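(* Let $K$ be a field of characteristic $0$. The cocharacter sequence of the ideal $I(M_3(K),so_3(K))$ of weak polynomial identities of the pair $(M_3(K),so_3(K))$ is \[ \chi_n(M_3(K),so_3(K))=\sum_{\nu\vdash n,\ \nu=(\nu_1,\nu_2,\nu_3)} m_\nu(M_3(K),so_3(K))\,\chi_\nu ,\qquad n=0,1,2,\dots, \] (the sum running over partitions of $n$ with at most three parts), where $m_{(2k,0,0)}(M_3(K),so_3(K))=1$ for $k=1,2,\dots$, and for every other partition $\nu=(\nu_1,\nu_2,\nu_3)$ (i.e. $\nu\notin\{(2k,0,0)\mid k\ge1\}$) we have $m_\nu(M_3(K),so_3(K))=m_\nu$, where $m_\nu$ is defined as follows: (i) if $\nu_1\equiv\nu_2\equiv\nu_3 \pmod 2$: $m_\nu=3$ if $\nu_1>\nu_2>\nu_3$; $m_\nu=2$ if $\nu_1=\nu_2>\nu_3$; $m_\nu=2$ if $\nu_1>\nu_2=\nu_3$; $m_\nu=1$ if $\nu_1=\nu_2=\nu_3$; (ii) if $\nu_1\equiv\nu_2\not\equiv\nu_3\pmod 2$: $m_\nu=2$ if $\nu_1>\nu_2$, and $m_\nu=1$ if $\nu_1=\nu_2$; (iii) if $\nu_1\equiv\nu_3\not\equiv\nu_2\pmod 2$: $m_\nu=2$; (iv) if $\nu_1\not\equiv\nu_2\equiv\nu_3\pmod 2$: $m_\nu=2$ if $\nu_2>\nu_3$, and $m_\nu=1$ if $\nu_2=\nu_3$.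
   Context: $so_3(K)$ denotes the Lie algebra of $3\times 3$ skew-symmetric matrices over $K$, a Lie subalgebra of $M_3(K)^{(-)}$ (commutator bracket). $K\langle X\rangle=K\langle x_1,x_2,\dots\rangle$ is the free associative algebra. A polynomial $f(x_1,\dots,x_n)\in K\langle X\rangle$ is a weak polynomial identity of the pair $(M_3(K),so_3(K))$ if $f(a_1,\dots,a_n)=0$ in $M_3(K)$ for all $a_1,\dots,a_n\in so_3(K)$; these form an ideal $I(M_3(K),so_3(K))$. Let $P_n\subset K\langle X\rangle$ be the space of multilinear polynomials in $x_1,\dots,x_n$, with the natural left action of the symmetric group $S_n$ permuting variables; $P_n\cap I(M_3(K),so_3(K))$ is an $S_n$-submodule. The cocharacter $\chi_n(M_3(K),so_3(K))$ is the $S_n$-character of $P_n/(P_n\cap I(M_3(K),so_3(K)))$, and $\chi_\nu$ is the irreducible $S_n$-character indexed by the partition $\nu\vdash n$. *)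

theory Defs
  imports "HOL-Analysis.Analysis" "HOL-Library.Function_Algebras" "HOL-Combinatorics.Permutations"
begin

definition fscale :: "'k::field \<Rightarrow> ('g \<Rightarrow> 'k) \<Rightarrow> ('g \<Rightarrow> 'k)" where
  "fscale c f = (\<lambda>x. c * f x)"

text \<open>Trace of a linear map T on the quotient space V/W (W \<subseteq> V, both T-invariant,
  V finite dimensional): pick a basis BW of W, extend it to a basis B of V; the cosets
  of B - BW form a basis of V/W and the trace is the sum of the diagonal coordinates.\<close>

definition qtrace ::
  "('g \<Rightarrow> 'k::field) set \<Rightarrow> ('g \<Rightarrow> 'k) set \<Rightarrow> (('g \<Rightarrow> 'k) \<Rightarrow> ('g \<Rightarrow> 'k)) \<Rightarrow> 'k" where
  "qtrace V W T =
    (let BW = (SOME B. module.independent fscale B \<and> module.span fscale B = W);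
         BV = (SOME B. BW \<subseteq> B \<and> module.independent fscale B \<and> module.span fscale B = V)
     in \<Sum>b\<in>BV - BW. module.representation fscale BV (T b) b)"

definition Sn :: "nat \<Rightarrow> (nat \<Rightarrow> nat) set" where
  "Sn n = {p. p permutes {..<n}}"

text \<open>P_n: a multilinear polynomial is given by its coefficient function c, where
  c \<sigma> is the coefficient of the monomial x_(\<sigma> 0) x_(\<sigma> 1) ... x_(\<sigma> (n-1)).
  The same space serves as the group algebra K S_n.\<close>

definition Pn :: "nat \<Rightarrow> ((nat \<Rightarrow> nat) \<Rightarrow> 'k::field) set" where
  "Pn n = {c. \<forall>\<sigma>. \<sigma> \<notin> Sn n \<longrightarrow> c \<sigma> = 0}"

text \<open>Left action of \<tau> \<in> S_n: x_i \<mapsto> x_(\<tau> i), i.e. the monomial indexed by \<sigma> goes to the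
  one indexed by \<tau> \<circ> \<sigma>. (Equivalently, left multiplication by \<tau> in K S_n.)\<close>

definition act :: "(nat \<Rightarrow> nat) \<Rightarrow> ((nat \<Rightarrow> nat) \<Rightarrow> 'k::field) \<Rightarrow> ((nat \<Rightarrow> nat) \<Rightarrow> 'k)" where
  "act \<tau> c = (\<lambda>\<rho>. c (inv \<tau> \<circ> \<rho>))"

definition so3 :: "('k::field ^ 3 ^ 3) set" where
  "so3 = {A. transpose A = - A}"

definition monom_eval :: "nat \<Rightarrow> (nat \<Rightarrow> nat) \<Rightarrow> (nat \<Rightarrow> 'k::field ^ 3 ^ 3) \<Rightarrow> 'k ^ 3 ^ 3" where
  "monom_eval n \<sigma> a = foldr (\<lambda>i M. a (\<sigma> i) ** M) [0..<n] (mat 1)"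

definition eval_multilin :: "nat \<Rightarrow> ((nat \<Rightarrow> nat) \<Rightarrow> 'k::field) \<Rightarrow> (nat \<Rightarrow> 'k ^ 3 ^ 3) \<Rightarrow> 'k ^ 3 ^ 3" where
  "eval_multilin n c a = (\<Sum>\<sigma>\<in>Sn n. (\<chi> i j. c \<sigma> * monom_eval n \<sigma> a $ i $ j))"

definition weak_ids_Pn :: "nat \<Rightarrow> ((nat \<Rightarrow> nat) \<Rightarrow> 'k::field) set" where
  "weak_ids_Pn n = {c \<in> Pn n. \<forall>a. (\<forall>i<n. a i \<in> (so3 :: ('k ^ 3 ^ 3) set)) \<longrightarrow> eval_multilin n c a = 0}"

definition cochar :: "nat \<Rightarrow> (nat \<Rightarrow> nat) \<Rightarrow> 'k::field" where
  "cochar n \<tau> = qtrace (Pn n) (weak_ids_Pn n) (act \<tau>)"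

definition conv :: "nat \<Rightarrow> ((nat \<Rightarrow> nat) \<Rightarrow> 'k::field) \<Rightarrow> ((nat \<Rightarrow> nat) \<Rightarrow> 'k) \<Rightarrow> ((nat \<Rightarrow> nat) \<Rightarrow> 'k)" where
  "conv n f h = (\<lambda>\<rho>. \<Sum>\<sigma>\<in>Sn n. f \<sigma> * h (inv \<sigma> \<circ> \<rho>))"

text \<open>Young tableau of shape (a,b,c) filled row by row with 0,...,n-1.\<close>

definition tab_row :: "nat \<times> nat \<times> nat \<Rightarrow> nat \<Rightarrow> nat" where
  "tab_row \<nu> k = (case \<nu> of (a,b,c) \<Rightarrow> if k < a then 0 else if k < a + b then 1 else 2)"

definition tab_col :: "nat \<times> nat \<times> nat \<Rightarrow> nat \<Rightarrow> nat" where
  "tab_col \<nu> k = (case \<nu> of (a,b,c) \<Rightarrow> if k < a then k else if k < a + b then k - a else k - a - b)"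

definition size3 :: "nat \<times> nat \<times> nat \<Rightarrow> nat" where
  "size3 \<nu> = (case \<nu> of (a,b,c) \<Rightarrow> a + b + c)"

definition row_group :: "nat \<times> nat \<times> nat \<Rightarrow> (nat \<Rightarrow> nat) set" where
  "row_group \<nu> = {p \<in> Sn (size3 \<nu>). \<forall>k < size3 \<nu>. tab_row \<nu> (p k) = tab_row \<nu> k}"

definition col_group :: "nat \<times> nat \<times> nat \<Rightarrow> (nat \<Rightarrow> nat) set" where
  "col_group \<nu> = {p \<in> Sn (size3 \<nu>). \<forall>k < size3 \<nu>. tab_col \<nu> (p k) = tab_col \<nu> k}"

definition young_sym :: "nat \<times> nat \<times> nat \<Rightarrow> ((nat \<Rightarrow> nat) \<Rightarrow> 'k::field)" where
  "young_sym \<nu> = conv (size3 \<nu>)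
      (\<lambda>\<sigma>. if \<sigma> \<in> row_group \<nu> then 1 else 0)
      (\<lambda>\<sigma>. if \<sigma> \<in> col_group \<nu> then of_int (sign \<sigma>) else 0)"

definition specht :: "nat \<times> nat \<times> nat \<Rightarrow> ((nat \<Rightarrow> nat) \<Rightarrow> 'k::field) set" where
  "specht \<nu> = {conv (size3 \<nu>) f (young_sym \<nu>) | f. f \<in> Pn (size3 \<nu>)}"

definition irr_char :: "nat \<times> nat \<times> nat \<Rightarrow> (nat \<Rightarrow> nat) \<Rightarrow> 'k::field" where
  "irr_char \<nu> \<tau> = qtrace (specht \<nu>) {0} (act \<tau>)"

definition partitions3 :: "nat \<Rightarrow> (nat \<times> nat \<times> nat) set" where
  "partitions3 n = {(a,b,c). a \<ge> b \<and> b \<ge> c \<and> a + b + c = n}"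

definition m_nu :: "nat \<times> nat \<times> nat \<Rightarrow> nat" where
  "m_nu \<nu> = (case \<nu> of (a,b,c) \<Rightarrow>
     if even a = even b \<and> even b = even c then
        (if a > b \<and> b > c then 3 else if a = b \<and> b > c then 2
         else if a > b \<and> b = c then 2 else 1)
     else if even a = even b \<and> even b \<noteq> even c then (if a > b then 2 else 1)
     else if even a = even c \<and> even a \<noteq> even b then 2
     else (if b > c then 2 else 1))"

definition mult_so3 :: "nat \<times> nat \<times> nat \<Rightarrow> nat" where
  "mult_so3 \<nu> = (case \<nu> of (a,b,c) \<Rightarrow>
     if b = 0 \<and> c = 0 \<and> even a \<and> a \<ge> 2 then 1 else m_nu \<nu>)"

end

theory Submission
  imports Defs
begin

text \<open>Let \<open>A\<close> be the group algebra \<open>K S\<^sub>n\<close> (the space \<open>Pn n\<close> under \<open>conv n\<close>), \<open>I\<close> the left ideal of weak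
  identities and \<open>e\<^sub>\<nu> = R\<^sub>\<nu> C\<^sub>\<nu>\<close> a Young symmetrizer (row sum times signed column sum).
  By Maschke's theorem \<open>A\<close> is von Neumann regular, so it suffices to know \<open>e\<^sub>\<nu> A e\<^sub>\<nu> = K e\<^sub>\<nu>\<close>,
  \<open>e\<^sub>\<mu> A e\<^sub>\<nu> = 0\<close> for \<open>\<mu> \<noteq> \<nu>\<close>, and \<open>A = I + (\<Sum>\<nu>. A e\<^sub>\<nu> A)\<close>, to conclude that \<open>A/I\<close> is the sum of the
  Specht modules \<open>A e\<^sub>\<nu>\<close> taken \<open>dim (e\<^sub>\<nu> A / e\<^sub>\<nu> I)\<close> times. All three facts come from a straightening
  procedure: if \<open>v\<close> is fixed by the row group and killed by all row sums with a letter moved to a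
  higher row, then \<open>R\<^sub>\<nu> g v\<close> is a multiple of \<open>v\<close> for every permutation \<open>g\<close>.

  A multilinear polynomial in \<open>e\<^sub>\<nu> A\<close> is a highest weight vector for mixing its rows and is equivariant
  for \<open>so\<^sub>3\<close>. As \<open>gl\<^sub>3\<close> is spanned by \<open>so\<^sub>3\<close> and the upper triangular matrices, the polynomial is
  determined by its value \<open>X\<close> when row \<open>i\<close> is replaced by the \<open>i\<close>-th standard basis element of \<open>so\<^sub>3\<close>.
  Conjugation by diagonal sign matrices leaves at most three (for equal parities) or two nonzero
  entries of \<open>X\<close>, and equal rows of \<open>\<nu>\<close> force \<open>X\<close> to commute with a rotation. All remaining matrices
  occur as values of products of column polynomials, except for \<open>\<nu> = (2k, 0, 0)\<close>, where the only
  value is \<open>x\<^sup>2\<^sup>k\<close>.\<close>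

subsection \<open>Traces on function spaces\<close>

text \<open>Multiplicities come from an explicit decomposition of \<open>Pn n\<close> into the weak
  identities and copies of Specht modules; traces are then added over the summands. Only three rows
  occur because \<open>so3\<close> has dimension three: a multilinear polynomial is tested on words
  in three letters. Each multiplicity space is identified with a space of 3 x 3 matrices and its
  dimension is found from two sides: symmetry restricts the matrices, explicit polynomials realize
  the rest. The obstacle in the upper bound is that values are compatible only with
  \<open>so3\<close>, whereas the highest weight condition concerns upper triangular substitutions;
  both have to be used in turn while a word is brought closer to the highest weight word. For (2k,
  0, 0) symmetry alone would leave all matrices diag(p, q, q). In other shapes with equal parities
  and \<nu>\<open>\<^sub>1\<close> > \<nu>\<open>\<^sub>2\<close> = \<nu>\<open>\<^sub>3\<close> the
  second dimension is realized by a column of length three that surrounds the columns of length one,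
  and a shape with one row has no such column.\<close>

interpretation FS: vector_space "fscale :: 'k::field \<Rightarrow> ('g \<Rightarrow> 'k) \<Rightarrow> 'g \<Rightarrow> 'k"
  by unfold_locales (auto simp: fscale_def fun_eq_iff algebra_simps)

interpretation FSP: vector_space_pair "fscale :: 'k::field \<Rightarrow> ('g \<Rightarrow> 'k) \<Rightarrow> 'g \<Rightarrow> 'k"
  "fscale :: 'k::field \<Rightarrow> ('h \<Rightarrow> 'k) \<Rightarrow> 'h \<Rightarrow> 'k" ..

abbreviation flinear :: "(('g \<Rightarrow> 'k::field) \<Rightarrow> 'h \<Rightarrow> 'k) \<Rightarrow> bool" where
  "flinear \<equiv> Vector_Spaces.linear fscale fscale"

lemma sum_fun_apply: "(\<Sum>i\<in>A. f i) x = (\<Sum>i\<in>A. (f i x :: 'k::comm_monoid_add))"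
  by (induction A rule: infinite_finite_induct) auto

lemma flinear_iff:
  "flinear T \<longleftrightarrow> (\<forall>x y. T (x + y) = T x + T y) \<and> (\<forall>c x. T (fscale c x) = fscale c (T x))"
  by (auto simp: Vector_Spaces.linear_iff FS.vector_space_axioms)

lemma flinearI:
  assumes "\<And>x y. T (x + y) = T x + T y" "\<And>c x. T (fscale c x) = fscale c (T x)"
  shows "flinear T"
  using assms by (simp add: flinear_iff)

lemma flinear_add: "flinear T \<Longrightarrow> T (x + y) = T x + T y"
  by (simp add: flinear_iff)

lemma flinear_scale: "flinear T \<Longrightarrow> T (fscale c x) = fscale c (T x)"
  by (simp add: flinear_iff)

lemma flinear_zero: "flinear T \<Longrightarrow> T 0 = 0"
  by (rule FSP.linear_0)

lemma flinear_sum: "flinear T \<Longrightarrow> T (\<Sum>x\<in>A. g x) = (\<Sum>x\<in>A. T (g x))"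
  by (rule FSP.linear_sum)

definition basis_trace :: "('g \<Rightarrow> 'k::field) set \<Rightarrow> (('g \<Rightarrow> 'k) \<Rightarrow> 'g \<Rightarrow> 'k) \<Rightarrow> 'k" where
  "basis_trace B T = (\<Sum>b\<in>B. FS.representation B (T b) b)"

lemma representation_sum_scale:
  assumes "FS.independent B" "\<And>i. i \<in> I \<Longrightarrow> v i \<in> FS.span B"
  shows "FS.representation B (\<Sum>i\<in>I. fscale (c i) (v i)) b = (\<Sum>i\<in>I. c i * FS.representation B (v i) b)"
proof -
  have "FS.representation B (\<Sum>i\<in>I. fscale (c i) (v i)) b = (\<Sum>i\<in>I. FS.representation B (fscale (c i) (v i)) b)"
    using assms by (subst FS.representation_sum) (auto simp: FS.span_scale)
  then show ?thesis using assms by (simp add: FS.representation_scale)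
qed

text \<open>Expanding the elements of each basis in the other one and exchanging the sums is the
  identity tr(PQ) = tr(QP).\<close>

lemma basis_trace_cong:
  assumes B: "finite B" "FS.independent B" and B': "finite B'" "FS.independent B'"
    and sp: "FS.span B = FS.span B'" and T: "flinear T" "T ` FS.span B \<subseteq> FS.span B"
  shows "basis_trace B T = basis_trace B' T"
proof -
  let ?r = "FS.representation B" and ?r' = "FS.representation B'"
  have in_span: "T x \<in> FS.span B'" if "x \<in> FS.span B'" for x using T(2) sp that by auto
  have m: "b' \<in> FS.span B" if "b' \<in> B'" for b' using that sp FS.span_base by auto
  have m': "T b \<in> FS.span B'" if "b \<in> B" for b using that in_span sp FS.span_base by auto
  have "basis_trace B T = (\<Sum>b\<in>B. ?r (\<Sum>b'\<in>B'. fscale (?r' (T b) b') b') b)"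
    unfolding basis_trace_def
    by (intro sum.cong refl, subst FS.sum_representation_eq) (use B' m' in auto)
  also have "\<dots> = (\<Sum>b\<in>B. \<Sum>b'\<in>B'. ?r' (T b) b' * ?r b' b)"
    by (simp add: representation_sum_scale[OF B(2)] m)
  also have "\<dots> = (\<Sum>b'\<in>B'. \<Sum>b\<in>B. ?r b' b * ?r' (T b) b')"
    by (subst sum.swap) (simp add: mult.commute)
  also have "\<dots> = (\<Sum>b'\<in>B'. ?r' (T (\<Sum>b\<in>B. fscale (?r b' b) b)) b')"
    by (simp add: flinear_sum[OF T(1)] flinear_scale[OF T(1)] representation_sum_scale[OF B'(2)] m')
  also have "\<dots> = basis_trace B' T"
    unfolding basis_trace_def
    by (intro sum.cong refl, subst FS.sum_representation_eq) (use B sp FS.span_base in auto)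
  finally show ?thesis .
qed

lemma basis_of_subspace_ex:
  assumes "FS.subspace V"
  shows "\<exists>B. FS.independent B \<and> FS.span B = V"
  using FS.basis_exists[of V] assms by (metis FS.span_subspace)

lemma basis_of_subspace_extend:
  assumes "FS.subspace V" "FS.independent B" "FS.span B \<subseteq> V"
  shows "\<exists>B'. B \<subseteq> B' \<and> FS.independent B' \<and> FS.span B' = V"
  using FS.maximal_independent_subset_extend[of B V] assms FS.span_superset[of B]
  by (metis FS.span_subspace subset_trans)

definition sub_trace :: "('g \<Rightarrow> 'k::field) set \<Rightarrow> (('g \<Rightarrow> 'k) \<Rightarrow> 'g \<Rightarrow> 'k) \<Rightarrow> 'k" where
  "sub_trace V T = basis_trace (SOME B. FS.independent B \<and> FS.span B = V) T"

text \<open>The functions have an arbitrary domain, in the application all of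
  \<open>nat \<Rightarrow> nat\<close>, so finiteness of the dimension is recorded for
  subspaces.\<close>

definition findim :: "('g \<Rightarrow> 'k::field) set \<Rightarrow> bool" where
  "findim V \<longleftrightarrow> (\<exists>S. finite S \<and> V \<subseteq> FS.span S)"

lemma findim_mono: "findim V \<Longrightarrow> U \<subseteq> V \<Longrightarrow> findim U"
  unfolding findim_def by blast

lemma findim_finite: "findim V \<Longrightarrow> FS.independent B \<Longrightarrow> FS.span B \<subseteq> V \<Longrightarrow> finite B"
  unfolding findim_def using FS.independent_span_bound FS.span_superset by (metis subset_trans)

lemma findim_image:
  assumes "findim V" "flinear T" shows "findim (T ` V)"
proof -
  obtain S where S: "finite S" "V \<subseteq> FS.span S" using assms unfolding findim_def by auto
  have "T ` V \<subseteq> FS.span (T ` S)"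
    using S FSP.linear_span_image[OF assms(2), of S] by auto
  then show ?thesis using S unfolding findim_def by blast
qed

lemma sub_trace_eq:
  assumes "findim V" "FS.independent B" "FS.span B = V" "flinear T" "T ` V \<subseteq> V"
  shows "sub_trace V T = basis_trace B T"
proof -
  have "\<exists>B. FS.independent B \<and> FS.span B = V" using assms by blast
  from someI_ex[OF this] show ?thesis
    unfolding sub_trace_def using assms findim_finite
    by (intro basis_trace_cong) auto
qed

text \<open>The basis chosen for V extends the one chosen for W and T preserves W, so T is block
  triangular: its diagonal coordinates over \<open>BW\<close> are those of T on W.\<close>

lemma qtrace_eq:
  assumes V: "findim V" "FS.subspace V" "T ` V \<subseteq> V"
    and W: "FS.subspace W" "W \<subseteq> V" "T ` W \<subseteq> W" and T: "flinear T"
  shows "qtrace V W T = sub_trace V T - sub_trace W T"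
proof -
  define BW where "BW = (SOME B. FS.independent B \<and> FS.span B = W)"
  have BW: "FS.independent BW" "FS.span BW = W"
    using someI_ex[OF basis_of_subspace_ex[OF W(1)]] unfolding BW_def by auto
  define BV where "BV = (SOME B. BW \<subseteq> B \<and> FS.independent B \<and> FS.span B = V)"
  have BV: "BW \<subseteq> BV" "FS.independent BV" "FS.span BV = V"
    using someI_ex[OF basis_of_subspace_extend[OF V(2) BW(1)]] BW W unfolding BV_def by auto
  have fin: "finite BV" using findim_finite BV V by blast
  have "qtrace V W T = (\<Sum>b\<in>BV - BW. FS.representation BV (T b) b)"
    unfolding qtrace_def BW_def BV_def by (simp add: Let_def)
  also have "\<dots> = basis_trace BV T - (\<Sum>b\<in>BW. FS.representation BV (T b) b)"
    unfolding basis_trace_def using fin BV(1) by (simp add: sum_diff)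
  also have "(\<Sum>b\<in>BW. FS.representation BV (T b) b) = basis_trace BW T"
    unfolding basis_trace_def
  proof (intro sum.cong refl)
    fix b assume "b \<in> BW"
    then have "T b \<in> FS.span BW" using BW W FS.span_base by blast
    then show "FS.representation BV (T b) b = FS.representation BW (T b) b"
      using FS.representation_extend[OF BV(2) _ BV(1)] by simp
  qed
  also have "basis_trace BV T = sub_trace V T" using sub_trace_eq[OF V(1) BV(2,3) T V(3)] by simp
  also have "basis_trace BW T = sub_trace W T"
    using sub_trace_eq[OF findim_mono[OF V(1) W(2)] BW T W(3)] by simp
  finally show ?thesis .
qed

lemma sub_trace_0: "flinear T \<Longrightarrow> sub_trace {0} T = 0"
  by (subst sub_trace_eq[of _ "{}"])
    (auto simp: basis_trace_def findim_def flinear_zero FS.independent_empty intro!: exI[of _ "{}"])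

text \<open>An injective intertwiner carries a basis to a basis and keeps the coordinates. This
  serves to compare a copy of a Specht module inside \<open>Pn n\<close> with the Specht module
  itself.\<close>

lemma sub_trace_iso:
  assumes V: "findim V" "FS.subspace V" "T ` V \<subseteq> V" and T: "flinear T" "flinear T'"
    and h: "flinear h" "inj_on h V" "\<And>x. x \<in> V \<Longrightarrow> h (T x) = T' (h x)"
  shows "sub_trace (h ` V) T' = sub_trace V T"
proof -
  obtain B where B: "FS.independent B" "FS.span B = V" using basis_of_subspace_ex[OF V(2)] by auto
  have fin: "finite B" using findim_finite[OF V(1) B(1)] B by simp
  have BV: "B \<subseteq> V" using B FS.span_superset by blast
  have inj: "inj_on h B" using h(2) BV inj_on_subset by blast
  have iB: "FS.independent (h ` B)"
    using FSP.linear_independent_injective_image[OF h(1) B(1)] B(2) h(2) by simp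
  have sB: "FS.span (h ` B) = h ` V" using FSP.linear_span_image[OF h(1)] B by simp
  have "sub_trace (h ` V) T' = basis_trace (h ` B) T'"
  proof (rule sub_trace_eq[OF findim_image[OF V(1) h(1)] iB sB T(2)])
    show "T' ` h ` V \<subseteq> h ` V" using h(3) V(3) by (auto simp flip: h(3))
  qed
  also have "\<dots> = (\<Sum>b\<in>B. FS.representation (h ` B) (h (T b)) (h b))"
    unfolding basis_trace_def sum.reindex[OF inj] o_def
    by (intro sum.cong refl) (use h(3) BV in auto)
  also have "\<dots> = (\<Sum>b\<in>B. FS.representation B (T b) b)"
  proof (intro sum.cong refl)
    fix b assume b: "b \<in> B"
    have Tb: "T b \<in> FS.span B" using b BV V(3) B(2) by auto
    let ?r = "FS.representation B (T b)"
    define g where "g = (\<lambda>v. if v \<in> h ` B then ?r (the_inv_into B h v) else 0)"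
    have g: "g (h x) = ?r x" if "x \<in> B" for x
      using that inj by (simp add: g_def the_inv_into_f_f)
    have "FS.representation (h ` B) (h (T b)) = g"
    proof (rule FS.representation_eqI[OF iB])
      have "h (T b) = h (\<Sum>b\<in>B. fscale (?r b) b)"
        by (subst FS.sum_representation_eq[OF B(1) Tb fin]) auto
      also have "\<dots> = (\<Sum>b\<in>B. fscale (g (h b)) (h b))"
        using g by (simp add: flinear_sum[OF h(1)] flinear_scale[OF h(1)])
      also have "\<dots> = (\<Sum>v\<in>h ` B. fscale (g v) v)" by (subst sum.reindex[OF inj]) simp
      finally have eq: "h (T b) = (\<Sum>v\<in>h ` B. fscale (g v) v)" .
      show "finite {v. g v \<noteq> 0}"
        by (rule finite_subset[of _ "h ` B"]) (use fin in \<open>auto simp: g_def split: if_splits\<close>)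
      have "(\<Sum>v | g v \<noteq> 0. fscale (g v) v) = (\<Sum>v\<in>h ` B. fscale (g v) v)"
        by (rule sum.mono_neutral_left) (use fin in \<open>auto simp: g_def split: if_splits\<close>)
      then show "(\<Sum>v | g v \<noteq> 0. fscale (g v) v) = h (T b)" using eq by simp
      show "h (T b) \<in> FS.span (h ` B)" using sB Tb B(2) by auto
      show "\<And>v. g v \<noteq> 0 \<Longrightarrow> v \<in> h ` B" by (auto simp: g_def split: if_splits)
    qed
    then show "FS.representation (h ` B) (h (T b)) (h b) = ?r b" using g b by simp
  qed
  also have "\<dots> = sub_trace V T"
    using sub_trace_eq[OF V(1) B T(1) V(3)] by (simp add: basis_trace_def)
  finally show ?thesis .
qed

lemma sub_trace_sum:
  assumes U: "findim U" "FS.subspace U" "T ` U \<subseteq> U" and W: "findim W" "FS.subspace W" "T ` W \<subseteq> W"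
    and int: "U \<inter> W \<subseteq> {0}" and T: "flinear T"
  shows "sub_trace {x + y |x y. x \<in> U \<and> y \<in> W} T = sub_trace U T + sub_trace W T" (is "sub_trace ?S T = _")
    and "findim {x + y |x y. x \<in> U \<and> y \<in> W}"
    and "FS.subspace {x + y |x y. x \<in> U \<and> y \<in> W}"
    and "T ` {x + y |x y. x \<in> U \<and> y \<in> W} \<subseteq> {x + y |x y. x \<in> U \<and> y \<in> W}"
proof -
  obtain B where B: "FS.independent B" "FS.span B = U" using basis_of_subspace_ex[OF U(2)] by auto
  obtain C where C: "FS.independent C" "FS.span C = W" using basis_of_subspace_ex[OF W(2)] by auto
  have fin: "finite B" "finite C" using findim_finite B C U W by auto
  have sp: "FS.span (B \<union> C) = ?S" using B C by (simp add: FS.span_Un)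
  show fd: "findim ?S" using fin sp unfolding findim_def by (intro exI[of _ "B \<union> C"]) auto
  show sub: "FS.subspace ?S" using sp FS.subspace_span by metis
  show st: "T ` ?S \<subseteq> ?S" using U(3) W(3) flinear_add[OF T] by blast
  have BU: "B \<subseteq> U" "C \<subseteq> W" using B C FS.span_superset by blast+
  have disj: "B \<inter> C = {}"
    using int BU B(1) FS.dependent_zero[of B] by blast
  have ind: "FS.independent (B \<union> C)"
    unfolding FS.dependent_finite[OF finite_UnI[OF fin]]
  proof (rule notI, elim exE bexE conjE)
    fix u x assume 0: "(\<Sum>v\<in>B \<union> C. fscale (u v) v) = 0" and x: "x \<in> B \<union> C" "u x \<noteq> 0"
    have eq: "(\<Sum>v\<in>B. fscale (u v) v) + (\<Sum>v\<in>C. fscale (u v) v) = 0"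
      using 0 fin disj by (simp add: sum.union_disjoint)
    have "(\<Sum>v\<in>B. fscale (u v) v) \<in> U" using BU U(2) by (intro FS.subspace_sum FS.subspace_scale) auto
    moreover have c: "(\<Sum>v\<in>C. fscale (u v) v) \<in> W" using BU W(2) by (intro FS.subspace_sum FS.subspace_scale) auto
    moreover have "(\<Sum>v\<in>B. fscale (u v) v) = - (\<Sum>v\<in>C. fscale (u v) v)"
      using eq by (simp add: eq_neg_iff_add_eq_0)
    ultimately have "(\<Sum>v\<in>B. fscale (u v) v) = 0"
      using int FS.subspace_neg[OF W(2) c] by auto
    moreover from this eq have "(\<Sum>v\<in>C. fscale (u v) v) = 0" by simp
    ultimately show False
      using x FS.independentD[OF B(1) fin(1) subset_refl] FS.independentD[OF C(1) fin(2) subset_refl] by blast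
  qed
  have "sub_trace ?S T = basis_trace (B \<union> C) T" by (rule sub_trace_eq[OF fd ind sp T st])
  also have "\<dots> = (\<Sum>b\<in>B. FS.representation (B \<union> C) (T b) b) + (\<Sum>b\<in>C. FS.representation (B \<union> C) (T b) b)"
    unfolding basis_trace_def using fin disj by (simp add: sum.union_disjoint)
  also have "(\<Sum>b\<in>B. FS.representation (B \<union> C) (T b) b) = basis_trace B T"
    unfolding basis_trace_def
    by (intro sum.cong refl, subst FS.representation_extend[OF ind]) (use B BU U in auto)
  also have "(\<Sum>b\<in>C. FS.representation (B \<union> C) (T b) b) = basis_trace C T"
    unfolding basis_trace_def
    by (intro sum.cong refl, subst FS.representation_extend[OF ind]) (use C BU W in auto)
  finally show "sub_trace ?S T = sub_trace U T + sub_trace W T"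
    unfolding sub_trace_eq[OF U(1) B T U(3)] sub_trace_eq[OF W(1) C T W(3)] .
qed

text \<open>Directness is expressed relative to W: a sum of elements of the \<open>S j\<close> that
  falls into W has only zero terms. Induction on J then adds one summand at a time.\<close>

lemma sub_trace_direct_sum:
  assumes J: "finite J" and W: "findim W" "FS.subspace W" "T ` W \<subseteq> W" and T: "flinear T"
    and S: "\<And>j. j \<in> J \<Longrightarrow> findim (S j) \<and> FS.subspace (S j) \<and> T ` S j \<subseteq> S j"
    and ind: "\<And>x. (\<And>j. j \<in> J \<Longrightarrow> x j \<in> S j) \<Longrightarrow> (\<Sum>j\<in>J. x j) \<in> W \<Longrightarrow> \<forall>j\<in>J. x j = 0"
  shows "let N = {w + (\<Sum>j\<in>J. x j) |w x. w \<in> W \<and> (\<forall>j\<in>J. x j \<in> S j)} in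
    sub_trace N T = sub_trace W T + (\<Sum>j\<in>J. sub_trace (S j) T) \<and> findim N \<and> FS.subspace N \<and> T ` N \<subseteq> N"
  unfolding Let_def using J S ind
proof (induction J)
  case empty
  show ?case using W by auto
next
  case (insert i J)
  let ?X = "{w + (\<Sum>j\<in>J. x j) |w x. w \<in> W \<and> (\<forall>j\<in>J. x j \<in> S j)}"
  let ?Y = "{w + (\<Sum>j\<in>insert i J. x j) |w x. w \<in> W \<and> (\<forall>j\<in>insert i J. x j \<in> S j)}"
  have IH: "sub_trace ?X T = sub_trace W T + (\<Sum>j\<in>J. sub_trace (S j) T) \<and>
    findim ?X \<and> FS.subspace ?X \<and> T ` ?X \<subseteq> ?X"
  proof (rule insert.IH)
    fix j assume "j \<in> J" then show "findim (S j) \<and> FS.subspace (S j) \<and> T ` S j \<subseteq> S j"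
      using insert.prems(1) by blast
  next
    fix x assume x: "\<And>j. j \<in> J \<Longrightarrow> x j \<in> S j" "sum x J \<in> W"
    \<comment> \<open>A family on J is extended by 0 at i, so that independence over
      \<open>insert i J\<close> applies.\<close>
    have "\<forall>j\<in>insert i J. (x(i := 0)) j = 0"
    proof (rule insert.prems(2))
      show "(x(i := 0)) j \<in> S j" if "j \<in> insert i J" for j
        using x that insert.prems(1)[of i] FS.subspace_0 by auto
      have "sum (x(i := 0)) (insert i J) = sum x J"
        using insert.hyps by (auto intro!: sum.cong)
      then show "sum (x(i := 0)) (insert i J) \<in> W" using x by simp
    qed
    then show "\<forall>j\<in>J. x j = 0" using insert.hyps(2) by (metis fun_upd_other insertCI)
  qed
  have Si: "findim (S i)" "FS.subspace (S i)" "T ` S i \<subseteq> S i" using insert.prems(1) by auto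
  have int: "?X \<inter> S i \<subseteq> {0}"
  proof
    fix z assume z: "z \<in> ?X \<inter> S i"
    then obtain w x where wx: "z = w + (\<Sum>j\<in>J. x j)" "w \<in> W" "\<forall>j\<in>J. x j \<in> S j" by auto
    \<comment> \<open>With \<open>- z\<close> at i the whole family sums to \<open>- w\<close>, an
      element of W.\<close>
    define y where "y = (\<lambda>j. if j = i then - z else x j)"
    have "\<forall>j\<in>insert i J. y j = 0"
    proof (rule insert.prems(2))
      show "y j \<in> S j" if "j \<in> insert i J" for j
        using that wx(3) z FS.subspace_neg[OF Si(2)] by (auto simp: y_def)
      have "sum y J = sum x J" using insert.hyps by (intro sum.cong) (auto simp: y_def)
      then have "sum y (insert i J) = - w" using insert.hyps wx(1) by (simp add: y_def)
      then show "sum y (insert i J) \<in> W" using FS.subspace_neg[OF W(2) wx(2)] by simp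
    qed
    then show "z \<in> {0}" by (auto simp: y_def)
  qed
  have eq: "?Y = {x + y |x y. x \<in> ?X \<and> y \<in> S i}"
  proof safe
    fix w x assume "w \<in> W" "\<forall>j\<in>insert i J. x j \<in> S j"
    then show "\<exists>xa y. w + sum x (insert i J) = xa + y \<and> xa \<in> ?X \<and> y \<in> S i"
      using insert.hyps by (intro exI[of _ "w + sum x J"] exI[of _ "x i"]) (auto simp: add_ac)
  next
    fix w x y assume a: "y \<in> S i" "w \<in> W" "\<forall>j\<in>J. x j \<in> S j"
    have s: "sum (x(i := y)) J = sum x J" using insert.hyps by (intro sum.cong) auto
    show "\<exists>wa xa. w + sum x J + y = wa + sum xa (insert i J) \<and> wa \<in> W \<and> (\<forall>j\<in>insert i J. xa j \<in> S j)"
      using a insert.hyps s by (intro exI[of _ w] exI[of _ "x(i := y)"]) (auto simp: add_ac)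
  qed
  show ?case
    unfolding eq using IH Si int T
      sub_trace_sum[of ?X T "S i"] insert.hyps by (simp add: add_ac)
qed

subsection \<open>The group algebra of the symmetric group\<close>

abbreviation tp :: "nat \<Rightarrow> nat \<Rightarrow> nat \<Rightarrow> nat" where
  "tp \<equiv> Transposition.transpose"

lemma Sn_finite [simp]: "finite (Sn n)"
  by (simp add: Sn_def finite_permutations)

lemma Sn_id [simp]: "id \<in> Sn n"
  by (simp add: Sn_def permutes_id)

lemma Sn_comp: "\<sigma> \<in> Sn n \<Longrightarrow> \<tau> \<in> Sn n \<Longrightarrow> \<sigma> \<circ> \<tau> \<in> Sn n"
  by (simp add: Sn_def permutes_compose)

lemma Sn_inv: "\<sigma> \<in> Sn n \<Longrightarrow> inv \<sigma> \<in> Sn n"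
  by (simp add: Sn_def permutes_inv)

lemma Sn_bij: "\<sigma> \<in> Sn n \<Longrightarrow> bij \<sigma>"
  by (auto simp: Sn_def permutes_bij)

lemma Sn_transpose: "x < n \<Longrightarrow> y < n \<Longrightarrow> tp x y \<in> Sn n"
  by (simp add: Sn_def permutes_swap_id)

lemma Sn_less: "\<sigma> \<in> Sn n \<Longrightarrow> \<sigma> k < n \<longleftrightarrow> k < n"
  unfolding Sn_def using permutes_in_image by fastforce

lemma Sn_inv_o [simp]: "\<sigma> \<in> Sn n \<Longrightarrow> inv \<sigma> \<circ> \<sigma> = id" "\<sigma> \<in> Sn n \<Longrightarrow> \<sigma> \<circ> inv \<sigma> = id"
  by (auto simp: Sn_def permutes_inv_o)

lemma Sn_inv_o_assoc: "\<sigma> \<in> Sn n \<Longrightarrow> inv \<sigma> \<circ> (\<sigma> \<circ> \<rho>) = \<rho>" "\<sigma> \<in> Sn n \<Longrightarrow> \<sigma> \<circ> (inv \<sigma> \<circ> \<rho>) = \<rho>"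
  by (simp_all add: comp_assoc[symmetric])

lemma Sn_inv_inv: "\<sigma> \<in> Sn n \<Longrightarrow> inv (inv \<sigma>) = \<sigma>"
  by (simp add: Sn_bij inv_inv_eq)

lemma Sn_comp_iff: "\<sigma> \<in> Sn n \<Longrightarrow> \<sigma> \<circ> \<rho> \<in> Sn n \<longleftrightarrow> \<rho> \<in> Sn n"
  by (metis Sn_comp Sn_inv Sn_inv_o_assoc(1))

lemma transpose_conj:
  assumes "bij g" shows "tp (g i) (g j) \<circ> g = g \<circ> tp i j"
  using assms by (auto simp: fun_eq_iff Transposition.transpose_def bij_def inj_eq)

lemma sum_Sn_left: "\<tau> \<in> Sn n \<Longrightarrow> (\<Sum>\<sigma>\<in>Sn n. F (\<tau> \<circ> \<sigma>)) = (\<Sum>\<sigma>\<in>Sn n. F \<sigma>)"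
  by (rule sum.reindex_bij_witness[of _ "\<lambda>\<sigma>. inv \<tau> \<circ> \<sigma>" "\<lambda>\<sigma>. \<tau> \<circ> \<sigma>"])
    (auto simp: Sn_comp Sn_inv Sn_inv_o_assoc)

lemma sum_Sn_right: "\<tau> \<in> Sn n \<Longrightarrow> (\<Sum>\<sigma>\<in>Sn n. F (\<sigma> \<circ> \<tau>)) = (\<Sum>\<sigma>\<in>Sn n. F \<sigma>)"
  by (rule sum.reindex_bij_witness[of _ "\<lambda>\<sigma>. \<sigma> \<circ> inv \<tau>" "\<lambda>\<sigma>. \<sigma> \<circ> \<tau>"])
    (auto simp: Sn_comp Sn_inv comp_assoc)

type_synonym 'k grpalg = "(nat \<Rightarrow> nat) \<Rightarrow> 'k"

lemma flinear_act: "flinear (act \<tau>)"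
  by (rule flinearI) (auto simp: act_def fscale_def fun_eq_iff)

lemmas act_add = flinear_add[OF flinear_act]
  and act_scale = flinear_scale[OF flinear_act]
  and act_zero [simp] = flinear_zero[OF flinear_act]
  and act_sum = flinear_sum[OF flinear_act]

lemma act_act: "\<sigma> \<in> Sn n \<Longrightarrow> \<tau> \<in> Sn n \<Longrightarrow> act \<sigma> (act \<tau> c) = act (\<sigma> \<circ> \<tau>) c"
  by (simp add: act_def o_inv_distrib Sn_bij comp_assoc)

lemma act_id [simp]: "act id c = c"
  by (simp add: act_def)

lemma conv_eq: "conv n f h = (\<Sum>\<sigma>\<in>Sn n. fscale (f \<sigma>) (act \<sigma> h))"
  by (auto simp: conv_def fun_eq_iff sum_fun_apply fscale_def act_def)

lemma flinear_conv: "flinear (conv n f)"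
  by (rule flinearI)
    (simp_all add: conv_eq act_add act_scale FS.scale_right_distrib sum.distrib FS.scale_sum_right mult.commute)

lemma flinear_conv_left: "flinear (\<lambda>f. conv n f h)"
proof (rule flinearI)
  show "conv n (fscale c x) h = fscale c (conv n x h)" for c x
    by (auto simp: conv_def fscale_def fun_eq_iff sum_distrib_left mult_ac)
  show "conv n (x + y) h = conv n x h + conv n y h" for x y
    by (auto simp: conv_def fun_eq_iff sum.distrib distrib_right)
qed

lemmas conv_add = flinear_add[OF flinear_conv] and conv_scale = flinear_scale[OF flinear_conv]
  and conv_zero [simp] = flinear_zero[OF flinear_conv] and conv_sum = flinear_sum[OF flinear_conv]
  and conv_add_left = flinear_add[OF flinear_conv_left] and conv_scale_left = flinear_scale[OF flinear_conv_left]
  and conv_zero_left [simp] = flinear_zero[OF flinear_conv_left] and conv_sum_left = flinear_sum[OF flinear_conv_left]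

lemma conv_diff: "conv n f (x - y) = conv n f x - conv n f y"
  using FSP.linear_diff[OF flinear_conv] .

lemma conv_diff_left: "conv n (x - y) f = conv n x f - conv n y f"
  using FSP.linear_diff[OF flinear_conv_left] .

lemma act_conv:
  assumes "\<tau> \<in> Sn n" shows "act \<tau> (conv n f h) = conv n (act \<tau> f) h"
proof -
  have "act \<tau> (conv n f h) = (\<Sum>\<sigma>\<in>Sn n. fscale (act \<tau> f (\<tau> \<circ> \<sigma>)) (act (\<tau> \<circ> \<sigma>) h))"
    unfolding conv_eq act_sum act_scale using assms
    by (intro sum.cong refl) (simp add: act_act Sn_inv_o_assoc, simp add: act_def Sn_inv_o_assoc)
  also have "\<dots> = conv n (act \<tau> f) h" unfolding conv_eq by (rule sum_Sn_left[OF assms])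
  finally show ?thesis .
qed

lemma conv_assoc: "conv n (conv n f g) h = conv n f (conv n g h)"
proof -
  have "conv n (conv n f g) h = (\<Sum>\<sigma>\<in>Sn n. conv n (fscale (f \<sigma>) (act \<sigma> g)) h)"
    unfolding conv_eq[of n f g] by (rule conv_sum_left)
  also have "\<dots> = (\<Sum>\<sigma>\<in>Sn n. fscale (f \<sigma>) (act \<sigma> (conv n g h)))"
    by (intro sum.cong refl) (simp add: conv_scale_left act_conv)
  finally show ?thesis by (simp add: conv_eq[of n f])
qed

definition delta :: "(nat \<Rightarrow> nat) \<Rightarrow> 'k::field grpalg" where
  "delta \<sigma> = (\<lambda>\<rho>. if \<rho> = \<sigma> then 1 else 0)"

lemma delta_Pn [simp]: "\<sigma> \<in> Sn n \<Longrightarrow> delta \<sigma> \<in> Pn n"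
  by (auto simp: delta_def Pn_def)

lemma conv_delta: "\<sigma> \<in> Sn n \<Longrightarrow> conv n (delta \<sigma>) h = act \<sigma> h"
proof -
  assume s: "\<sigma> \<in> Sn n"
  have "conv n (delta \<sigma>) h = (\<Sum>\<tau>\<in>Sn n. if \<tau> = \<sigma> then act \<tau> h else 0)"
    unfolding conv_eq by (intro sum.cong refl) (simp add: delta_def)
  then show ?thesis using s by simp
qed

lemma act_delta: "\<sigma> \<in> Sn n \<Longrightarrow> act \<sigma> (delta \<tau>) = delta (\<sigma> \<circ> \<tau>)"
  unfolding act_def delta_def by (rule ext) (metis Sn_inv_o_assoc)

lemma Pn_expand: "f \<in> Pn n \<Longrightarrow> f = (\<Sum>\<sigma>\<in>Sn n. fscale (f \<sigma>) (delta \<sigma>))"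
proof
  fix \<rho> assume f: "f \<in> Pn n"
  have "(\<Sum>\<sigma>\<in>Sn n. fscale (f \<sigma>) (delta \<sigma>)) \<rho> = (\<Sum>\<sigma>\<in>Sn n. if \<rho> = \<sigma> then f \<sigma> else 0)"
    unfolding sum_fun_apply by (intro sum.cong refl) (simp add: fscale_def delta_def)
  then show "f \<rho> = (\<Sum>\<sigma>\<in>Sn n. fscale (f \<sigma>) (delta \<sigma>)) \<rho>" using f by (simp add: Pn_def)
qed

lemma conv_unit: "f \<in> Pn n \<Longrightarrow> conv n f (delta id) = f"
  using Pn_expand[of f n] by (simp add: conv_eq act_delta)

lemma conv_unit_left: "conv n (delta id) f = f"
  by (simp add: conv_delta)

lemma subspace_Pn: "FS.subspace (Pn n)"
  by (rule FS.subspaceI) (auto simp: Pn_def fscale_def)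

lemma act_Pn: "\<tau> \<in> Sn n \<Longrightarrow> c \<in> Pn n \<Longrightarrow> act \<tau> c \<in> Pn n"
  unfolding Pn_def act_def using Sn_comp_iff[OF Sn_inv] by auto

lemma findim_Pn: "findim (Pn n)"
  unfolding findim_def
proof (intro exI[of _ "delta ` Sn n"] conjI subsetI)
  fix f :: "(nat \<Rightarrow> nat) \<Rightarrow> 'a" assume f: "f \<in> Pn n"
  have "(\<Sum>\<sigma>\<in>Sn n. fscale (f \<sigma>) (delta \<sigma>)) \<in> FS.span (delta ` Sn n)"
    by (intro FS.span_sum FS.span_scale FS.span_base) simp
  then show "f \<in> FS.span (delta ` Sn n)" unfolding Pn_expand[OF f, symmetric] .
qed simp

section \<open>Left ideals, Maschke's theorem and regularity\<close>

definition left_ideal :: "nat \<Rightarrow> 'k::field grpalg set \<Rightarrow> bool" where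
  "left_ideal n L \<longleftrightarrow> FS.subspace L \<and> L \<subseteq> Pn n \<and> (\<forall>\<tau>\<in>Sn n. \<forall>x\<in>L. act \<tau> x \<in> L)"

lemma left_ideal_conv: "left_ideal n L \<Longrightarrow> x \<in> L \<Longrightarrow> conv n f x \<in> L"
  unfolding conv_eq left_ideal_def by (auto intro!: FS.subspace_sum FS.subspace_scale)

lemma left_ideal_Pn: "left_ideal n (Pn n)"
  by (simp add: left_ideal_def subspace_Pn act_Pn)

lemma conv_Pn: "h \<in> Pn n \<Longrightarrow> conv n f h \<in> Pn n"
  using left_ideal_conv[OF left_ideal_Pn] .

lemma left_ideal_principal:
  assumes "e \<in> Pn n" shows "left_ideal n {conv n f e |f. f \<in> Pn n}"
proof -
  have eq: "{conv n f e |f. f \<in> Pn n} = (\<lambda>f. conv n f e) ` Pn n" by auto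
  have "act \<tau> (conv n f e) \<in> (\<lambda>f. conv n f e) ` Pn n" if "\<tau> \<in> Sn n" "f \<in> Pn n" for \<tau> f
    using that act_Pn[OF that] by (auto simp: act_conv)
  then show ?thesis unfolding left_ideal_def eq
    using assms conv_Pn FSP.linear_subspace_image[OF flinear_conv_left subspace_Pn]
    by auto
qed

text \<open>Averaging a linear projection onto \<open>L\<close> over the group gives an equivariant one, which is
  right multiplication by the image of the identity.\<close>

lemma maschke:
  fixes L :: "'k::field_char_0 grpalg set"
  assumes L: "left_ideal n L"
  shows "\<exists>f\<in>L. \<forall>x\<in>L. conv n x f = x"
proof -
  have sub: "FS.subspace L" and LP: "L \<subseteq> Pn n" and Lact: "\<And>\<tau> x. \<tau> \<in> Sn n \<Longrightarrow> x \<in> L \<Longrightarrow> act \<tau> x \<in> L"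
    using L by (auto simp: left_ideal_def)
  \<comment> \<open>A left inverse of the identity on L is a linear projection onto L.\<close>
  have "\<exists>g. g ` UNIV \<subseteq> L \<and> flinear g \<and> (\<forall>v\<in>L. g (id v) = v)"
    using FSP.linear_exists_left_inverse_on[OF _ sub, of id] FS.linear_id by auto
  then obtain p where p: "\<And>x. p x \<in> L" "flinear p" "\<And>v. v \<in> L \<Longrightarrow> p v = v" by auto
  define N :: 'k where "N = of_nat (card (Sn n))"
  have N: "N \<noteq> 0" unfolding N_def using Sn_id by (auto simp del: Sn_id)
  define f where "f = fscale (1 / N) (\<Sum>g\<in>Sn n. act (inv g) (p (delta g)))"
  have fL: "f \<in> L" unfolding f_def
    by (intro FS.subspace_scale[OF sub] FS.subspace_sum[OF sub] Lact p Sn_inv)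
  moreover have "conv n x f = x" if x: "x \<in> L" for x
  proof -
    have "conv n x (\<Sum>g\<in>Sn n. act (inv g) (p (delta g))) =
        (\<Sum>s\<in>Sn n. \<Sum>g\<in>Sn n. fscale (x s) (act s (act (inv g) (p (delta g)))))"
      by (simp add: conv_eq act_sum FS.scale_sum_right)
    \<comment> \<open>Reindexing by g = h s cancels the outer action of s and moves the coefficients
      of x into the argument of p; the sum over s then reassembles x.\<close>
    also have "\<dots> = (\<Sum>s\<in>Sn n. \<Sum>h\<in>Sn n. fscale (x s) (act s (act (inv (h \<circ> s)) (p (delta (h \<circ> s))))))"
      by (rule sum.cong[OF refl], rule sum_Sn_right[symmetric])
    also have "\<dots> = (\<Sum>s\<in>Sn n. \<Sum>h\<in>Sn n. act (inv h) (p (act h (fscale (x s) (delta s)))))"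
      by (intro sum.cong refl)
        (simp add: act_act[of _ n] Sn_inv Sn_comp o_inv_distrib Sn_bij Sn_inv_o_assoc act_scale
          flinear_scale[OF p(2)] act_delta[of _ n])
    also have "\<dots> = (\<Sum>h\<in>Sn n. act (inv h) (p (act h (\<Sum>s\<in>Sn n. fscale (x s) (delta s)))))"
      by (subst sum.swap) (simp add: act_sum flinear_sum[OF p(2)])
    also have "\<dots> = (\<Sum>h\<in>Sn n. x)"
    proof (intro sum.cong refl)
      fix h assume h: "h \<in> Sn n"
      have "p (act h x) = act h x" using p(3) Lact h x by blast
      then show "act (inv h) (p (act h (\<Sum>s\<in>Sn n. fscale (x s) (delta s)))) = x"
        using Pn_expand[of x n] x LP h by (simp add: act_act[of _ n] Sn_inv subset_iff)
    qed
    also have "\<dots> = fscale N x" by (simp add: N_def FS.sum_constant_scale del: sum_constant)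
    finally show ?thesis using N by (simp add: f_def conv_scale)
  qed
  ultimately show ?thesis by blast
qed

text \<open>Maschke's theorem for the left ideal generated by x gives a right unit of the form a x,
  and x itself lies in that ideal.\<close>

lemma von_neumann_regular:
  fixes x :: "'k::field_char_0 grpalg"
  assumes "x \<in> Pn n" shows "\<exists>a\<in>Pn n. conv n x (conv n a x) = x"
proof -
  obtain f where "f \<in> {conv n f x |f. f \<in> Pn n}" "\<forall>y\<in>{conv n f x |f. f \<in> Pn n}. conv n y f = y"
    using maschke[OF left_ideal_principal[OF assms]] by blast
  moreover have "x \<in> {conv n f x |f. f \<in> Pn n}" using conv_unit_left[of n x, symmetric] delta_Pn[OF Sn_id, of n] by blast
  ultimately show ?thesis by auto
qed

subsection \<open>Symmetrizers of colourings\<close>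

text \<open>Rows and columns are treated alike, as classes of a colouring of the letters. Arbitrary
  colourings are allowed so that moving the letter y to row i is the update
  \<open>r(y := i)\<close>.\<close>

definition stab :: "nat \<Rightarrow> (nat \<Rightarrow> nat) \<Rightarrow> (nat \<Rightarrow> nat) set" where
  "stab n r = {p \<in> Sn n. \<forall>k<n. r (p k) = r k}"

definition rowsum :: "nat \<Rightarrow> (nat \<Rightarrow> nat) \<Rightarrow> 'k::field grpalg" where
  "rowsum n r = (\<lambda>\<sigma>. if \<sigma> \<in> stab n r then 1 else 0)"

definition colsum :: "nat \<Rightarrow> (nat \<Rightarrow> nat) \<Rightarrow> 'k::field grpalg" where
  "colsum n r = (\<lambda>\<sigma>. if \<sigma> \<in> stab n r then of_int (sign \<sigma>) else 0)"

lemma stab_Sn: "p \<in> stab n r \<Longrightarrow> p \<in> Sn n"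
  by (simp add: stab_def)

lemma stab_finite [simp]: "finite (stab n r)"
  by (simp add: stab_def)

lemma stab_id [simp]: "id \<in> stab n r"
  by (simp add: stab_def)

lemma stab_comp: "p \<in> stab n r \<Longrightarrow> q \<in> stab n r \<Longrightarrow> p \<circ> q \<in> stab n r"
  by (simp add: stab_def Sn_comp Sn_less)

lemma stab_inv: "p \<in> stab n r \<Longrightarrow> inv p \<in> stab n r"
proof -
  assume p: "p \<in> stab n r"
  have "r (inv p k) = r k" if "k < n" for k
  proof -
    have s: "p \<in> Sn n" using p stab_Sn by blast
    have "r (p (inv p k)) = r (inv p k)" using p that Sn_less[OF Sn_inv[OF s]] by (simp add: stab_def)
    then show ?thesis using Sn_inv_o(2)[OF s] by (simp add: fun_eq_iff)
  qed
  then show ?thesis using p by (simp add: stab_def Sn_inv)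
qed

lemma stab_transpose:
  "x < n \<Longrightarrow> y < n \<Longrightarrow> r x = r y \<Longrightarrow> tp x y \<in> stab n r"
  by (auto simp: stab_def Sn_transpose Transposition.transpose_def)

lemma sum_stab_left: "q \<in> stab n r \<Longrightarrow> (\<Sum>p\<in>stab n r. F (q \<circ> p)) = (\<Sum>p\<in>stab n r. F p)"
  by (rule sum.reindex_bij_witness[of _ "\<lambda>p. inv q \<circ> p" "\<lambda>p. q \<circ> p"])
    (auto simp: stab_comp stab_inv Sn_inv_o_assoc[OF stab_Sn])

lemma sum_stab_right: "q \<in> stab n r \<Longrightarrow> (\<Sum>p\<in>stab n r. F (p \<circ> q)) = (\<Sum>p\<in>stab n r. F p)"
  by (rule sum.reindex_bij_witness[of _ "\<lambda>p. p \<circ> inv q" "\<lambda>p. p \<circ> q"])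
    (auto simp: stab_comp stab_inv comp_assoc Sn_inv_o[OF stab_Sn])

lemma rowsum_Pn [simp]: "rowsum n r \<in> Pn n" and colsum_Pn [simp]: "colsum n r \<in> Pn n"
  by (auto simp: rowsum_def colsum_def Pn_def stab_def)

lemma conv_supported:
  assumes "S \<subseteq> Sn n"
  shows "conv n (\<lambda>\<sigma>. if \<sigma> \<in> S then F \<sigma> else 0) x = (\<Sum>p\<in>S. fscale (F p) (act p x))"
  unfolding conv_eq by (rule sum.mono_neutral_cong_right) (use assms in auto)

abbreviation "rsym n r \<equiv> conv n (rowsum n r)"
abbreviation "csym n r \<equiv> conv n (colsum n r)"

lemma conv_rowsum: "rsym n r x = (\<Sum>p\<in>stab n r. act p x)"
  unfolding rowsum_def by (subst conv_supported) (auto simp: stab_def)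

lemma conv_colsum: "csym n r x = (\<Sum>p\<in>stab n r. fscale (of_int (sign p)) (act p x))"
  unfolding colsum_def by (subst conv_supported) (auto simp: stab_def)

lemma sign_Sn_comp: "p \<in> Sn n \<Longrightarrow> q \<in> Sn n \<Longrightarrow> sign (p \<circ> q) = sign p * sign q"
  unfolding Sn_def by (metis finite_lessThan mem_Collect_eq permutation_permutes sign_compose)

lemma act_conv_rowsum: "p \<in> stab n r \<Longrightarrow> act p (rsym n r x) = rsym n r x"
  using sum_stab_left[of p n r "\<lambda>p. act p x"]
  by (simp add: conv_rowsum act_sum act_act[of _ n] stab_Sn[of _ n r])

lemma conv_rowsum_act: "p \<in> stab n r \<Longrightarrow> rsym n r (act p x) = rsym n r x"
  using sum_stab_right[of p n r "\<lambda>p. act p x"]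
  by (simp add: conv_rowsum act_sum act_act[of _ n] stab_Sn[of _ n r])

lemma sign_sq [simp]: "of_int (sign p) * (of_int (sign p) :: 'k::ring_1) = 1"
  by (simp add: sign_def)

lemma act_conv_colsum:
  assumes p: "p \<in> stab n r"
  shows "act p (csym n r x) = fscale (of_int (sign p)) (csym n r x)"
proof -
  have "fscale (of_int (sign p)) (act p (csym n r x)) =
      (\<Sum>q\<in>stab n r. fscale (of_int (sign (p \<circ> q))) (act (p \<circ> q) x))"
    using p by (simp add: conv_colsum act_sum act_act[of _ n] stab_Sn[of _ n r] act_scale
        FS.scale_sum_right sign_Sn_comp[of _ n])
  also have "\<dots> = csym n r x"
    unfolding conv_colsum by (rule sum_stab_left[OF p])
  finally have "fscale (of_int (sign p)) (fscale (of_int (sign p)) (act p (csym n r x))) =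
      fscale (of_int (sign p)) (csym n r x)" by simp
  then show ?thesis by simp
qed

lemma conv_colsum_act:
  assumes p: "p \<in> stab n r"
  shows "csym n r (act p x) = fscale (of_int (sign p)) (csym n r x)"
proof -
  have "fscale (of_int (sign p)) (csym n r (act p x)) =
      (\<Sum>q\<in>stab n r. fscale (of_int (sign (q \<circ> p))) (act (q \<circ> p) x))"
    using p by (simp add: conv_colsum act_sum act_act[of _ n] stab_Sn[of _ n r] act_scale
        FS.scale_sum_right sign_Sn_comp[of _ n] mult.commute)
  also have "\<dots> = csym n r x"
    unfolding conv_colsum by (rule sum_stab_right[OF p])
  finally have "fscale (of_int (sign p)) (fscale (of_int (sign p)) (csym n r (act p x))) =
      fscale (of_int (sign p)) (csym n r x)" by simp
  then show ?thesis by simp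
qed

text \<open>Coset decomposition: a member p of the new stabilizer is determined by x = p y, which is
  y or a letter of colour i, and by what remains after composing with the transposition of x and y;
  the remainder fixes y and preserves r.\<close>

lemma stab_upd:
  assumes y: "y < n" "r y \<noteq> i"
  shows "bij_betw (\<lambda>(x, s). tp x y \<circ> s)
    ({x. x < n \<and> (x = y \<or> r x = i)} \<times> {s \<in> stab n r. s y = y}) (stab n (r(y := i)))"
proof (rule bij_betw_byWitness[where f' = "\<lambda>p. (p y, tp (p y) y \<circ> p)"])
  let ?X = "{x. x < n \<and> (x = y \<or> r x = i)}" and ?S = "{s \<in> stab n r. s y = y}"
  show "\<forall>a\<in>?X \<times> ?S. (\<lambda>p. (p y, tp (p y) y \<circ> p))
      ((\<lambda>(x, s). tp x y \<circ> s) a) = a"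
    by (auto simp: comp_assoc[symmetric])
  show "\<forall>p\<in>stab n (r(y := i)). (\<lambda>(x, s). tp x y \<circ> s)
      (p y, tp (p y) y \<circ> p) = p"
    by (auto simp: comp_assoc[symmetric])
  show "(\<lambda>(x, s). tp x y \<circ> s) ` (?X \<times> ?S) \<subseteq> stab n (r(y := i))"
  proof clarify
    fix x s assume x: "x < n" "x = y \<or> r x = i" and s: "s \<in> stab n r" "s y = y"
    have inj: "s k = y \<longleftrightarrow> k = y" for k
      using s Sn_bij[OF stab_Sn[OF s(1)]] by (metis bij_pointE)
    have "(r(y := i)) ((tp x y \<circ> s) k) = (r(y := i)) k" if "k < n" for k
    proof (cases "k = y")
      case True then show ?thesis using s x by (auto simp: Transposition.transpose_def)
    next
      case False
      then have "s k \<noteq> y" "r (s k) = r k" using inj s that by (auto simp: stab_def)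
      then show ?thesis using False x by (auto simp: Transposition.transpose_def)
    qed
    moreover have "tp x y \<circ> s \<in> Sn n"
      using x y s by (simp add: stab_def Sn_comp Sn_transpose)
    ultimately show "tp x y \<circ> s \<in> stab n (r(y := i))"
      unfolding stab_def by blast
  qed
  show "(\<lambda>p. (p y, tp (p y) y \<circ> p)) ` stab n (r(y := i)) \<subseteq> ?X \<times> ?S"
  proof
    fix z assume "z \<in> (\<lambda>p. (p y, tp (p y) y \<circ> p)) ` stab n (r(y := i))"
    then obtain p where p: "p \<in> stab n (r(y := i))" and z: "z = (p y, tp (p y) y \<circ> p)"
      by auto
    have py: "p y < n" using p y by (simp add: stab_def Sn_less)
    have pr: "(r(y := i)) (p k) = (r(y := i)) k" if "k < n" for k using p that by (simp add: stab_def)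
    have inj: "p k = p y \<longleftrightarrow> k = y" for k
      using Sn_bij[OF stab_Sn[OF p]] by (metis bij_def inj_eq)
    have "r ((tp (p y) y \<circ> p) k) = r k" if "k < n" for k
    proof (cases "k = y")
      case False
      then show ?thesis using pr[OF that] pr[OF y(1)] inj[of k]
        by (auto simp: Transposition.transpose_def split: if_splits)
    qed auto
    moreover have "tp (p y) y \<circ> p \<in> Sn n"
      using p y py by (simp add: stab_def Sn_comp Sn_transpose)
    ultimately have "tp (p y) y \<circ> p \<in> stab n r"
      unfolding stab_def by blast
    then show "z \<in> ?X \<times> ?S" using z py pr[OF y(1)] by (auto split: if_splits)
  qed
qed

text \<open>By \<open>stab_upd\<close> the new row sum applied to v is a positive integer multiple
  of this expression, since v is fixed by the factor from \<open>stab n r\<close>; characteristic 0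
  allows division. For L = {0} this says that a raising operator kills a highest weight
  vector.\<close>

lemma raising:
  fixes v :: "'k::field_char_0 grpalg"
  assumes v: "\<And>p. p \<in> stab n r \<Longrightarrow> act p v = v" and y: "y < n" "r y \<noteq> i"
    and L: "FS.subspace L" "rsym n (r(y := i)) v \<in> L"
  shows "v + (\<Sum>x | x < n \<and> r x = i. act (tp x y) v) \<in> L"
proof -
  let ?X = "{x. x < n \<and> (x = y \<or> r x = i)}" and ?S = "{s \<in> stab n r. s y = y}"
  have "rsym n (r(y := i)) v =
      (\<Sum>z\<in>?X \<times> ?S. act (case z of (x, s) \<Rightarrow> tp x y \<circ> s) v)"
    unfolding conv_rowsum by (rule sum.reindex_bij_betw[OF stab_upd, symmetric]) (use y in auto)
  also have "\<dots> = (\<Sum>x\<in>?X. \<Sum>s\<in>?S. act (tp x y \<circ> s) v)"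
    unfolding sum.cartesian_product by (intro sum.cong refl) auto
  also have "\<dots> = (\<Sum>x\<in>?X. \<Sum>s\<in>?S. act (tp x y) v)"
    using v y by (intro sum.cong refl) (auto simp: act_act[of _ n, symmetric] Sn_transpose stab_Sn[of _ n r])
  also have "\<dots> = fscale (of_nat (card ?S)) (\<Sum>x\<in>?X. act (tp x y) v)"
    by (simp add: FS.sum_constant_scale FS.scale_sum_right del: sum_constant)
  also have "?X = insert y {x. x < n \<and> r x = i}" using y by auto
  also have "(\<Sum>x\<in>insert y {x. x < n \<and> r x = i}. act (tp x y) v) =
      v + (\<Sum>x | x < n \<and> r x = i. act (tp x y) v)"
    using y by (subst sum.insert) auto
  finally have eq: "rsym n (r(y := i)) v =
      fscale (of_nat (card ?S)) (v + (\<Sum>x | x < n \<and> r x = i. act (tp x y) v))" .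
  have "fscale (of_nat (card ?S)) (v + (\<Sum>x | x < n \<and> r x = i. act (tp x y) v)) \<in> L"
    using L(2) unfolding eq .
  from FS.subspace_scale[OF L(1) this, of "1 / of_nat (card ?S)"]
  have "fscale (1 / of_nat (card ?S) * of_nat (card ?S))
      (v + (\<Sum>x | x < n \<and> r x = i. act (tp x y) v)) \<in> L" by simp
  moreover have "id \<in> ?S" "finite ?S" by auto
  then have "card ?S \<noteq> 0" by (metis card_eq_0_iff empty_iff)
  ultimately show ?thesis by simp
qed

text \<open>A permutation preserves the sum of all colours, so colours cannot only go up.\<close>

lemma lowered_letter_ex:
  fixes r :: "nat \<Rightarrow> nat"
  assumes "g \<in> Sn n" "x < n" "r (g x) \<noteq> r x"
  shows "\<exists>y<n. r (g y) < r y"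
proof (rule ccontr)
  assume "\<not> (\<exists>y<n. r (g y) < r y)"
  then have le: "r y \<le> r (g y)" if "y < n" for y using that by auto
  have "r x < r (g x)" using le[OF assms(2)] assms(3) by simp
  then have "(\<Sum>y<n. r y) < (\<Sum>y<n. r (g y))"
    using le assms(2) by (intro sum_strict_mono_ex1) auto
  moreover have "(\<Sum>y<n. r (g y)) = (\<Sum>y<n. r y)"
    using sum.permute[of g "{..<n}" r] assms by (simp add: Sn_def o_def)
  ultimately show False by simp
qed

text \<open>Induction on the number of letters whose colour g changes. The ideal L absorbs the
  raised terms: it is {0} for Young symmetrizers, and larger where row sums are straightened modulo
  lexicographically larger contents.\<close>

lemma straighten:
  fixes v :: "'k::field_char_0 grpalg"
  assumes v: "\<And>p. p \<in> stab n r \<Longrightarrow> act p v = v" and L: "left_ideal n L"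
    and hw: "\<And>y i. y < n \<Longrightarrow> i < r y \<Longrightarrow> rsym n (r(y := i)) v \<in> L"
    and g: "g \<in> Sn n"
  shows "\<exists>c. rsym n r (act g v) - fscale c v \<in> L"
  using g
proof (induction "card {x. x < n \<and> r (g x) \<noteq> r x}" arbitrary: g rule: less_induct)
  case less
  have sub: "FS.subspace L" using L by (simp add: left_ideal_def)
  let ?psi = "\<lambda>g. rsym n r (act g v)"
  show ?case
  proof (cases "g \<in> stab n r")
    case True
    have "?psi g = fscale (of_nat (card (stab n r))) v"
      using v True by (simp add: conv_rowsum FS.sum_constant_scale del: sum_constant)
    then show ?thesis using FS.subspace_0[OF sub] by (intro exI[of _ "of_nat (card (stab n r))"]) simp
  next
    case False
    then obtain x where "x < n" "r (g x) \<noteq> r x" using less.prems by (auto simp: stab_def)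
    from lowered_letter_ex[OF less.prems this] obtain y where y: "y < n" "r (g y) < r y" by auto
    define i where "i = r (g y)"
    define t where "t = (\<lambda>x. tp x y)"
    let ?X = "{x. x < n \<and> r x = i}"
    \<comment> \<open>For x in A both g x and g y have colour i, so the row sum absorbs their
      transposition. For x in B the swap gives x its proper colour i, while y was misplaced anyway;
      the composite changes fewer colours than g.\<close>
    let ?A = "{x. x < n \<and> r x = i \<and> r (g x) = i}" and ?B = "{x. x < n \<and> r x = i \<and> r (g x) \<noteq> i}"
    have XAB: "?X = ?A \<union> ?B" "?A \<inter> ?B = {}" by auto
    have tS: "t x \<in> Sn n" if "x < n" for x using that y by (simp add: t_def Sn_transpose)
    have "v + (\<Sum>x\<in>?X. act (t x) v) \<in> L" unfolding t_def
      by (rule raising[OF v]) (use y hw sub in \<open>auto simp: i_def\<close>)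
    then have "rsym n r (act g (v + (\<Sum>x\<in>?X. act (t x) v))) \<in> L"
      using L less.prems by (intro left_ideal_conv[OF L]) (auto simp: left_ideal_def)
    also have "rsym n r (act g (v + (\<Sum>x\<in>?X. act (t x) v))) =
        ?psi g + (\<Sum>x\<in>?X. rsym n r (act g (act (t x) v)))"
      unfolding conv_add act_add act_sum conv_sum ..
    also have "(\<Sum>x\<in>?X. rsym n r (act g (act (t x) v))) = (\<Sum>x\<in>?X. ?psi (g \<circ> t x))"
      by (intro sum.cong refl, subst act_act) (use less.prems tS in auto)
    also have "(\<Sum>x\<in>?X. ?psi (g \<circ> t x)) = (\<Sum>x\<in>?A. ?psi (g \<circ> t x)) + (\<Sum>x\<in>?B. ?psi (g \<circ> t x))"
      unfolding XAB(1) by (rule sum.union_disjoint) (use XAB(2) in auto)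
    also have "(\<Sum>x\<in>?A. ?psi (g \<circ> t x)) = (\<Sum>x\<in>?A. ?psi g)"
    proof (intro sum.cong refl)
      fix x assume x: "x \<in> ?A"
      have "g \<circ> t x = tp (g x) (g y) \<circ> g"
        unfolding t_def by (rule transpose_conj[OF Sn_bij[OF less.prems], symmetric])
      moreover have "tp (g x) (g y) \<in> stab n r"
        using x y less.prems by (intro stab_transpose) (auto simp: Sn_less i_def)
      ultimately show "?psi (g \<circ> t x) = ?psi g"
        using conv_rowsum_act[of _ n r "act g v"] less.prems by (simp add: act_act[of _ n] stab_Sn[of _ n r])
    qed
    also have "(\<Sum>x\<in>?A. ?psi g) = fscale (of_nat (card ?A)) (?psi g)" by (simp add: FS.sum_constant_scale del: sum_constant)
    finally have main: "?psi g + (fscale (of_nat (card ?A)) (?psi g) + (\<Sum>x\<in>?B. ?psi (g \<circ> t x))) \<in> L" .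
    have "\<exists>c. ?psi (g \<circ> t x) - fscale c v \<in> L" if x: "x \<in> ?B" for x
    proof (rule less.hyps)
      show "g \<circ> t x \<in> Sn n" using x less.prems tS by (simp add: Sn_comp)
      have "{k. k < n \<and> r ((g \<circ> t x) k) \<noteq> r k} \<subset> {k. k < n \<and> r (g k) \<noteq> r k}"
      proof
        show "{k. k < n \<and> r ((g \<circ> t x) k) \<noteq> r k} \<subseteq> {k. k < n \<and> r (g k) \<noteq> r k}"
          using x y by (auto simp: t_def Transposition.transpose_def i_def)
        have "x \<in> {k. k < n \<and> r (g k) \<noteq> r k}" "x \<notin> {k. k < n \<and> r ((g \<circ> t x) k) \<noteq> r k}"
          using x by (auto simp: t_def i_def)
        then show "{k. k < n \<and> r ((g \<circ> t x) k) \<noteq> r k} \<noteq> {k. k < n \<and> r (g k) \<noteq> r k}" by blast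
      qed
      then show "card {k. k < n \<and> r ((g \<circ> t x) k) \<noteq> r k} < card {k. k < n \<and> r (g k) \<noteq> r k}"
        by (intro psubset_card_mono) auto
    qed
    then have "\<forall>x\<in>?B. \<exists>c. ?psi (g \<circ> t x) - fscale c v \<in> L" by blast
    from bchoice[OF this] obtain c where "\<forall>x\<in>?B. ?psi (g \<circ> t x) - fscale (c x) v \<in> L" ..
    then have c: "\<And>x. x \<in> ?B \<Longrightarrow> ?psi (g \<circ> t x) - fscale (c x) v \<in> L" by blast
    have "(\<Sum>x\<in>?B. ?psi (g \<circ> t x) - fscale (c x) v) \<in> L" by (rule FS.subspace_sum[OF sub c])
    \<comment> \<open>Every letter of A contributes another copy of \<open>?psi g\<close>, so its
      coefficient is 1 + |A|, which is invertible in characteristic 0.\<close>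
    from FS.subspace_diff[OF sub main this]
    have "fscale (1 + of_nat (card ?A)) (?psi g) + fscale (\<Sum>x\<in>?B. c x) v \<in> L"
      by (simp add: sum_subtractf FS.scale_left_distrib FS.scale_sum_left algebra_simps)
    from FS.subspace_scale[OF sub this, of "1 / (1 + of_nat (card ?A))"]
    have "?psi g - fscale (- (\<Sum>x\<in>?B. c x) / (1 + of_nat (card ?A))) v \<in> L"
      by (simp add: FS.scale_right_distrib of_nat_Suc[symmetric] del: of_nat_Suc)
    then show ?thesis by blast
  qed
qed

subsection \<open>Young symmetrizers of shapes with three rows\<close>

definition cnt :: "nat \<Rightarrow> (nat \<Rightarrow> nat) \<Rightarrow> nat \<Rightarrow> nat" where
  "cnt n r i = card {k. k < n \<and> r k = i}"

lemma partitions3_iff: "(a, b, c) \<in> partitions3 n \<longleftrightarrow> b \<le> a \<and> c \<le> b \<and> a + b + c = n"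
  by (auto simp: partitions3_def)

lemma partitions3_finite [simp]: "finite (partitions3 n)"
  by (rule finite_subset[of _ "{..n} \<times> {..n} \<times> {..n}"]) (auto simp: partitions3_def)

lemma size3_partitions3: "\<nu> \<in> partitions3 n \<Longrightarrow> size3 \<nu> = n"
  by (auto simp: partitions3_def size3_def)

lemma tab_row_less3: "tab_row \<nu> k < 3"
  by (auto simp: tab_row_def split: prod.splits)

lemma cnt_tab_row:
  "cnt (a + b + c) (tab_row (a, b, c)) 0 = a"
  "cnt (a + b + c) (tab_row (a, b, c)) (Suc 0) = b"
  "cnt (a + b + c) (tab_row (a, b, c)) 2 = c"
proof -
  have "{k. k < a + b + c \<and> tab_row (a, b, c) k = 0} = {..<a}"
    "{k. k < a + b + c \<and> tab_row (a, b, c) k = Suc 0} = {a..<a + b}"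
    "{k. k < a + b + c \<and> tab_row (a, b, c) k = 2} = {a + b..<a + b + c}"
    by (auto simp: tab_row_def split: if_splits)
  then show "cnt (a + b + c) (tab_row (a, b, c)) 0 = a"
    "cnt (a + b + c) (tab_row (a, b, c)) (Suc 0) = b"
    "cnt (a + b + c) (tab_row (a, b, c)) 2 = c" by (simp_all add: cnt_def)
qed

lemma cnt_upd:
  assumes "y < n" "r y = j" "j \<noteq> i"
  shows "cnt n (r(y := i)) i = Suc (cnt n r i)" "cnt n r j = Suc (cnt n (r(y := i)) j)"
    "m \<noteq> i \<Longrightarrow> m \<noteq> j \<Longrightarrow> cnt n (r(y := i)) m = cnt n r m"
proof -
  have "{k. k < n \<and> (r(y := i)) k = i} = insert y {k. k < n \<and> r k = i}" using assms by auto
  then show "cnt n (r(y := i)) i = Suc (cnt n r i)" using assms by (simp add: cnt_def)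
  have "{k. k < n \<and> r k = j} = insert y {k. k < n \<and> (r(y := i)) k = j}" using assms by auto
  moreover have "y \<notin> {k. k < n \<and> (r(y := i)) k = j}" using assms by auto
  ultimately show "cnt n r j = Suc (cnt n (r(y := i)) j)" by (simp add: cnt_def)
  show "cnt n (r(y := i)) m = cnt n r m" if "m \<noteq> i" "m \<noteq> j"
    unfolding cnt_def by (rule arg_cong[of _ _ card]) (use that assms in auto)
qed

lemma cnt_le: "cnt n r i \<le> n"
  using card_mono[of "{..<n}" "{k. k < n \<and> r k = i}"] by (auto simp: cnt_def)

lemma cnt_sum3:
  assumes "\<And>k. k < n \<Longrightarrow> r k < 3"
  shows "cnt n r 0 + cnt n r (Suc 0) + cnt n r 2 = n"
proof -
  have "{..<n} = {k. k < n \<and> r k = 0} \<union> {k. k < n \<and> r k = Suc 0} \<union> {k. k < n \<and> r k = 2}"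
    using assms by (force simp: numeral_3_eq_3 less_Suc_eq)
  then have "card {..<n} = card ({k. k < n \<and> r k = 0} \<union> {k. k < n \<and> r k = Suc 0} \<union> {k. k < n \<and> r k = 2})"
    by simp
  also have "\<dots> = cnt n r 0 + cnt n r (Suc 0) + cnt n r 2"
    unfolding cnt_def by (subst card_Un_disjoint; (subst card_Un_disjoint)?) auto
  finally show ?thesis by simp
qed

text \<open>Pigeonhole: colour 0 needs at least as many columns as it has letters, and each of the
  \<open>c\<close> columns of length 3 contains colour 2.\<close>

lemma collision:
  assumes abc: "b \<le> a" "c \<le> b" "n = a + b + c" and r: "\<And>k. k < n \<Longrightarrow> r k < 3" and y: "y \<in> Sn n"
    and bad: "a < cnt n r 0 \<or> cnt n r 2 < c"
  shows "\<exists>i<n. \<exists>j<n. i \<noteq> j \<and> r i = r j \<and> tab_col (a, b, c) (y i) = tab_col (a, b, c) (y j)"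
proof (rule ccontr)
  assume neg: "\<not> ?thesis"
  let ?f = "\<lambda>k. tab_col (a, b, c) (y k)"
  have neg': "i = j" if "i < n" "j < n" "r i = r j" "?f i = ?f j" for i j
    using neg that by blast
  have inj: "inj_on ?f {k. k < n \<and> r k = i}" for i
    by (rule inj_onI) (use neg' in simp)
  have "?f ` {k. k < n \<and> r k = 0} \<subseteq> {..<a}"
  proof clarify
    fix k assume "k < n"
    then have "y k < a + b + c" using Sn_less[OF y] abc by simp
    then show "?f k < a" using abc(1,2) by (simp add: tab_col_def) linarith
  qed
  then have "cnt n r 0 \<le> a" using card_inj_on_le[OF inj, of 0 "{..<a}"] by (simp add: cnt_def)
  moreover have "{..<c} \<subseteq> ?f ` {k. k < n \<and> r k = 2}"
  proof
    fix m assume "m \<in> {..<c}"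
    then have m: "m < c" by simp
    define p where "p = (\<lambda>i. inv y i)"
    have yp: "y (p i) = i" for i using Sn_inv_o(2)[OF y] by (simp add: p_def fun_eq_iff)
    have pn: "p i < n" if "i < n" for i using that Sn_less[OF Sn_inv[OF y]] by (simp add: p_def)
    have n: "m < n" "a + m < n" "a + b + m < n" using m abc by auto
    have ne: "p m \<noteq> p (a + m)" "p m \<noteq> p (a + b + m)" "p (a + m) \<noteq> p (a + b + m)"
      using yp[of m] yp[of "a + m"] yp[of "a + b + m"] m abc by auto
    have col: "?f (p m) = m" "?f (p (a + m)) = m" "?f (p (a + b + m)) = m"
      using m abc by (auto simp: yp tab_col_def)
    have "r (p m) \<noteq> r (p (a + m))" "r (p m) \<noteq> r (p (a + b + m))" "r (p (a + m)) \<noteq> r (p (a + b + m))"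
      using neg'[OF pn[OF n(1)] pn[OF n(2)]] neg'[OF pn[OF n(1)] pn[OF n(3)]] neg'[OF pn[OF n(2)] pn[OF n(3)]]
        ne col by auto
    moreover have "r (p m) < 3" "r (p (a + m)) < 3" "r (p (a + b + m)) < 3" using r pn n by auto
    ultimately have "r (p m) = 2 \<or> r (p (a + m)) = 2 \<or> r (p (a + b + m)) = 2" by arith
    then show "m \<in> ?f ` {k. k < n \<and> r k = 2}"
      using image_eqI[of m ?f "p m", OF col(1)[symmetric]] image_eqI[of m ?f "p (a + m)", OF col(2)[symmetric]]
        image_eqI[of m ?f "p (a + b + m)", OF col(3)[symmetric]]
        pn[OF n(1)] pn[OF n(2)] pn[OF n(3)] by (elim disjE) simp_all
  qed
  then have "card {..<c} \<le> card (?f ` {k. k < n \<and> r k = 2})" by (intro card_mono) auto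
  then have "c \<le> cnt n r 2" using card_image[OF inj] by (simp add: cnt_def)
  ultimately show False using bad by simp
qed

lemma eq_neg_self: "x = fscale (-1) x \<Longrightarrow> x = (0 :: 'g \<Rightarrow> 'k::field_char_0)"
  by (auto simp: fscale_def fun_eq_iff)

text \<open>For each permutation \<sigma> the pigeonhole argument yields two letters of equal colour
  whose preimages under \<sigma> lie in one column. Their transposition is absorbed by the row sum
  with sign 1, and passes through \<sigma> to the column sum with sign -1.\<close>

lemma rowsum_conv_colsum_eq_0:
  fixes f :: "'k::field_char_0 grpalg"
  assumes "b \<le> a" "c \<le> b" "n = a + b + c" "\<And>k. k < n \<Longrightarrow> r k < 3"
    and "a < cnt n r 0 \<or> cnt n r 2 < c"
  shows "rsym n r (conv n f (csym n (tab_col (a, b, c)) h)) = 0"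
proof -
  let ?Ch = "csym n (tab_col (a, b, c)) h"
  have "rsym n r (act \<sigma> ?Ch) = 0" if s: "\<sigma> \<in> Sn n" for \<sigma>
  proof -
    obtain i j where ij: "i < n" "j < n" "i \<noteq> j" "r i = r j"
        "tab_col (a, b, c) (inv \<sigma> i) = tab_col (a, b, c) (inv \<sigma> j)"
      using collision[OF assms(1-4) Sn_inv[OF s] assms(5)] by blast
    let ?t = "tp i j" and ?u = "tp (inv \<sigma> i) (inv \<sigma> j)"
    have si: "\<sigma> (inv \<sigma> k) = k" for k using Sn_inv_o(2)[OF s] by (simp add: fun_eq_iff)
    have less: "inv \<sigma> i < n" "inv \<sigma> j < n" using ij Sn_less[OF Sn_inv[OF s]] by auto
    have t: "?t \<in> stab n r" and u: "?u \<in> stab n (tab_col (a, b, c))"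
      using ij less by (auto intro!: stab_transpose)
    have ne: "inv \<sigma> i \<noteq> inv \<sigma> j" using si ij(3) by metis
    have "?t \<circ> \<sigma> = \<sigma> \<circ> ?u"
      using transpose_conj[OF Sn_bij[OF s], of "inv \<sigma> i" "inv \<sigma> j"] by (simp add: si)
    then have "act ?t (act \<sigma> ?Ch) = act \<sigma> (act ?u ?Ch)"
      using s t u by (simp add: act_act[of _ n] stab_Sn[of _ n])
    also have "act ?u ?Ch = fscale (-1) ?Ch"
      using ne act_conv_colsum[OF u, of h] by (simp add: sign_swap_id)
    also have "act \<sigma> (fscale (-1) ?Ch) = fscale (-1) (act \<sigma> ?Ch)" by (rule act_scale)
    finally have "rsym n r (act ?t (act \<sigma> ?Ch)) = fscale (-1) (rsym n r (act \<sigma> ?Ch))"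
      by (simp only: conv_scale)
    then show ?thesis using conv_rowsum_act[OF t, of "act \<sigma> ?Ch"] by (intro eq_neg_self) simp
  qed
  then show ?thesis by (simp add: conv_eq[of n f] conv_sum conv_scale)
qed

text \<open>The mirror image of \<open>rowsum_conv_colsum_eq_0\<close>: the row sum on the right
  absorbs a transposition with sign 1, the column sum on the left absorbs its conjugate with sign
  -1.\<close>

lemma colsum_conv_rowsum_eq_0:
  fixes f :: "'k::field_char_0 grpalg"
  assumes "b \<le> a" "c \<le> b" "n = a + b + c" "\<And>k. k < n \<Longrightarrow> r k < 3"
    and "a < cnt n r 0 \<or> cnt n r 2 < c"
  shows "csym n (tab_col (a, b, c)) (conv n f (rsym n r h)) = 0"
proof -
  let ?Rh = "rsym n r h" and ?C = "colsum n (tab_col (a, b, c)) :: 'k grpalg"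
  have "conv n ?C (act \<sigma> ?Rh) = 0" if s: "\<sigma> \<in> Sn n" for \<sigma>
  proof -
    obtain i j where ij: "i < n" "j < n" "i \<noteq> j" "r i = r j"
        "tab_col (a, b, c) (\<sigma> i) = tab_col (a, b, c) (\<sigma> j)"
      using collision[OF assms(1-4) s assms(5)] by blast
    let ?t = "tp i j" and ?u = "tp (\<sigma> i) (\<sigma> j)"
    have t: "?t \<in> stab n r" and u: "?u \<in> stab n (tab_col (a, b, c))"
      using ij s by (auto intro!: stab_transpose simp: Sn_less)
    have ne: "\<sigma> i \<noteq> \<sigma> j" using ij(3) Sn_bij[OF s] by (auto simp: bij_def inj_eq)
    have "act \<sigma> ?Rh = act ?u (act \<sigma> ?Rh)"
      using transpose_conj[OF Sn_bij[OF s], of i j] s t u act_conv_rowsum[OF t, of h]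
      by (simp add: act_act[of _ n] stab_Sn[of _ n], metis act_act stab_Sn)
    then have "conv n ?C (act \<sigma> ?Rh) = fscale (-1) (conv n ?C (act \<sigma> ?Rh))"
      using conv_colsum_act[OF u, of "act \<sigma> ?Rh"] ne by (simp add: sign_swap_id)
    then show ?thesis by (rule eq_neg_self)
  qed
  then show ?thesis by (simp add: conv_eq[of n f] conv_sum conv_scale)
qed

lemma young_sym_eq:
  "\<nu> \<in> partitions3 n \<Longrightarrow> young_sym \<nu> = rsym n (tab_row \<nu>) (colsum n (tab_col \<nu>))"
  by (simp add: young_sym_def size3_partitions3 rowsum_def colsum_def row_group_def col_group_def stab_def)

lemma young_sym_Pn: "\<nu> \<in> partitions3 n \<Longrightarrow> young_sym \<nu> \<in> Pn n"
  by (simp add: young_sym_eq conv_Pn)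

text \<open>The first two facts are what the pigeonhole lemmas ask for. The third, lexicographic
  growth of the first two row lengths, drives the induction in
  \<open>rowsum_in_young_ideal\<close>.\<close>

lemma raised_tab_row:
  assumes "n = a + b + c" "y < n" "i < tab_row (a, b, c) y"
  defines "r \<equiv> (tab_row (a, b, c))(y := i)"
  shows "a < cnt n r 0 \<or> cnt n r 2 < c" "r k < 3"
    "cnt n (tab_row (a, b, c)) 0 < cnt n r 0 \<or>
     cnt n (tab_row (a, b, c)) 0 = cnt n r 0 \<and> cnt n (tab_row (a, b, c)) (Suc 0) < cnt n r (Suc 0)"
proof -
  note u = cnt_upd[OF assms(2) refl, of "tab_row (a, b, c)" i, folded r_def]
  note t = cnt_tab_row[of a b c, folded assms(1)]
  have T: "tab_row (a, b, c) y < 3" by (rule tab_row_less3)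
  show "r k < 3" using tab_row_less3[of "(a, b, c)" k] T assms(3) by (simp add: r_def)
  have "a < cnt n r 0 \<and> cnt n (tab_row (a, b, c)) 0 < cnt n r 0 \<or> cnt n r 2 < c \<and>
     cnt n (tab_row (a, b, c)) 0 = cnt n r 0 \<and> cnt n (tab_row (a, b, c)) (Suc 0) < cnt n r (Suc 0)"
  proof (cases "i = 0")
    case True
    then show ?thesis using u(1) t(1) assms(3) by simp
  next
    case False
    then have i: "i = Suc 0" "tab_row (a, b, c) y = 2" using assms(3) T by linarith+
    then have "cnt n r (Suc 0) = Suc b" "c = Suc (cnt n r 2)" "cnt n r 0 = a"
      using u(1,2) u(3)[of 0] t by auto
    then show ?thesis using t by simp
  qed
  then show "a < cnt n r 0 \<or> cnt n r 2 < c" "cnt n (tab_row (a, b, c)) 0 < cnt n r 0 \<or>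
     cnt n (tab_row (a, b, c)) 0 = cnt n r 0 \<and> cnt n (tab_row (a, b, c)) (Suc 0) < cnt n r (Suc 0)"
    by blast+
qed

text \<open>Raising a letter either makes row 0 longer than the number of columns or leaves fewer
  letters in row 2 than there are columns of length three. In both cases the new row sum meets the
  column sum in zero.\<close>

lemma highest_weight:
  fixes f :: "'k::field_char_0 grpalg"
  assumes "(a, b, c) \<in> partitions3 n" "y < n" "i < tab_row (a, b, c) y"
  shows "rsym n ((tab_row (a, b, c))(y := i))
    (conv n (rsym n (tab_row (a, b, c)) (colsum n (tab_col (a, b, c)))) f) = 0"
proof -
  have p: "b \<le> a" "c \<le> b" "n = a + b + c" using assms(1) by (simp_all add: partitions3_iff)
  show ?thesis unfolding conv_assoc
    by (rule rowsum_conv_colsum_eq_0[OF p raised_tab_row(2,1)[OF p(3) assms(2,3)]])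
qed

text \<open>Straightening with L = {0} and v = e makes every R g e a multiple of e, and e f e is a
  combination of such terms.\<close>

lemma young_sym_sandwich:
  fixes f :: "'k::field_char_0 grpalg"
  assumes nu: "\<nu> \<in> partitions3 n"
  shows "\<exists>c. conv n (young_sym \<nu>) (conv n f (young_sym \<nu>)) = fscale c (young_sym \<nu>)"
proof -
  let ?R = "rowsum n (tab_row \<nu>) :: 'k grpalg" and ?C = "colsum n (tab_col \<nu>) :: 'k grpalg"
  let ?e = "young_sym \<nu> :: 'k grpalg"
  have e: "?e = conv n ?R ?C" using young_sym_eq[OF nu] .
  have "\<exists>c. conv n ?R (act g ?e) - fscale c ?e \<in> {0}" if g: "g \<in> Sn n" for g
  proof (rule straighten[OF _ _ _ g])
    show "act p ?e = ?e" if "p \<in> stab n (tab_row \<nu>)" for p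
      unfolding e using act_conv_rowsum[OF that] .
    show "left_ideal n {0}" by (auto simp: left_ideal_def Pn_def)
    show "rsym n ((tab_row \<nu>)(y := i)) ?e \<in> {0}" if "y < n" "i < tab_row \<nu> y" for y i
    proof -
      obtain a b c where abc: "\<nu> = (a, b, c)" by (cases \<nu>)
      show ?thesis using highest_weight[of a b c n y i "delta id :: 'k grpalg", folded abc] nu that conv_Pn[of ?C n ?R]
        unfolding e by (simp add: conv_unit)
    qed
  qed
  then have "\<forall>g\<in>Sn n. \<exists>c. conv n ?R (act g ?e) = fscale c ?e" by auto
  from bchoice[OF this] obtain c where c: "\<forall>g\<in>Sn n. conv n ?R (act g ?e) = fscale (c g) ?e" ..
  let ?x = "conv n ?C f"
  have "conv n ?e (conv n f ?e) = conv n ?R (conv n ?x ?e)" unfolding e conv_assoc ..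
  also have "\<dots> = (\<Sum>g\<in>Sn n. fscale (?x g) (conv n ?R (act g ?e)))"
    unfolding conv_eq[of n ?x] by (simp add: conv_sum conv_scale)
  also have "\<dots> = fscale (\<Sum>g\<in>Sn n. ?x g * c g) ?e" by (simp add: c FS.scale_sum_left)
  finally show ?thesis by blast
qed

lemma young_sym_orthogonal:
  fixes f :: "'k::field_char_0 grpalg"
  assumes "\<mu> \<in> partitions3 n" "\<nu> \<in> partitions3 n" "\<mu> \<noteq> \<nu>"
  shows "conv n (young_sym \<mu>) (conv n f (young_sym \<nu>)) = 0"
proof -
  obtain a b c a' b' c' where nu: "\<nu> = (a, b, c)" and mu: "\<mu> = (a', b', c')" by (cases \<nu>, cases \<mu>)
  note p = assms[unfolded nu mu partitions3_iff]
  have n: "n = a + b + c" "n = a' + b' + c'" using p by auto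
  \<comment> \<open>Distinct triples of equal sum differ in the first or the last entry. In the
    first case the row sum of \<mu> annihilates against the column sum of \<nu>, in the second the
    column sum of \<mu> against the row sum of \<nu>.\<close>
  consider "a < a' \<or> c' < c" | "a' < a \<or> c < c'" using p by fastforce
  then show ?thesis
  proof cases
    case 1
    have "rsym n (tab_row \<mu>) (conv n (csym n (tab_col \<mu>) (conv n f (rowsum n (tab_row \<nu>))))
        (csym n (tab_col \<nu>) (delta id))) = (0 :: 'k grpalg)"
      unfolding nu by (rule rowsum_conv_colsum_eq_0)
        (use p 1 cnt_tab_row[of a' b' c', folded n(2)] in \<open>auto simp: mu tab_row_less3\<close>)
    then show ?thesis using assms by (simp add: young_sym_eq conv_assoc conv_unit)
  next
    case 2
    have "csym n (tab_col \<mu>) (conv n f (rsym n (tab_row \<nu>) (colsum n (tab_col \<nu>)))) =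
        (0 :: 'k grpalg)"
      unfolding mu by (rule colsum_conv_rowsum_eq_0)
        (use p 2 cnt_tab_row[of a b c, folded n(1)] in \<open>auto simp: nu tab_row_less3\<close>)
    then show ?thesis using assms by (simp add: young_sym_eq conv_assoc)
  qed
qed

text \<open>A permutation that preserves the row and the column of every cell is the identity, so
  the coefficient of the identity is 1.\<close>

lemma young_sym_neq_0:
  assumes nu: "\<nu> \<in> partitions3 n" shows "(young_sym \<nu> :: 'k::field_char_0 grpalg) \<noteq> 0"
proof -
  obtain a b c where abc: "\<nu> = (a, b, c)" by (cases \<nu>)
  have id: "\<sigma> = id" if s: "\<sigma> \<in> stab n (tab_row \<nu>)" "inv \<sigma> \<in> stab n (tab_col \<nu>)" for \<sigma>
  proof
    fix k
    have s': "\<sigma> \<in> stab n (tab_col \<nu>)"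
      using stab_inv[OF s(2)] Sn_inv_inv[OF stab_Sn[OF s(1)]] by simp
    show "\<sigma> k = id k"
    proof (cases "k < n")
      case True
      then have "tab_row \<nu> (\<sigma> k) = tab_row \<nu> k" "tab_col \<nu> (\<sigma> k) = tab_col \<nu> k" "\<sigma> k < n"
        using s(1) s' by (auto simp: stab_def Sn_less)
      then show ?thesis using nu True unfolding abc partitions3_iff
        by (auto simp: tab_row_def tab_col_def split: if_splits)
    next
      case False
      then show ?thesis using s(1) by (auto simp: stab_def Sn_def permutes_def)
    qed
  qed
  have "young_sym \<nu> id = (\<Sum>\<sigma>\<in>Sn n. if \<sigma> = id then 1 else 0 :: 'k)"
    unfolding young_sym_eq[OF nu] conv_def
  proof (intro sum.cong refl)
    fix \<sigma> :: "nat \<Rightarrow> nat"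
    show "rowsum n (tab_row \<nu>) \<sigma> * colsum n (tab_col \<nu>) (inv \<sigma> \<circ> id) = (if \<sigma> = id then 1 else 0 :: 'k)"
      using id[of \<sigma>] by (auto simp: rowsum_def colsum_def)
  qed
  then have "young_sym \<nu> id = (1 :: 'k)" by simp
  then show ?thesis by (metis zero_fun_def zero_neq_one)
qed

section \<open>Row sums of three-colourings and completeness of the symmetrizers\<close>

lemma relabel_colouring:
  assumes "\<And>i. cnt n r i = cnt n s i"
  shows "\<exists>g\<in>Sn n. \<forall>k<n. s (g k) = r k"
proof -
  have "mset (map r [0..<n]) = mset (map s [0..<n])"
  proof (rule multiset_eqI)
    fix i
    have "count (mset (map q [0..<n])) i = cnt n q i" for q :: "nat \<Rightarrow> nat"
    proof -
      have "count (mset (map q [0..<n])) i = length (filter ((=) i) (map q [0..<n]))"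
        by (simp only: count_mset count_list_eq_length_filter)
      also have "\<dots> = cnt n q i" unfolding length_filter_conv_card cnt_def
        by (rule arg_cong[of _ _ card]) auto
      finally show ?thesis .
    qed
    then show "count (mset (map r [0..<n])) i = count (mset (map s [0..<n])) i" using assms by simp
  qed
  then obtain p where p: "p permutes {..<length (map s [0..<n])}" "permute_list p (map s [0..<n]) = map r [0..<n]"
    by (rule mset_eq_permutation)
  have "s (p k) = r k" if "k < n" for k
  proof -
    have pk: "p k < n" using p(1) that permutes_in_image[of p "{..<n}" k] by simp
    have "permute_list p (map s [0..<n]) ! k = map s [0..<n] ! p k"
      by (rule permute_list_nth) (use p that in auto)
    then show ?thesis using that pk p(2) by simp
  qed
  then show ?thesis using p(1) by (auto simp: Sn_def)
qed

lemma conv_rowsum_relabel: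
  assumes g: "g \<in> Sn n" "\<And>k. k < n \<Longrightarrow> s (g k) = r k"
  shows "rsym n r z = act (inv g) (rsym n s (act g z))"
proof -
  have gi: "inv g \<in> Sn n" using g Sn_inv by blast
  have s: "s k = r (inv g k)" if "k < n" for k
    using g(2)[of "inv g k"] that Sn_less[OF gi] Sn_inv_o(2)[OF g(1)] by (simp add: fun_eq_iff)
  have "(\<Sum>p\<in>stab n r. act p z) = (\<Sum>q\<in>stab n s. act (inv g \<circ> (q \<circ> g)) z)"
  proof (rule sum.reindex_bij_witness[of _ "\<lambda>q. inv g \<circ> (q \<circ> g)" "\<lambda>p. g \<circ> (p \<circ> inv g)"])
    fix p assume p: "p \<in> stab n r"
    show "inv g \<circ> (g \<circ> (p \<circ> inv g) \<circ> g) = p"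
      using g by (simp add: comp_assoc Sn_inv_o_assoc)
    show "g \<circ> (p \<circ> inv g) \<in> stab n s"
      using p g gi s by (auto simp: stab_def Sn_comp Sn_less)
    show "act (inv g \<circ> (g \<circ> (p \<circ> inv g) \<circ> g)) z = act p z"
      using g by (simp add: comp_assoc Sn_inv_o_assoc)
  next
    fix q assume q: "q \<in> stab n s"
    show "g \<circ> (inv g \<circ> (q \<circ> g) \<circ> inv g) = q"
      using g by (simp add: comp_assoc Sn_inv_o_assoc)
    show "inv g \<circ> (q \<circ> g) \<in> stab n r"
    proof -
      have "r (inv g (q (g k))) = r k" if k: "k < n" for k
        using s[of "q (g k)"] q g k by (simp add: stab_def Sn_less)
      then show ?thesis using q g gi by (simp add: stab_def Sn_comp)
    qed
  qed
  also have "\<dots> = (\<Sum>q\<in>stab n s. act (inv g) (act q (act g z)))"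
    using g gi by (intro sum.cong refl) (simp add: act_act[of _ n] stab_Sn[of _ n s] Sn_comp comp_assoc)
  finally show ?thesis by (simp add: conv_rowsum act_sum)
qed

text \<open>Induction over contents, the lexicographically larger ones first: this is the triangular
  decomposition of permutation modules into Specht modules. Modulo the ideal \<open>L\<close> of the
  proof, straightening makes e a R a multiple of R, and multiplication by the column sum shows that
  the factor is 1; so R lies in e A + L.\<close>

lemma rowsum_in_young_ideal:
  fixes N :: "'k::field_char_0 grpalg set"
  assumes N: "left_ideal n N"
    and e: "\<And>\<nu> z. \<nu> \<in> partitions3 n \<Longrightarrow> z \<in> Pn n \<Longrightarrow> conv n (young_sym \<nu>) z \<in> N"
  shows "(\<And>k. k < n \<Longrightarrow> r k < 3) \<Longrightarrow> z \<in> Pn n \<Longrightarrow> rsym n r z \<in> N"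
proof (induction "n * Suc n + n - (cnt n r 0 * Suc n + cnt n r (Suc 0))" arbitrary: r z rule: less_induct)
  case less
  \<comment> \<open>The first two counts are read as the digits of a number to base n + 1, which
    turns the lexicographic order into the order of numbers.\<close>
  let ?m = "\<lambda>r. cnt n r 0 * Suc n + cnt n r (Suc 0)"
  have bound: "?m s \<le> n * Suc n + n" for s
    using cnt_le[of n s 0] cnt_le[of n s "Suc 0"] by (meson add_le_mono mult_le_mono1)
  have IH: "rsym n s z \<in> N"
    if "cnt n r 0 < cnt n s 0 \<or> cnt n r 0 = cnt n s 0 \<and> cnt n r (Suc 0) < cnt n s (Suc 0)"
      "\<And>k. k < n \<Longrightarrow> s k < 3" "z \<in> Pn n" for s z
  proof (rule less.hyps)
    have "?m r < ?m s"
    proof (cases "cnt n r 0 < cnt n s 0")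
      case True
      then have "Suc (cnt n r 0) * Suc n \<le> cnt n s 0 * Suc n" by (intro mult_le_mono1) simp
      then show ?thesis using cnt_le[of n r "Suc 0"] by simp
    qed (use that in simp)
    then show "n * Suc n + n - ?m s < n * Suc n + n - ?m r" using bound[of s] by linarith
  qed (use that in auto)
  \<comment> \<open>Renaming colours does not change the stabilizer, so a content that is not weakly
    decreasing reduces to a lexicographically larger one.\<close>
  have swap: "rsym n r z \<in> N"
    if sw: "cnt n r i < cnt n r (Suc i)" "i < 2" for i
  proof -
    let ?t = "tp i (Suc i)"
    let ?s = "\<lambda>k. ?t (r k)"
    have "stab n ?s = stab n r" by (auto simp: stab_def dest: transpose_eq_imp_eq)
    then have eq: "rowsum n ?s = (rowsum n r :: 'k grpalg)" by (simp add: rowsum_def)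
    have c: "cnt n ?s (?t m) = cnt n r m" for m by (simp add: cnt_def inj_eq[OF inj_transpose])
    have "rsym n ?s z \<in> N"
    proof (rule IH)
      show "cnt n r 0 < cnt n ?s 0 \<or> cnt n r 0 = cnt n ?s 0 \<and> cnt n r (Suc 0) < cnt n ?s (Suc 0)"
      proof (cases "i = 0")
        case True then show ?thesis using c[of "Suc 0"] sw by simp
      next
        case False
        then have "i = Suc 0" using sw by simp
        then show ?thesis using c[of 0] c[of 2] sw by (simp add: numeral_2_eq_2)
      qed
      show "?s k < 3" if "k < n" for k
        using less.prems(1)[OF that] sw by (auto simp: Transposition.transpose_def)
    qed (use less.prems in auto)
    then show ?thesis by (simp add: eq)
  qed
  show ?case
  proof (cases "cnt n r (Suc 0) \<le> cnt n r 0 \<and> cnt n r 2 \<le> cnt n r (Suc 0)")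
    case False
    then show ?thesis using swap[of 0] swap[of "Suc 0"] by (auto simp: numeral_2_eq_2)
  next
    case True
    define \<nu> where "\<nu> = (cnt n r 0, cnt n r (Suc 0), cnt n r 2)"
    have n: "n = cnt n r 0 + cnt n r (Suc 0) + cnt n r 2" using cnt_sum3[of n r] less.prems by simp
    have nu: "\<nu> \<in> partitions3 n" using True n by (simp add: \<nu>_def partitions3_iff)
    have cnt_nu: "cnt n (tab_row \<nu>) i = cnt n r i" for i
    proof -
      consider "i = 0" | "i = Suc 0" | "i = 2" | "3 \<le> i" by arith
      then show ?thesis
      proof cases
        case 4
        have "{k. k < n \<and> tab_row \<nu> k = i} = {}" using 4 tab_row_less3[of \<nu>] by (auto simp: not_less[symmetric])
        moreover have "{k. k < n \<and> r k = i} = {}" using 4 less.prems(1) by (auto simp: not_less[symmetric])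
        ultimately show ?thesis by (simp only: cnt_def)
      qed (use cnt_tab_row[of "cnt n r 0" "cnt n r (Suc 0)" "cnt n r 2", folded n] in \<open>simp_all add: \<nu>_def\<close>)
    qed
    let ?R = "rowsum n (tab_row \<nu>) :: 'k grpalg" and ?C = "colsum n (tab_col \<nu>) :: 'k grpalg"
    let ?e = "young_sym \<nu> :: 'k grpalg"
    have e_eq: "?e = conv n ?R ?C" using young_sym_eq[OF nu] .
    \<comment> \<open>The first condition sends right multiples of elements of \<open>L\<close> into
      \<open>N\<close>; the second makes \<open>L\<close> vanish under right multiplication by the
      column sum, which is how the scalar is found.\<close>
    define L where "L = {x \<in> Pn n. (\<forall>z\<in>Pn n. conv n x z \<in> N) \<and> conv n x ?C = 0}"
    have subN: "FS.subspace N" using N by (simp add: left_ideal_def)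
    have subP: "FS.subspace (Pn n :: 'k grpalg set)" by (rule subspace_Pn)
    have L: "left_ideal n L"
      unfolding left_ideal_def
    proof (intro conjI ballI)
      show "FS.subspace L"
      proof (rule FS.subspaceI)
        show "0 \<in> L" using FS.subspace_0[OF subN] FS.subspace_0[OF subP] by (simp add: L_def)
        show "x + y \<in> L" if "x \<in> L" "y \<in> L" for x y
          using that FS.subspace_add[OF subN] FS.subspace_add[OF subP] by (simp add: L_def conv_add_left)
        show "fscale k x \<in> L" if "x \<in> L" for k x
          using that FS.subspace_scale[OF subN] FS.subspace_scale[OF subP] by (simp add: L_def conv_scale_left)
      qed
      show "L \<subseteq> Pn n" by (auto simp: L_def)
      show "act \<tau> x \<in> L" if "\<tau> \<in> Sn n" "x \<in> L" for \<tau> x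
        using that N by (simp add: L_def left_ideal_def act_Pn act_conv[symmetric])
    qed
    have subL: "FS.subspace L" using L by (simp add: left_ideal_def)
    have hw: "rsym n ((tab_row \<nu>)(y := i)) ?R \<in> L" if y: "y < n" "i < tab_row \<nu> y" for y i
      unfolding L_def
    proof (intro CollectI conjI ballI)
      note rt = raised_tab_row[OF n y[unfolded \<nu>_def], folded \<nu>_def]
      show "rsym n ((tab_row \<nu>)(y := i)) ?R \<in> Pn n" by (simp add: conv_Pn)
      show "conv n (rsym n ((tab_row \<nu>)(y := i)) ?R) z \<in> N" if "z \<in> Pn n" for z
        unfolding conv_assoc
        by (rule IH) (use rt that in \<open>auto simp: cnt_nu conv_Pn\<close>)
      show "conv n (rsym n ((tab_row \<nu>)(y := i)) ?R) ?C = 0"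
        using highest_weight[of "cnt n r 0" "cnt n r (Suc 0)" "cnt n r 2" n y i "delta id :: 'k grpalg", folded \<nu>_def]
          nu y conv_Pn[of ?C n ?R] unfolding conv_assoc by (simp add: conv_unit)
    qed
    have "\<exists>c. conv n ?R (act g ?R) - fscale c ?R \<in> L" if g: "g \<in> Sn n" for g
      by (rule straighten[OF _ L hw g]) (use act_conv_rowsum[of _ n "tab_row \<nu>" "delta id"] in \<open>auto simp: conv_unit\<close>)
    then have "\<forall>g\<in>Sn n. \<exists>c. conv n ?R (act g ?R) - fscale c ?R \<in> L" by blast
    from bchoice[OF this] obtain c
      where c: "\<forall>g\<in>Sn n. conv n ?R (act g ?R) - fscale (c g) ?R \<in> L" ..
    obtain a where a: "a \<in> Pn n" "conv n ?e (conv n a ?e) = ?e"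
      using von_neumann_regular[OF young_sym_Pn[OF nu]] by blast
    let ?x = "conv n ?C a"
    define l where "l = (\<Sum>g\<in>Sn n. ?x g * c g)"
    have "(\<Sum>g\<in>Sn n. fscale (?x g) (conv n ?R (act g ?R) - fscale (c g) ?R)) \<in> L"
      using c by (intro FS.subspace_sum[OF subL] FS.subspace_scale[OF subL]) blast
    also have "(\<Sum>g\<in>Sn n. fscale (?x g) (conv n ?R (act g ?R) - fscale (c g) ?R)) =
        conv n ?e (conv n a ?R) - fscale l ?R"
    proof -
      have "conv n ?e (conv n a ?R) = conv n ?R (conv n ?x ?R)" unfolding e_eq conv_assoc ..
      also have "\<dots> = (\<Sum>g\<in>Sn n. fscale (?x g) (conv n ?R (act g ?R)))"
        unfolding conv_eq[of n ?x] by (simp add: conv_sum conv_scale)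
      finally show ?thesis by (simp add: l_def FS.scale_right_diff_distrib sum_subtractf FS.scale_sum_left)
    qed
    finally have inL: "conv n ?e (conv n a ?R) - fscale l ?R \<in> L" .
    \<comment> \<open>Right multiplication by the column sum turns R into e, and e a R into e a e =
      e.\<close>
    then have "conv n (conv n ?e (conv n a ?R) - fscale l ?R) ?C = 0" by (simp add: L_def)
    then have "?e = fscale l ?e"
      using a(2) by (simp add: conv_diff_left conv_scale_left conv_assoc flip: e_eq)
    then have "fscale (1 - l) ?e = 0" by (simp add: FS.scale_left_diff_distrib)
    then have l: "l = 1" using young_sym_neq_0[OF nu, where 'k = 'k] by (simp add: FS.scale_eq_0_iff)
    have R: "conv n ?R z \<in> N" if z: "z \<in> Pn n" for z
    proof -
      have "conv n (conv n ?e (conv n a ?R) - fscale l ?R) z \<in> N" using inL z by (simp add: L_def)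
      then have "conv n ?e (conv n a (conv n ?R z)) - conv n ?R z \<in> N"
        by (simp add: conv_diff_left l conv_assoc)
      moreover have "conv n ?e (conv n a (conv n ?R z)) \<in> N" using z by (intro e nu conv_Pn)
      ultimately have "conv n ?e (conv n a (conv n ?R z)) - (conv n ?e (conv n a (conv n ?R z)) - conv n ?R z) \<in> N"
        using FS.subspace_diff[OF subN] by blast
      then show ?thesis by simp
    qed
    obtain g where g: "g \<in> Sn n" "\<forall>k<n. tab_row \<nu> (g k) = r k"
      using relabel_colouring[of n r "tab_row \<nu>"] cnt_nu by auto
    have "act (inv g) (conv n ?R (act g z)) \<in> N"
      using N g less.prems R by (simp add: left_ideal_def Sn_inv act_Pn)
    then show ?thesis using conv_rowsum_relabel[of g n "tab_row \<nu>" r z] g by simp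
  qed
qed

text \<open>By Maschke's theorem N has a right unit f, so N annihilates y = 1 - f. The row sums of
  all three-colourings lie in N, hence annihilate y; by \<open>faithful\<close> y lies in N, and
  therefore so does 1.\<close>

lemma young_ideal_complete:
  fixes N :: "'k::field_char_0 grpalg set"
  assumes N: "left_ideal n N"
    and e: "\<And>\<nu> z. \<nu> \<in> partitions3 n \<Longrightarrow> z \<in> Pn n \<Longrightarrow> conv n (young_sym \<nu>) z \<in> N"
    and faithful: "\<And>y. y \<in> Pn n \<Longrightarrow>
      (\<And>r. (\<And>k. k < n \<Longrightarrow> r k < 3) \<Longrightarrow> rsym n r y = 0) \<Longrightarrow> y \<in> N"
  shows "N = Pn n"
proof -
  obtain f where f: "f \<in> N" "\<And>x. x \<in> N \<Longrightarrow> conv n x f = x" using maschke[OF N] by blast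
  have NP: "N \<subseteq> Pn n" and sub: "FS.subspace N" using N by (auto simp: left_ideal_def)
  define y where "y = delta id - f"
  have yP: "y \<in> Pn n" unfolding y_def using f(1) NP
    by (intro FS.subspace_diff[OF subspace_Pn]) auto
  have xy: "conv n x y = 0" if "x \<in> N" for x
    using that NP f(2)[OF that] by (auto simp: y_def conv_diff conv_unit)
  have "y \<in> N"
  proof (rule faithful[OF yP])
    fix r :: "nat \<Rightarrow> nat" assume r: "\<And>k. k < n \<Longrightarrow> r k < 3"
    have "rowsum n r \<in> N" using rowsum_in_young_ideal[OF N e r, where z = "delta id"]
      by (simp add: conv_unit)
    then show "rsym n r y = 0" by (rule xy)
  qed
  then have "delta id \<in> N" using f(1) FS.subspace_add[OF sub, of y f] by (simp add: y_def)
  then have "x \<in> N" if "x \<in> Pn n" for x using left_ideal_conv[OF N, of "delta id" x] conv_unit[OF that] by simp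
  then show ?thesis using NP by blast
qed

subsection \<open>Evaluation on skew-symmetric matrices\<close>

type_synonym 'k mat3 = "'k ^ 3 ^ 3"

definition smat :: "'k::field \<Rightarrow> 'k mat3 \<Rightarrow> 'k mat3" where
  "smat c M = (\<chi> i j. c * M $ i $ j)"

lemma smat_nth [simp]: "smat c M $ i $ j = c * M $ i $ j"
  by (simp add: smat_def)

lemma mat3_eqI: "(\<And>i j. A $ i $ j = B $ i $ j) \<Longrightarrow> A = (B :: 'k mat3)"
  by (simp add: vec_eq_iff)

lemma smat_one [simp]: "smat 1 M = M" and smat_zero [simp]: "smat 0 M = 0"
  and smat_smat [simp]: "smat c (smat d M) = smat (c * d) M"
  and smat_0_right [simp]: "smat c 0 = 0"
  and smat_add: "smat c (M + N) = smat c M + smat c N"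
  by (auto intro!: mat3_eqI simp: algebra_simps)

lemma smat_sum: "smat c (\<Sum>x\<in>A. F x) = (\<Sum>x\<in>A. smat c (F x))"
  by (rule mat3_eqI) (simp add: sum_distrib_left)

lemma smat_eq_0_iff: "smat c M = 0 \<longleftrightarrow> c = 0 \<or> M = 0"
  by (auto simp: vec_eq_iff)

lemma smat_mult_left: "smat c A ** B = smat c (A ** B)"
  and smat_mult_right: "A ** smat c B = smat c (A ** B)"
  by (auto intro!: mat3_eqI simp: matrix_matrix_mult_def sum_distrib_left mult_ac)

lemma mult_zero_mat [simp]: "A ** (0 :: 'k::field mat3) = 0" "(0 :: 'k::field mat3) ** A = 0"
  by (auto intro!: mat3_eqI simp: matrix_matrix_mult_def)

lemma mult_diff_mat: "A ** (B - C) = A ** B - A ** (C :: 'k::field mat3)"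
    "(B - C) ** A = B ** A - C ** (A :: 'k::field mat3)"
  by (auto intro!: mat3_eqI simp: matrix_matrix_mult_def sum_subtractf algebra_simps)

lemma mult_add_mat: "A ** (B + C) = A ** B + A ** (C :: 'k::field mat3)"
    "(B + C) ** A = B ** A + C ** (A :: 'k::field mat3)"
  by (auto intro!: mat3_eqI simp: matrix_matrix_mult_def sum.distrib algebra_simps)

lemma mult_sum_mat: "A ** (\<Sum>x\<in>S. F x) = (\<Sum>x\<in>S. A ** (F x :: 'k::field mat3))"
    "(\<Sum>x\<in>S. F x) ** A = (\<Sum>x\<in>S. F x ** (A :: 'k::field mat3))"
  by (auto intro!: mat3_eqI simp: matrix_matrix_mult_def sum_distrib_left sum_distrib_right intro: sum.swap)

lemma sum_const_mat: "(\<Sum>x\<in>S. M) = smat (of_nat (card S)) M"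
  by (induction S rule: infinite_finite_induct) (auto intro!: mat3_eqI simp: algebra_simps)

definition lprod :: "('k::field mat3) list \<Rightarrow> 'k mat3" where
  "lprod xs = foldr (**) xs (mat 1)"

lemma lprod_Nil [simp]: "lprod [] = mat 1" and lprod_Cons [simp]: "lprod (x # xs) = x ** lprod xs"
  by (simp_all add: lprod_def)

lemma lprod_append: "lprod (xs @ ys) = lprod xs ** lprod ys"
  by (induction xs) (auto simp: matrix_mul_assoc)

lemma monom_eval_lprod: "monom_eval n \<sigma> a = lprod (map (\<lambda>i. a (\<sigma> i)) [0..<n])"
  by (simp add: monom_eval_def lprod_def foldr_map o_def)

lemma eval_multilin_eq: "eval_multilin n c a = (\<Sum>\<sigma>\<in>Sn n. smat (c \<sigma>) (monom_eval n \<sigma> a))"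
  by (simp add: eval_multilin_def smat_def)

lemma eval_cong:
  assumes "\<And>i. i < n \<Longrightarrow> a i = b i" shows "eval_multilin n c a = eval_multilin n c b"
  unfolding eval_multilin_eq monom_eval_lprod using assms
  by (intro sum.cong refl arg_cong[of _ _ "smat _"] arg_cong[of _ _ lprod] map_cong) (auto simp: Sn_less)

lemma eval_add: "eval_multilin n (c + d) a = eval_multilin n c a + eval_multilin n d a"
  and eval_scale: "eval_multilin n (fscale t c) a = smat t (eval_multilin n c a)"
  and eval_zero [simp]: "eval_multilin n 0 a = 0"
  by (auto intro!: mat3_eqI simp: eval_multilin_eq fscale_def sum.distrib sum_distrib_left algebra_simps)

lemma eval_sum: "eval_multilin n (\<Sum>x\<in>S. c x) a = (\<Sum>x\<in>S. eval_multilin n (c x) a)"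
  by (induction S rule: infinite_finite_induct)
    (simp_all only: sum.infinite sum.empty sum.insert eval_add eval_zero not_False_eq_True)

lemma eval_act:
  assumes "\<tau> \<in> Sn n" shows "eval_multilin n (act \<tau> c) a = eval_multilin n c (\<lambda>k. a (\<tau> k))"
proof -
  have "eval_multilin n (act \<tau> c) a = (\<Sum>\<sigma>\<in>Sn n. smat (act \<tau> c (\<tau> \<circ> \<sigma>)) (monom_eval n (\<tau> \<circ> \<sigma>) a))"
    unfolding eval_multilin_eq by (rule sum_Sn_left[OF assms, symmetric])
  also have "\<dots> = eval_multilin n c (\<lambda>k. a (\<tau> k))"
    unfolding eval_multilin_eq using assms
    by (intro sum.cong refl) (simp add: act_def Sn_inv_o_assoc monom_eval_lprod)
  finally show ?thesis .
qed

lemma monom_slot: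
  assumes "\<sigma> \<in> Sn n" "k < n"
  shows "\<exists>L R. \<forall>M. monom_eval n \<sigma> (a(k := M)) = L ** M ** R"
proof -
  define i where "i = inv \<sigma> k"
  have i: "i < n" using assms(2) Sn_less[OF Sn_inv[OF assms(1)], of k] by (simp add: i_def)
  have si: "\<sigma> i = k" using fun_cong[OF Sn_inv_o(2)[OF assms(1)], of k] by (simp add: i_def)
  have ne: "\<sigma> j \<noteq> k" if "j \<noteq> i" for j using that si inj_eq[OF bij_is_inj[OF Sn_bij[OF assms(1)]], of j i] by simp
  have split: "[0..<n] = [0..<i] @ i # [Suc i..<n]"
    using i upt_add_eq_append[of 0 i "n - i"] upt_conv_Cons[of i n] by simp
  have "monom_eval n \<sigma> (a(k := M)) =
      lprod (map (\<lambda>j. a (\<sigma> j)) [0..<i]) ** M ** lprod (map (\<lambda>j. a (\<sigma> j)) [Suc i..<n])" for M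
  proof -
    have "map (\<lambda>j. (a(k := M)) (\<sigma> j)) [0..<i] = map (\<lambda>j. a (\<sigma> j)) [0..<i]"
      "map (\<lambda>j. (a(k := M)) (\<sigma> j)) [Suc i..<n] = map (\<lambda>j. a (\<sigma> j)) [Suc i..<n]"
      using ne by auto
    then show ?thesis unfolding monom_eval_lprod split map_append lprod_append list.map
      by (simp only: lprod_Cons si fun_upd_same matrix_mul_assoc)
  qed
  then show ?thesis by blast
qed

lemma eval_slot_add:
  assumes "k < n"
  shows "eval_multilin n c (a(k := M + N)) = eval_multilin n c (a(k := M)) + eval_multilin n c (a(k := N))"
  unfolding eval_multilin_eq sum.distrib[symmetric]
proof (intro sum.cong refl)
  fix \<sigma> assume "\<sigma> \<in> Sn n"
  then obtain L R where "\<forall>M. monom_eval n \<sigma> (a(k := M)) = L ** M ** R" using monom_slot assms by blast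
  then show "smat (c \<sigma>) (monom_eval n \<sigma> (a(k := M + N))) =
      smat (c \<sigma>) (monom_eval n \<sigma> (a(k := M))) + smat (c \<sigma>) (monom_eval n \<sigma> (a(k := N)))"
    by (simp add: mult_add_mat smat_add)
qed

lemma eval_slot_scale:
  assumes "k < n"
  shows "eval_multilin n c (a(k := smat t M)) = smat t (eval_multilin n c (a(k := M)))"
  unfolding eval_multilin_eq smat_sum
proof (intro sum.cong refl)
  fix \<sigma> assume "\<sigma> \<in> Sn n"
  then obtain L R where "\<forall>M. monom_eval n \<sigma> (a(k := M)) = L ** M ** R" using monom_slot assms by blast
  then show "smat (c \<sigma>) (monom_eval n \<sigma> (a(k := smat t M))) = smat t (smat (c \<sigma>) (monom_eval n \<sigma> (a(k := M))))"
    by (simp add: smat_mult_left smat_mult_right mult.commute)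
qed

lemma eval_slot_zero: "k < n \<Longrightarrow> eval_multilin n c (a(k := 0)) = 0"
  using eval_slot_scale[of k n c a 0 0] by simp

lemma commutator_lprod:
  "s ** lprod xs - lprod xs ** s = (\<Sum>i<length xs. lprod (xs[i := s ** xs ! i - xs ! i ** s]))"
proof (induction xs)
  case Nil then show ?case by simp
next
  case (Cons x xs)
  have "s ** lprod (x # xs) - lprod (x # xs) ** s =
      (s ** x - x ** s) ** lprod xs + x ** (s ** lprod xs - lprod xs ** s)"
    by (simp add: mult_diff_mat matrix_mul_assoc)
  then show ?case unfolding Cons.IH by (simp add: sum.lessThan_Suc_shift mult_sum_mat del: sum.lessThan_Suc)
qed

text \<open>Commutation with s is a derivation, and in a multilinear polynomial the Leibniz rule
  changes one argument at a time.\<close>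

lemma eval_derivation:
  "s ** eval_multilin n c a - eval_multilin n c a ** s =
    (\<Sum>k<n. eval_multilin n c (a(k := s ** a k - a k ** s)))"
proof -
  have m: "s ** monom_eval n \<sigma> a - monom_eval n \<sigma> a ** s =
      (\<Sum>k<n. monom_eval n \<sigma> (a(k := s ** a k - a k ** s)))" if s: "\<sigma> \<in> Sn n" for \<sigma>
  proof -
    let ?xs = "map (\<lambda>i. a (\<sigma> i)) [0..<n]"
    have "s ** monom_eval n \<sigma> a - monom_eval n \<sigma> a ** s = (\<Sum>i<n. lprod (?xs[i := s ** ?xs ! i - ?xs ! i ** s]))"
      unfolding monom_eval_lprod commutator_lprod by simp
    also have "\<dots> = (\<Sum>i<n. monom_eval n \<sigma> (a(\<sigma> i := s ** a (\<sigma> i) - a (\<sigma> i) ** s)))"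
      unfolding monom_eval_lprod
    proof (intro sum.cong refl arg_cong[of _ _ lprod] nth_equalityI)
      fix i j assume "i \<in> {..<n}" "j < length (?xs[i := s ** ?xs ! i - ?xs ! i ** s])"
      then show "?xs[i := s ** ?xs ! i - ?xs ! i ** s] ! j =
          map (\<lambda>ia. (a(\<sigma> i := s ** a (\<sigma> i) - a (\<sigma> i) ** s)) (\<sigma> ia)) [0..<n] ! j"
        using Sn_bij[OF s] by (cases "i = j") (auto simp: bij_def inj_eq)
    qed simp
    also have "\<dots> = (\<Sum>k<n. monom_eval n \<sigma> (a(k := s ** a k - a k ** s)))"
      using sum.permute[of \<sigma> "{..<n}" "\<lambda>k. monom_eval n \<sigma> (a(k := s ** a k - a k ** s))"] s
      by (simp add: Sn_def o_def)
    finally show ?thesis .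
  qed
  have "s ** eval_multilin n c a - eval_multilin n c a ** s =
      (\<Sum>\<sigma>\<in>Sn n. smat (c \<sigma>) (s ** monom_eval n \<sigma> a - monom_eval n \<sigma> a ** s))"
    unfolding eval_multilin_eq
    by (simp add: mult_sum_mat smat_mult_left smat_mult_right sum_subtractf[symmetric])
      (intro sum.cong refl mat3_eqI, simp add: algebra_simps)
  also have "\<dots> = (\<Sum>\<sigma>\<in>Sn n. \<Sum>k<n. smat (c \<sigma>) (monom_eval n \<sigma> (a(k := s ** a k - a k ** s))))"
    by (intro sum.cong refl) (simp add: m smat_sum)
  also have "\<dots> = (\<Sum>k<n. eval_multilin n c (a(k := s ** a k - a k ** s)))"
    unfolding eval_multilin_eq by (rule sum.swap)
  finally show ?thesis .
qed

text \<open>\<open>hat i\<close> is the matrix of the cross product with the \<open>i\<close>-th standard basis vector.\<close>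

definition hat :: "nat \<Rightarrow> 'k::field mat3" where
  "hat i = (if i = 0 then vector [vector [0, 0, 0], vector [0, 0, -1], vector [0, 1, 0]]
    else if i = 1 then vector [vector [0, 0, 1], vector [0, 0, 0], vector [-1, 0, 0]]
    else vector [vector [0, -1, 0], vector [1, 0, 0], vector [0, 0, 0]])"

lemmas mat3_simps = vec_eq_iff forall_3 matrix_matrix_mult_def sum_3 vector_3 hat_def

lemma hat_so3: "hat i \<in> so3"
  by (simp add: so3_def transpose_def mat3_simps)

lemma so3_expand:
  fixes M :: "'k::field_char_0 mat3"
  assumes "M \<in> so3" shows "\<exists>x y z. M = smat x (hat 0) + (smat y (hat 1) + smat z (hat 2))"
proof -
  have s: "M $ j $ i = - M $ i $ j" for i j
  proof -
    have "transpose M $ i $ j = (- M) $ i $ j" using assms by (simp only: so3_def mem_Collect_eq)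
    then show ?thesis by (simp add: transpose_def)
  qed
  have "M $ i $ i = 0" for i using s[of i i] by simp
  then show ?thesis using s[of 2 1] s[of 1 3] s[of 3 2]
    by (intro exI[of _ "M $ 3 $ 2"] exI[of _ "M $ 1 $ 3"] exI[of _ "M $ 2 $ 1"]) (simp add: mat3_simps)
qed

text \<open>The third axis \<open>3 - l - k\<close> generates the rotations of the plane of l and k,
  so it exchanges the two basis elements up to sign; \<open>e\<close> is 1 exactly for cyclically
  ordered pairs.\<close>

lemma hat_commutator:
  assumes "l < 3" "k < 3" "l \<noteq> k"
  shows "\<exists>e :: 'k::field. e \<noteq> 0 \<and> hat (3 - l - k) ** hat l - hat l ** hat (3 - l - k) = smat e (hat k) \<and>
    hat (3 - l - k) ** hat k - hat k ** hat (3 - l - k) = smat (- e) (hat l)"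
proof -
  define e :: 'k where "e = (if (l, k) \<in> {(0, 1), (1, 2), (2, 0)} then 1 else -1)"
  have "(l, k) \<in> {(0, 1), (1, 2), (2, 0), (1, 0), (2, 1), (0, 2)}" using assms by auto
  then show ?thesis by (intro exI[of _ e]) (auto simp: e_def mat3_simps)
qed

section \<open>Evaluation on words in the basis of so_3\<close>

definition wev :: "nat \<Rightarrow> 'k::field grpalg \<Rightarrow> (nat \<Rightarrow> nat) \<Rightarrow> 'k mat3" where
  "wev n c w = eval_multilin n c (\<lambda>k. hat (w k))"

lemma wev_cong: "(\<And>i. i < n \<Longrightarrow> w i = u i) \<Longrightarrow> wev n c w = wev n c u"
  unfolding wev_def by (rule eval_cong) simp

lemma wev_act: "\<tau> \<in> Sn n \<Longrightarrow> wev n (act \<tau> c) w = wev n c (\<lambda>k. w (\<tau> k))"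
  by (simp add: wev_def eval_act)

lemmas wev_add = eval_add[of n c d "\<lambda>k. hat (w k)" for n c d w, folded wev_def]
  and wev_scale = eval_scale[of n t c "\<lambda>k. hat (w k)" for n t c w, folded wev_def]
  and wev_sum = eval_sum[of n c S "\<lambda>k. hat (w k)" for n c S w, folded wev_def]
  and wev_zero [simp] = eval_zero[of n "\<lambda>k. hat (w k)" for n w, folded wev_def]

lemma wev_derivation:
  "s ** wev n c w - wev n c w ** s =
    (\<Sum>k<n. eval_multilin n c ((\<lambda>k. hat (w k))(k := s ** hat (w k) - hat (w k) ** s)))"
  unfolding wev_def by (rule eval_derivation)

lemma hat_upd: "(\<lambda>k. hat (w k))(q := hat j) = (\<lambda>k. hat ((w(q := j)) k))"
  by auto

text \<open>By multilinearity it suffices to test basis elements. In the induction the first m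
  arguments are arbitrary skew-symmetric matrices and the others are basis elements.\<close>

lemma weak_ids_words:
  fixes c :: "'k::field_char_0 grpalg"
  shows "c \<in> weak_ids_Pn n \<longleftrightarrow> c \<in> Pn n \<and> (\<forall>w. (\<forall>k<n. w k < 3) \<longrightarrow> wev n c w = 0)"
proof safe
  assume c: "c \<in> weak_ids_Pn n"
  then show "c \<in> Pn n" by (simp add: weak_ids_Pn_def)
  show "wev n c w = 0" for w using c by (simp add: weak_ids_Pn_def wev_def hat_so3)
next
  assume c: "c \<in> Pn n" and w: "\<forall>w. (\<forall>k<n. w k < 3) \<longrightarrow> wev n c w = 0"
  have "eval_multilin n c a = 0"
    if "m \<le> n" "\<And>i. i < m \<Longrightarrow> a i \<in> so3" "\<And>i. m \<le> i \<Longrightarrow> i < n \<Longrightarrow> \<exists>j<3. a i = hat j" for a m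
    using that
  proof (induction m arbitrary: a)
    case 0
    then have "\<forall>i. \<exists>j. i < n \<longrightarrow> j < 3 \<and> a i = hat j" by blast
    then obtain u where u: "\<And>i. i < n \<Longrightarrow> u i < 3 \<and> a i = hat (u i)" by metis
    then have "eval_multilin n c a = wev n c u" unfolding wev_def by (intro eval_cong) auto
    then show ?case using w u by simp
  next
    case (Suc m)
    have m: "m < n" using Suc.prems by simp
    have z: "eval_multilin n c (a(m := hat j)) = 0" if "j < 3" for j
    proof (rule Suc.IH)
      show "\<exists>j'<3. (a(m := hat j)) i = hat j'" if "m \<le> i" "i < n" for i
        using that \<open>j < 3\<close> Suc.prems(3)[of i] by (cases "i = m") auto
    qed (use Suc.prems in auto)
    obtain x y t where "a m = smat x (hat 0) + (smat y (hat 1) + smat t (hat 2))"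
      using so3_expand Suc.prems(2)[of m] by blast
    then have "eval_multilin n c a = eval_multilin n c (a(m := smat x (hat 0) + (smat y (hat 1) + smat t (hat 2))))"
      by (metis fun_upd_triv)
    also have "\<dots> = 0" using m z[of 0] z[of 1] z[of 2] by (simp add: eval_slot_add eval_slot_scale)
    finally show ?case .
  qed
  from this[OF order_refl] show "c \<in> weak_ids_Pn n" using c by (simp add: weak_ids_Pn_def)
qed

lemma left_ideal_weak_ids: "left_ideal n (weak_ids_Pn n :: 'k::field_char_0 grpalg set)"
  unfolding left_ideal_def
proof (intro conjI ballI)
  have P: "FS.subspace (Pn n :: 'k grpalg set)" by (rule subspace_Pn)
  show "FS.subspace (weak_ids_Pn n :: 'k grpalg set)"
    by (rule FS.subspaceI)
      (auto simp: weak_ids_words wev_add wev_scale FS.subspace_0[OF P] FS.subspace_add[OF P] FS.subspace_scale[OF P])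
  show "(weak_ids_Pn n :: 'k grpalg set) \<subseteq> Pn n" by (auto simp: weak_ids_Pn_def)
  fix \<tau> :: "nat \<Rightarrow> nat" and x :: "'k grpalg" assume "\<tau> \<in> Sn n" "x \<in> weak_ids_Pn n"
  then show "act \<tau> x \<in> weak_ids_Pn n"
    by (auto simp: weak_ids_words wev_act act_Pn Sn_less)
qed

text \<open>The word r is unchanged by every permutation in its own stabilizer.\<close>

lemma wev_rowsum:
  "wev n (rsym n r z) r = smat (of_nat (card (stab n r))) (wev n z r)"
proof -
  have "wev n (rsym n r z) r = (\<Sum>p\<in>stab n r. wev n z (\<lambda>k. r (p k)))"
    by (simp add: conv_rowsum wev_sum wev_act[OF stab_Sn])
  also have "\<dots> = (\<Sum>p\<in>stab n r. wev n z r)"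
    by (intro sum.cong refl wev_cong) (simp add: stab_def)
  finally show ?thesis by (simp only: sum_const_mat)
qed

text \<open>A word in three letters is itself a colouring w with three colours, and evaluating the
  row sum of w at w only multiplies the value by the order of the stabilizer. Here the dimension of
  \<open>so3\<close> limits the shapes to three rows.\<close>

lemma rowsums_faithful:
  fixes y :: "'k::field_char_0 grpalg"
  assumes y: "y \<in> Pn n" and 0: "\<And>r. (\<And>k. k < n \<Longrightarrow> r k < 3) \<Longrightarrow> rsym n r y = 0"
  shows "y \<in> weak_ids_Pn n"
  unfolding weak_ids_words
proof (intro conjI allI impI y)
  fix w :: "nat \<Rightarrow> nat" assume w: "\<forall>k<n. w k < 3"
  have "0 = smat (of_nat (card (stab n w))) (wev n y w)"
    using wev_rowsum[of n w y] 0[of w] w by simp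
  then show "wev n y w = 0" using stab_id[of n w]
    by (auto simp: smat_eq_0_iff card_eq_0_iff simp del: stab_id)
qed

text \<open>Induction on the number of places where w differs from r. A place with w y < r y is
  treated by the raising relation. If all deviations go upwards, one of them is created by commuting
  the value at a closer word with the rotation that takes r p to w p. That value is zero by
  induction, and each term of the commutator is zero or the same nonzero multiple of the value at
  w.\<close>

lemma highest_weight_value_determines:
  fixes f :: "'k::field_char_0 grpalg"
  assumes inv: "\<And>p. p \<in> stab n r \<Longrightarrow> act p f = f" and r: "\<And>k. k < n \<Longrightarrow> r k < 3"
    and hw: "\<And>y i. y < n \<Longrightarrow> i < r y \<Longrightarrow> rsym n (r(y := i)) f = 0"
    and 0: "wev n f r = 0"
  shows "(\<And>k. k < n \<Longrightarrow> w k < 3) \<Longrightarrow> wev n f w = 0"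
proof (induction "card {k. k < n \<and> w k \<noteq> r k}" arbitrary: w rule: less_induct)
  case less
  let ?d = "\<lambda>w. card {k. k < n \<and> w k \<noteq> r k}"
  have IH: "wev n f u = 0" if "{k. k < n \<and> u k \<noteq> r k} \<subset> {k. k < n \<and> v k \<noteq> r k}" "?d v \<le> ?d w"
    "\<And>k. k < n \<Longrightarrow> u k < 3" for u v
  proof (rule less.hyps)
    have "?d u < ?d v" using that(1) by (intro psubset_card_mono) auto
    then show "?d u < ?d w" using that(2) by simp
  qed (use that in auto)
  \<comment> \<open>The claim covers all words with at most as many deviations as w, because the
    rotation used below also produces other words with a raised letter.\<close>
  have raised: "wev n f u = 0"
    if u: "\<And>k. k < n \<Longrightarrow> u k < 3" "?d u \<le> ?d w" and y: "y < n" "u y < r y" for u y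
  proof -
    let ?t = "\<lambda>x. tp x y"
    \<comment> \<open>For x in A the swap of x and y leaves the word unchanged. For x in B it puts
      the correct letter u y = r x at x, and y deviates anyway, so there are fewer
      deviations.\<close>
    let ?A = "{x. x < n \<and> r x = u y \<and> u x = u y}" and ?B = "{x. x < n \<and> r x = u y \<and> u x \<noteq> u y}"
    have XAB: "{x. x < n \<and> r x = u y} = ?A \<union> ?B" "?A \<inter> ?B = {}" by auto
    have "f + (\<Sum>x | x < n \<and> r x = u y. act (?t x) f) \<in> {0}"
      by (rule raising[OF inv]) (use y hw in auto)
    then have "0 = wev n (f + (\<Sum>x | x < n \<and> r x = u y. act (?t x) f)) u" by simp
    also have "\<dots> = wev n f u + (\<Sum>x | x < n \<and> r x = u y. wev n f (\<lambda>k. u (?t x k)))"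
      using y by (simp add: wev_add wev_sum wev_act Sn_transpose)
    also have "(\<Sum>x | x < n \<and> r x = u y. wev n f (\<lambda>k. u (?t x k))) =
        (\<Sum>x\<in>?A. wev n f (\<lambda>k. u (?t x k))) + (\<Sum>x\<in>?B. wev n f (\<lambda>k. u (?t x k)))"
      unfolding XAB(1) by (rule sum.union_disjoint) (use XAB(2) in auto)
    also have "(\<Sum>x\<in>?A. wev n f (\<lambda>k. u (?t x k))) = (\<Sum>x\<in>?A. wev n f u)"
      by (intro sum.cong refl wev_cong) (auto simp: Transposition.transpose_def)
    also have "(\<Sum>x\<in>?B. wev n f (\<lambda>k. u (?t x k))) = 0"
    proof (rule sum.neutral, rule ballI)
      fix x assume x: "x \<in> ?B"
      show "wev n f (\<lambda>k. u (?t x k)) = 0"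
      proof (rule IH[of _ u])
        have "{k. k < n \<and> u (?t x k) \<noteq> r k} \<subseteq> {k. k < n \<and> u k \<noteq> r k}"
          using x y by (auto simp: Transposition.transpose_def)
        moreover have "x \<in> {k. k < n \<and> u k \<noteq> r k}" "x \<notin> {k. k < n \<and> u (?t x k) \<noteq> r k}"
          using x by auto
        ultimately show "{k. k < n \<and> u (?t x k) \<noteq> r k} \<subset> {k. k < n \<and> u k \<noteq> r k}" by blast
        show "u (?t x k) < 3" if "k < n" for k
          using that u(1) x y by (auto simp: Transposition.transpose_def)
      qed (use u in auto)
    qed
    finally have "smat (1 + of_nat (card ?A)) (wev n f u) = 0"
      unfolding sum_const_mat by (simp add: vec_eq_iff algebra_simps)
    then show ?thesis by (simp only: smat_eq_0_iff of_nat_Suc[symmetric] of_nat_eq_0_iff) simp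
  qed
  show ?case
  proof (cases "\<exists>y<n. w y < r y")
    case True
    then obtain y where "y < n" "w y < r y" by blast
    then show ?thesis using raised[of w] less.prems by auto
  next
    case False
    show ?thesis
    proof (cases "\<exists>p<n. w p \<noteq> r p")
      case False
      then have "wev n f w = wev n f r" by (intro wev_cong) auto
      then show ?thesis using 0 by simp
    next
      case True
      then obtain p where p: "p < n" "w p \<noteq> r p" by auto
      define k l m where "k = w p" and "l = r p" and "m = 3 - l - k"
      have lk: "l < k" "l < 3" "k < 3" using p False less.prems[of p] r[of p]
        unfolding k_def l_def by (metis linorder_neqE_nat)+
      \<comment> \<open>The correct letter is restored at p, so the value at v is zero by induction;
        the commutator of this value with \<open>hat m\<close> is expanded letter by letter.\<close>
      define v where "v = w(p := l)"
      have v3: "v q < 3" if "q < n" for q using that less.prems[of q] lk by (auto simp: v_def)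
      have dv: "{q. q < n \<and> v q \<noteq> r q} \<subset> {q. q < n \<and> w q \<noteq> r q}"
        using p by (auto simp: v_def l_def)
      have v0: "wev n f v = 0" by (rule IH[OF dv]) (use v3 in auto)
      obtain e :: 'k where e: "e \<noteq> 0" "hat m ** hat l - hat l ** hat m = smat e (hat k)"
          "hat m ** hat k - hat k ** hat m = smat (- e) (hat l)"
        using hat_commutator[of l k] lk unfolding m_def by (metis less_irrefl)
      let ?T = "\<lambda>q. eval_multilin n f ((\<lambda>k. hat (v k))(q := hat m ** hat (v q) - hat (v q) ** hat m))"
      \<comment> \<open>The positions that contribute the value at w: p itself and the letters of
        row l that w leaves in place. By the row symmetry of f, changing any of them to k amounts to
        changing p.\<close>
      define Q where "Q = insert p {q. q < n \<and> q \<noteq> p \<and> w q = l \<and> r q = l}"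
      have upd: "wev n f (v(q := j)) = 0" if q: "q < n" "v q \<noteq> r q" "j < 3" for q j
      proof (rule IH[of _ w])
        show "{k. k < n \<and> (v(q := j)) k \<noteq> r k} \<subset> {k. k < n \<and> w k \<noteq> r k}"
          using dv q by auto
        show "(v(q := j)) k < 3" if "k < n" for k using that v3 q by simp
      qed simp
      have T_in: "?T q = smat e (wev n f w)" if q: "q \<in> Q" for q
      proof -
        have qn: "q < n" and vq: "v q = l" using q p by (auto simp: Q_def v_def)
        have "?T q = smat e (wev n f (v(q := k)))"
          by (simp only: vq e eval_slot_scale[OF qn] hat_upd wev_def)
        also have "wev n f (v(q := k)) = wev n f w"
        proof (cases "q = p")
          case True then show ?thesis by (simp add: v_def k_def)
        next
          case False
          then have q': "w q = l" "r q = l" using q by (auto simp: Q_def)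
          let ?t = "tp p q"
          have t: "?t \<in> stab n r" using p qn q' by (intro stab_transpose) (auto simp: l_def)
          have "wev n f w = wev n f (\<lambda>k. w (?t k))"
            using inv[OF t] wev_act[OF stab_Sn[OF t], of f w] by simp
          also have "(\<lambda>k. w (?t k)) = v(q := k)"
            using False q' by (auto simp: v_def k_def Transposition.transpose_def fun_eq_iff)
          finally show ?thesis by (rule sym)
        qed
        finally show ?thesis .
      qed
      have T_out: "?T q = 0" if q: "q < n" "q \<notin> Q" for q
      proof -
        have qp: "q \<noteq> p" using q by (auto simp: Q_def)
        \<comment> \<open>Changing a letter at a deviating place adds no deviation to v; a correct
          letter k becomes l < k, which is a raised letter; and the letter m commutes with
          \<open>hat m\<close>.\<close>
        have "v q = l \<or> v q = k \<or> v q = m" using v3[OF q(1)] lk unfolding m_def by linarith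
        then consider "v q = l" "r q \<noteq> l" | "v q = k" "r q = k" | "v q = k" "r q \<noteq> k" | "v q = m"
          using q qp by (auto simp: Q_def v_def)
        then show ?thesis
        proof cases
          case 1
          have "?T q = smat e (wev n f (v(q := k)))"
            by (simp only: 1 e eval_slot_scale[OF q(1)] hat_upd wev_def)
          then show ?thesis using upd[of q k] 1 q lk by simp
        next
          case 2
          have "?T q = smat (- e) (wev n f (v(q := l)))"
            by (simp only: 2 e eval_slot_scale[OF q(1)] hat_upd wev_def)
          moreover have "wev n f (v(q := l)) = 0"
          proof (rule raised[of _ q])
            have "{k. k < n \<and> (v(q := l)) k \<noteq> r k} \<subseteq> insert q {k. k < n \<and> v k \<noteq> r k}" by auto
            from card_mono[OF _ this] have "?d (v(q := l)) \<le> card (insert q {k. k < n \<and> v k \<noteq> r k})" by simp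
            also have "\<dots> \<le> Suc (?d v)" by (simp add: card_insert_if)
            also have "?d v < ?d w" using dv by (intro psubset_card_mono) auto
            finally show "?d (v(q := l)) \<le> ?d w" by simp
          qed (use 2 lk q v3 in auto)
          ultimately show ?thesis by simp
        next
          case 3
          have "?T q = smat (- e) (wev n f (v(q := l)))"
            by (simp only: 3 e eval_slot_scale[OF q(1)] hat_upd wev_def)
          then show ?thesis using upd[of q l] 3 q lk by simp
        next
          case 4
          then show ?thesis using q by (simp add: eval_slot_zero)
        qed
      qed
      have Q: "Q \<subseteq> {..<n}" using p by (auto simp: Q_def)
      have fQ: "finite Q" using Q finite_subset by blast
      have "0 = (\<Sum>q<n. ?T q)" using wev_derivation[of "hat m" n f v] by (simp only: v0 mult_zero_mat diff_self)
      also have "\<dots> = (\<Sum>q\<in>Q. ?T q)"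
        by (rule sum.mono_neutral_right) (use Q T_out in auto)
      also have "\<dots> = (\<Sum>q\<in>Q. smat e (wev n f w))" using T_in by (rule sum.cong[OF refl])
      also have "\<dots> = smat (of_nat (card Q)) (smat e (wev n f w))" by (rule sum_const_mat)
      finally have "of_nat (card Q) * e = 0 \<or> wev n f w = 0" by (simp add: smat_eq_0_iff)
      moreover have "card Q \<noteq> 0" using fQ by (auto simp: card_eq_0_iff Q_def)
      ultimately show ?thesis using e(1) by simp
    qed
  qed
qed

subsection \<open>Values at highest weight words\<close>

definition colgrp :: "(nat \<Rightarrow> nat) \<Rightarrow> nat set \<Rightarrow> (nat \<Rightarrow> nat) set" where
  "colgrp col S = {q. q permutes S \<and> (\<forall>k\<in>S. col (q k) = col k)}"

lemma colgrp_stab: "colgrp col {..<n} = stab n col"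
  by (auto simp: colgrp_def stab_def Sn_def)

lemma colgrp_restrict:
  assumes S: "finite S" "T \<subseteq> S" "\<And>x y. x \<in> T \<Longrightarrow> y \<in> S - T \<Longrightarrow> col x \<noteq> col y" and s: "s \<in> colgrp col S"
  shows "(\<lambda>k. if k \<in> T then s k else k) \<in> colgrp col T"
proof -
  have "s ` T \<subseteq> T"
  proof
    fix y assume "y \<in> s ` T"
    then obtain x where x: "x \<in> T" "y = s x" by auto
    then have "y \<in> S" "col y = col x" using s S(2) permutes_in_image[of s S x] by (auto simp: colgrp_def)
    then show "y \<in> T" using S(3)[OF x(1), of y] by auto
  qed
  moreover have inj: "inj_on s T" using s permutes_inj_on[of s S] by (auto simp: colgrp_def)
  moreover have "finite T" using S finite_subset by blast
  ultimately have "s ` T = T" by (simp add: endo_inj_surj)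
  then have "bij_betw (\<lambda>k. if k \<in> T then s k else k) T T"
    using inj by (simp add: bij_betw_def inj_on_def)
  then have "(\<lambda>k. if k \<in> T then s k else k) permutes T" by (intro bij_imp_permutes) auto
  then show ?thesis using s S(2) by (auto simp: colgrp_def)
qed

text \<open>No column meets both S and T, so the column group is a direct product; the inverse map
  restricts a permutation to each of the two parts.\<close>

lemma colgrp_Un:
  assumes S: "finite S" "finite T" "\<And>x y. x \<in> S \<Longrightarrow> y \<in> T \<Longrightarrow> col x \<noteq> col y"
  shows "bij_betw (\<lambda>(p, q). p \<circ> q) (colgrp col S \<times> colgrp col T) (colgrp col (S \<union> T))"
proof -
  let ?r = "\<lambda>T s k. if k \<in> T then s k else k"
  have disj: "S \<inter> T = {}" using S(3) by blast
  have app: "(p \<circ> q) k = (if k \<in> S then p k else q k)"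
    if pq: "p permutes S" "q permutes T" for p q k
  proof (cases "k \<in> S")
    case True
    then have "k \<notin> T" using disj by blast
    then show ?thesis using True permutes_not_in[OF pq(2)] by simp
  next
    case False
    have "q k \<notin> S"
    proof (cases "k \<in> T")
      case True then show ?thesis using pq(2) disj permutes_in_image[of q T k] by blast
    qed (use False permutes_not_in[OF pq(2), of k] in auto)
    then show ?thesis using False permutes_not_in[OF pq(1)] by simp
  qed
  show ?thesis
  proof (rule bij_betw_byWitness[where f' = "\<lambda>s. (?r S s, ?r T s)"])
    show "\<forall>a\<in>colgrp col S \<times> colgrp col T.
        (\<lambda>s. (?r S s, ?r T s)) ((\<lambda>(p, q). p \<circ> q) a) = a"
    proof (rule ballI)
      fix z assume "z \<in> colgrp col S \<times> colgrp col T"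
      then obtain p q where z: "z = (p, q)" and pq: "p \<in> colgrp col S" "q \<in> colgrp col T" by blast
      then have pq': "p permutes S" "q permutes T" by (auto simp: colgrp_def)
      have "?r S (p \<circ> q) = p"
        using app[OF pq'] permutes_not_in[OF pq'(1)] by auto
      moreover have "?r T (p \<circ> q) = q"
      proof (rule ext)
        fix k
        have "k \<in> T \<Longrightarrow> k \<notin> S" using disj by blast
        then show "(if k \<in> T then (p \<circ> q) k else k) = q k"
          using app[OF pq', of k] permutes_not_in[OF pq'(2), of k] by (cases "k \<in> T") simp_all
      qed
      ultimately show "(\<lambda>s. (?r S s, ?r T s))
          ((\<lambda>(p, q). p \<circ> q) z) = z"
        unfolding z prod.case by (rule arg_cong2[of _ _ _ _ Pair])
    qed
    have res: "?r S s \<in> colgrp col S" "?r T s \<in> colgrp col T"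
      if s: "s \<in> colgrp col (S \<union> T)" for s
    proof -
      show "?r S s \<in> colgrp col S"
        by (rule colgrp_restrict[OF _ _ _ s]) (use S in auto)
      have "col x \<noteq> col y" if "x \<in> T" "y \<in> S \<union> T - T" for x y using that S(3)[of y x] by auto
      then show "?r T s \<in> colgrp col T"
        by (intro colgrp_restrict[OF _ _ _ s]) (use S in auto)
    qed
    then show "(\<lambda>s. (?r S s, ?r T s)) ` colgrp col (S \<union> T)
        \<subseteq> colgrp col S \<times> colgrp col T" by blast
    show "\<forall>s\<in>colgrp col (S \<union> T). (\<lambda>(p, q). p \<circ> q)
        ((\<lambda>s. (?r S s, ?r T s)) s) = s"
    proof
      fix s assume s: "s \<in> colgrp col (S \<union> T)"
      let ?p = "?r S s" and ?q = "?r T s"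
      have pq: "?p permutes S" "?q permutes T" using res[OF s] by (auto simp: colgrp_def)
      have "?p \<circ> ?q = s"
      proof
        fix k
        show "(?p \<circ> ?q) k = s k"
          using app[OF pq, of k] s permutes_not_in[of s "S \<union> T" k] by (auto simp: colgrp_def)
      qed
      then show "(\<lambda>(p, q). p \<circ> q) (?p, ?q) = s" by simp
    qed
    show "(\<lambda>(p, q). p \<circ> q) ` (colgrp col S \<times> colgrp col T) \<subseteq> colgrp col (S \<union> T)"
    proof (rule image_subsetI)
      fix z assume "z \<in> colgrp col S \<times> colgrp col T"
      then obtain p q where z: "z = (p, q)" and pq: "p \<in> colgrp col S" "q \<in> colgrp col T" by blast
      then have pq': "p permutes S" "q permutes T" by (auto simp: colgrp_def)
      have "p \<circ> q permutes S \<union> T"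
        by (rule permutes_compose) (use pq' in \<open>auto intro: permutes_subset\<close>)
      moreover have "col ((p \<circ> q) k) = col k" if "k \<in> S \<union> T" for k
        using app[OF pq', of k] that pq by (auto simp: colgrp_def)
      ultimately show "(\<lambda>(p, q). p \<circ> q) z \<in> colgrp col (S \<union> T)" by (simp add: colgrp_def z)
    qed
  qed
qed

text \<open>For a list of all letters this is the value of a column-alternated monomial; for a
  shorter list consisting of whole columns it is the factor that these columns contribute.\<close>

definition alt :: "(nat \<Rightarrow> nat) \<Rightarrow> (nat \<Rightarrow> 'k::field mat3) \<Rightarrow> nat list \<Rightarrow> 'k mat3" where
  "alt col h L = (\<Sum>q\<in>colgrp col (set L). smat (of_int (sign q)) (lprod (map (\<lambda>x. h (q x)) L)))"

lemma colgrp_finite [simp]: "finite S \<Longrightarrow> finite (colgrp col S)"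
  by (rule finite_subset[OF _ finite_permutations[of S]]) (auto simp: colgrp_def)

text \<open>The letters of L2 share no column with the others, so the column group factors and the
  inner alternation can be evaluated on its own. This allows a column to surround other
  columns.\<close>

lemma alt_wrap:
  assumes disj: "\<And>x y. x \<in> set (L1 @ L3) \<Longrightarrow> y \<in> set L2 \<Longrightarrow> col x \<noteq> col y"
  shows "alt col h (L1 @ L2 @ L3) = (\<Sum>p\<in>colgrp col (set (L1 @ L3)).
    smat (of_int (sign p)) (lprod (map (\<lambda>x. h (p x)) L1) ** alt col h L2 ** lprod (map (\<lambda>x. h (p x)) L3)))"
proof -
  let ?S = "set (L1 @ L3)" and ?T = "set L2"
  let ?P = "\<lambda>L p. lprod (map (\<lambda>x. h (p x)) L)"
  have ST: "set (L1 @ L2 @ L3) = ?S \<union> ?T" by auto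
  have "alt col h (L1 @ L2 @ L3) = (\<Sum>z\<in>colgrp col ?S \<times> colgrp col ?T.
      smat (of_int (sign (case z of (p, q) \<Rightarrow> p \<circ> q))) (?P (L1 @ L2 @ L3) (case z of (p, q) \<Rightarrow> p \<circ> q)))"
    unfolding alt_def ST
    by (rule sum.reindex_bij_betw[OF colgrp_Un, symmetric]) (use disj in auto)
  also have "\<dots> = (\<Sum>p\<in>colgrp col ?S. \<Sum>q\<in>colgrp col ?T.
      smat (of_int (sign (p \<circ> q))) (?P (L1 @ L2 @ L3) (p \<circ> q)))"
    unfolding sum.cartesian_product by (intro sum.cong refl) auto
  also have "\<dots> = (\<Sum>p\<in>colgrp col ?S. \<Sum>q\<in>colgrp col ?T.
      smat (of_int (sign p)) (?P L1 p ** smat (of_int (sign q)) (?P L2 q) ** ?P L3 p))"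
  proof (intro sum.cong refl)
    fix p q assume "p \<in> colgrp col ?S" "q \<in> colgrp col ?T"
    then have pq: "p permutes ?S" "q permutes ?T" by (auto simp: colgrp_def)
    have sgn: "sign (p \<circ> q) = sign p * sign q"
      by (rule sign_compose; unfold permutation_permutes) (use pq finite_set in blast)+
    have 1: "(p \<circ> q) x = p x" if "x \<in> ?S" for x
    proof -
      have "x \<notin> ?T" using that disj[of x x] by blast
      then show ?thesis using permutes_not_in[OF pq(2)] by simp
    qed
    have 2: "(p \<circ> q) x = q x" if "x \<in> ?T" for x
    proof -
      have "q x \<in> ?T" using that permutes_in_image[OF pq(2)] by simp
      then have "q x \<notin> ?S" using disj[of "q x" "q x"] by auto
      then show ?thesis using permutes_not_in[OF pq(1)] by simp
    qed
    have "map (\<lambda>x. h ((p \<circ> q) x)) L1 = map (\<lambda>x. h (p x)) L1" "map (\<lambda>x. h ((p \<circ> q) x)) L3 = map (\<lambda>x. h (p x)) L3"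
      "map (\<lambda>x. h ((p \<circ> q) x)) L2 = map (\<lambda>x. h (q x)) L2"
      using 1 2 by (auto intro!: map_cong)
    then show "smat (of_int (sign (p \<circ> q))) (?P (L1 @ L2 @ L3) (p \<circ> q)) =
        smat (of_int (sign p)) (?P L1 p ** smat (of_int (sign q)) (?P L2 q) ** ?P L3 p)"
      by (simp only: map_append lprod_append sgn smat_mult_left smat_mult_right smat_smat of_int_mult matrix_mul_assoc)
  qed
  also have "\<dots> = (\<Sum>p\<in>colgrp col ?S. smat (of_int (sign p)) (?P L1 p ** alt col h L2 ** ?P L3 p))"
    by (simp only: alt_def smat_sum mult_sum_mat)
  finally show ?thesis .
qed

lemma alt_append:
  assumes "\<And>x y. x \<in> set L1 \<Longrightarrow> y \<in> set L2 \<Longrightarrow> col x \<noteq> col y"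
  shows "alt col h (L1 @ L2) = alt col h L1 ** alt col h L2"
  using alt_wrap[of L1 "[]" L2 col h] assms
  by (simp add: alt_def[of col h L1] mult_sum_mat smat_mult_left matrix_mul_rid)

lemma colgrp_mono: "(\<And>x y. x \<in> S \<Longrightarrow> y \<in> S \<Longrightarrow> col x = col y) \<Longrightarrow> colgrp col S = {p. p permutes S}"
proof -
  assume c: "\<And>x y. x \<in> S \<Longrightarrow> y \<in> S \<Longrightarrow> col x = col y"
  have "col (p k) = col k" if "p permutes S" "k \<in> S" for p k
    using that by (intro c) (simp_all add: permutes_in_image)
  then show ?thesis unfolding colgrp_def by blast
qed

lemma sum_permutes1: "(\<Sum>p | p permutes {x}. F p) = F id"
  by (simp add: permutes_sing)

lemma sum_permutes2:
  assumes "x \<noteq> (y :: nat)"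
  shows "(\<Sum>p | p permutes {x, y}. F p) = F id + F (tp x y)"
  using sum_over_permutations_insert[of "{y}" x F] assms by (simp add: permutes_sing)

lemma sum_permutes3:
  assumes "x \<noteq> (y :: nat)" "x \<noteq> z" "y \<noteq> z"
  shows "(\<Sum>p | p permutes {x, y, z}. F p) =
    F id + F (tp y z) +
    (F (tp x y) + F (tp x y \<circ> tp y z)) +
    (F (tp x z) + F (tp x z \<circ> tp y z))"
  using sum_over_permutations_insert[of "{y, z}" x F] assms by (simp add: sum_permutes2 add_ac)

lemma alt_pair_wrap:
  assumes "x \<noteq> y" "col x = col y" "\<And>z. z \<in> set L \<Longrightarrow> col z \<noteq> col x"
  shows "alt col h (x # L @ [y]) = h x ** alt col h L ** h y - h y ** alt col h L ** h x"
proof -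
  have grp: "colgrp col {x, y} = {p. p permutes {x, y}}" by (rule colgrp_mono) (use assms in auto)
  have "alt col h ([x] @ L @ [y]) = (\<Sum>p\<in>colgrp col (set ([x] @ [y])). smat (of_int (sign p))
      (lprod (map (\<lambda>x. h (p x)) [x]) ** alt col h L ** lprod (map (\<lambda>x. h (p x)) [y])))"
  proof (rule alt_wrap)
    fix u v assume "u \<in> set ([x] @ [y])" "v \<in> set L"
    then show "col u \<noteq> col v" using assms(2) assms(3)[of v] by auto
  qed
  also have "\<dots> = (\<Sum>p | p permutes {x, y}. smat (of_int (sign p)) (h (p x) ** alt col h L ** h (p y)))"
    by (simp add: grp matrix_mul_rid)
  also have "\<dots> = h x ** alt col h L ** h y - h y ** alt col h L ** h x"
    using assms(1) by (simp add: sum_permutes2 sign_swap_id) (simp add: vec_eq_iff)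
  finally show ?thesis by simp
qed

text \<open>The six permutations are paired by the letter they put last. For empty L the result is
  the standard polynomial of degree three.\<close>

lemma alt_triple_wrap:
  assumes "x \<noteq> y" "x \<noteq> z" "y \<noteq> z" "col x = col y" "col x = col z" "\<And>t. t \<in> set L \<Longrightarrow> col t \<noteq> col x"
  shows "alt col h (x # y # L @ [z]) =
    (h x ** h y - h y ** h x) ** alt col h L ** h z + (h y ** h z - h z ** h y) ** alt col h L ** h x +
    (h z ** h x - h x ** h z) ** alt col h L ** h y"
proof -
  have sg: "sign (tp a b \<circ> tp c d) =
      sign (tp a b) * sign (tp c (d :: nat))" for a b c d
    by (simp add: sign_compose permutation_swap_id)
  have grp: "colgrp col {x, y, z} = {p. p permutes {x, y, z}}" by (rule colgrp_mono) (use assms in auto)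
  have "alt col h ([x, y] @ L @ [z]) = (\<Sum>p\<in>colgrp col (set ([x, y] @ [z])). smat (of_int (sign p))
      (lprod (map (\<lambda>x. h (p x)) [x, y]) ** alt col h L ** lprod (map (\<lambda>x. h (p x)) [z])))"
  proof (rule alt_wrap)
    fix u v assume "u \<in> set ([x, y] @ [z])" "v \<in> set L"
    then show "col u \<noteq> col v" using assms(4,5) assms(6)[of v] by auto
  qed
  also have "\<dots> = (\<Sum>p | p permutes {x, y, z}.
      smat (of_int (sign p)) (h (p x) ** h (p y) ** alt col h L ** h (p z)))"
    by (simp add: grp matrix_mul_rid matrix_mul_assoc)
  also have "\<dots> = (h x ** h y - h y ** h x) ** alt col h L ** h z + (h y ** h z - h z ** h y) ** alt col h L ** h x +
    (h z ** h x - h x ** h z) ** alt col h L ** h y"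
    using assms(1-3) by (simp add: sum_permutes3 sg sign_swap_id mult_diff_mat) (simp add: vec_eq_iff algebra_simps)
  finally show ?thesis by simp
qed

lemma alt_single: "alt col h [x] = h x"
proof -
  have "colgrp col {x} = {p. p permutes {x}}" by (rule colgrp_mono) simp
  then show ?thesis by (simp add: alt_def sum_permutes1 matrix_mul_rid)
qed

lemma alt_Nil: "alt col h [] = mat 1"
  by (simp add: alt_def colgrp_def)

text \<open>In characteristic 0, by \<open>wev_rowsum\<close>, these are up to a nonzero factor the
  values of the polynomials in e A at the highest weight word; the dimension of this space is the
  multiplicity of the shape.\<close>

definition hwvals :: "nat \<Rightarrow> nat \<times> nat \<times> nat \<Rightarrow> ('k::field mat3) set" where
  "hwvals n \<nu> = (\<lambda>\<psi>. wev n (csym n (tab_col \<nu>) \<psi>) (tab_row \<nu>)) ` Pn n"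

lemma wev_delta:
  assumes "\<sigma> \<in> Sn n" shows "wev n (delta \<sigma>) w = lprod (map (\<lambda>i. hat (w (\<sigma> i))) [0..<n])"
proof -
  have "wev n (delta \<sigma>) w = (\<Sum>\<tau>\<in>Sn n. if \<tau> = \<sigma> then monom_eval n \<sigma> (\<lambda>k. hat (w k)) else 0)"
    unfolding wev_def eval_multilin_eq by (intro sum.cong refl) (simp add: delta_def)
  then show ?thesis using assms by (simp add: monom_eval_lprod)
qed

abbreviation hwvals3 :: "nat \<Rightarrow> nat \<Rightarrow> nat \<Rightarrow> ('k::field mat3) set" where
  "hwvals3 a b c \<equiv> hwvals (a + b + c) (a, b, c)"

abbreviation tabalt :: "nat \<times> nat \<times> nat \<Rightarrow> nat list \<Rightarrow> 'k::field mat3" where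
  "tabalt \<nu> \<equiv> alt (tab_col \<nu>) (\<lambda>k. hat (tab_row \<nu> k))"

text \<open>Read as a permutation, L is a monomial; the column sum applied to this monomial has the
  given value.\<close>

lemma alt_in_hwvals:
  assumes L: "distinct L" "set L = {..<n}"
  shows "(tabalt \<nu> L :: 'k::field mat3) \<in> hwvals n \<nu>"
proof -
  have len: "length L = n" using L distinct_card[of L] by simp
  define \<sigma> where "\<sigma> = (\<lambda>i. if i < n then L ! i else i)"
  have "bij_betw (\<lambda>i. L ! i) {..<length L} (set L)" by (rule bij_betw_nth[OF L(1)]) auto
  then have "bij_betw \<sigma> {..<n} {..<n}" using L(2) len by (simp add: \<sigma>_def bij_betw_def inj_on_def)
  then have "\<sigma> permutes {..<n}" by (rule bij_imp_permutes) (simp add: \<sigma>_def)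
  then have s: "\<sigma> \<in> Sn n" by (simp add: Sn_def)
  have mp: "map (\<lambda>i. f (\<sigma> i)) [0..<n] = map f L" for f :: "nat \<Rightarrow> 'k mat3"
    by (rule nth_equalityI) (simp_all add: len \<sigma>_def)
  have eq: "wev n (csym n (tab_col \<nu>) (delta \<sigma>)) (tab_row \<nu>) =
      (\<Sum>p\<in>stab n (tab_col \<nu>). smat (of_int (sign p)) (lprod (map (\<lambda>i. hat (tab_row \<nu> (p (\<sigma> i))) :: 'k mat3) [0..<n])))"
    unfolding conv_colsum wev_sum wev_scale
    by (intro sum.cong refl) (simp add: wev_act[OF stab_Sn] wev_delta[OF s])
  have "wev n (csym n (tab_col \<nu>) (delta \<sigma>)) (tab_row \<nu>) =
      (tabalt \<nu> L :: 'k mat3)"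
    unfolding alt_def L(2) colgrp_stab eq
  proof (intro sum.cong refl)
    fix p
    show "smat (of_int (sign p)) (lprod (map (\<lambda>i. hat (tab_row \<nu> (p (\<sigma> i))) :: 'k mat3) [0..<n])) =
        smat (of_int (sign p)) (lprod (map (\<lambda>x. hat (tab_row \<nu> (p x))) L))"
      using mp[of "\<lambda>i. hat (tab_row \<nu> (p i))"] by simp
  qed
  then show ?thesis unfolding hwvals_def using imageI[OF delta_Pn[OF s]] by metis
qed

lemma hwvals_smat: "X \<in> hwvals n \<nu> \<Longrightarrow> smat t X \<in> hwvals n \<nu>"
proof -
  assume "X \<in> hwvals n \<nu>"
  then obtain \<psi> where \<psi>: "\<psi> \<in> Pn n" "X = wev n (csym n (tab_col \<nu>) \<psi>) (tab_row \<nu>)"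
    unfolding hwvals_def by blast
  have "smat t X = wev n (csym n (tab_col \<nu>) (fscale t \<psi>)) (tab_row \<nu>)"
    unfolding \<psi>(2) conv_scale wev_scale ..
  moreover have "fscale t \<psi> \<in> Pn n" by (rule FS.subspace_scale[OF subspace_Pn \<psi>(1)])
  ultimately show ?thesis unfolding hwvals_def by blast
qed

lemma hwvals_smatD: "smat t X \<in> hwvals n \<nu> \<Longrightarrow> t \<noteq> 0 \<Longrightarrow> X \<in> hwvals n \<nu>"
  using hwvals_smat[of "smat t X" n \<nu> "1 / t"] by simp

lemma hwvalsI: "Y \<in> hwvals n \<nu> \<Longrightarrow> Y = smat t X \<Longrightarrow> t \<noteq> 0 \<Longrightarrow> X \<in> hwvals n \<nu>"
  by (auto dest: hwvals_smatD)

definition collist :: "nat \<times> nat \<times> nat \<Rightarrow> nat \<Rightarrow> nat list" where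
  "collist \<nu> j = (case \<nu> of (a, b, c) \<Rightarrow> if j < c then [j, a + j, a + b + j] else if j < b then [j, a + j] else [j])"

lemma collist:
  assumes "b \<le> a" "c \<le> b" "j < a"
  shows "distinct (collist (a, b, c) j)" "set (collist (a, b, c) j) = {k. k < a + b + c \<and> tab_col (a, b, c) k = j}"
proof -
  show "distinct (collist (a, b, c) j)" using assms by (auto simp: collist_def)
  show "set (collist (a, b, c) j) = {k. k < a + b + c \<and> tab_col (a, b, c) k = j}"
  proof (rule set_eqI)
    fix k
    consider "k < a" | "a \<le> k" "k < a + b" | "a + b \<le> k" by linarith
    then show "k \<in> set (collist (a, b, c) j) \<longleftrightarrow> k \<in> {k. k < a + b + c \<and> tab_col (a, b, c) k = j}"
      using assms by cases (auto simp: collist_def tab_col_def)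
  qed
qed

lemma collist_concat:
  assumes "b \<le> a" "c \<le> b" "distinct js" "set js \<subseteq> {..<a}"
  shows "distinct (concat (map (collist (a, b, c)) js))"
    "set (concat (map (collist (a, b, c)) js)) = {k. k < a + b + c \<and> tab_col (a, b, c) k \<in> set js}"
  using assms(3,4) by (induction js) (auto simp: collist[OF assms(1,2)])

lemma tab_col_less: "b \<le> a \<Longrightarrow> c \<le> b \<Longrightarrow> k < a + b + c \<Longrightarrow> tab_col (a, b, c) k < a"
  by (auto simp: tab_col_def)

text \<open>The value of one alternating column: the standard polynomial in \<open>hat 0\<close>,
  \<open>hat 1\<close>, \<open>hat 2\<close> for length three, the commutator of
  \<open>hat 0\<close> and \<open>hat 1\<close> for length two, and \<open>hat 0\<close> for length
  one.\<close>

definition colval :: "nat \<times> nat \<times> nat \<Rightarrow> nat \<Rightarrow> 'k::field mat3" where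
  "colval \<nu> j = (case \<nu> of (a, b, c) \<Rightarrow> if j < c then smat (-2) (mat 1) else if j < b then hat 2 else hat 0)"

text \<open>The commutators are \<open>hat 2\<close>, \<open>hat 0\<close> and \<open>hat 1\<close>,
  so the sum is the sum of the squares of the \<open>hat i\<close>: the Casimir element, which acts
  on the vector representation as -2.\<close>

lemma standard3_hat:
  "(hat 0 ** hat 1 - hat 1 ** hat 0) ** hat 2 + (hat 1 ** hat 2 - hat 2 ** hat 1) ** hat 0 +
    (hat 2 ** hat 0 - hat 0 ** hat 2) ** hat 1 = smat (-2) (mat 1 :: 'k::field mat3)"
  by (simp add: mat3_simps mat_def)

lemma tab_row_collist:
  assumes "b \<le> a" "c \<le> b"
  shows "j < a \<Longrightarrow> tab_row (a, b, c) j = 0" "j < b \<Longrightarrow> tab_row (a, b, c) (a + j) = 1"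
    "tab_row (a, b, c) (a + b + j) = 2"
  by (auto simp: tab_row_def)

lemma alt_collist:
  assumes "b \<le> a" "c \<le> b" "j < a"
  shows "tabalt (a, b, c) (collist (a, b, c) j) =
    (colval (a, b, c) j :: 'k::field mat3)"
proof -
  let ?col = "tab_col (a, b, c)" and ?h = "\<lambda>k. hat (tab_row (a, b, c) k) :: 'k mat3"
  have col: "?col x = j" if "x \<in> set (collist (a, b, c) j)" for x
    using that collist(2)[OF assms] by simp
  consider "j < c" | "c \<le> j" "j < b" | "b \<le> j" by linarith
  then show ?thesis
  proof cases
    case 1
    then have L: "collist (a, b, c) j = j # (a + j) # [] @ [a + b + j]" by (simp add: collist_def)
    have "?col j = j" "?col (a + j) = j" "?col (a + b + j) = j" using col unfolding L by auto
    then show ?thesis unfolding L using 1 assms standard3_hat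
      by (subst alt_triple_wrap) (auto simp: alt_Nil tab_row_collist[OF assms(1,2)] colval_def matrix_mul_rid)
  next
    case 2
    then have L: "collist (a, b, c) j = j # [] @ [a + j]" by (simp add: collist_def)
    have "?col j = j" "?col (a + j) = j" using col unfolding L by auto
    moreover have "hat 0 ** hat 1 - hat 1 ** hat 0 = (hat 2 :: 'k mat3)" by (simp add: mat3_simps)
    ultimately show ?thesis unfolding L using 2 assms
      by (subst alt_pair_wrap) (auto simp: alt_Nil tab_row_collist[OF assms(1,2)] colval_def matrix_mul_rid)
  next
    case 3
    then have "collist (a, b, c) j = [j]" using assms by (simp add: collist_def)
    then show ?thesis using 3 assms by (simp add: alt_single tab_row_collist[OF assms(1,2)] colval_def)
  qed
qed

lemma alt_concat:
  assumes "b \<le> a" "c \<le> b" "distinct js" "set js \<subseteq> {..<a}"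
  shows "tabalt (a, b, c) (concat (map (collist (a, b, c)) js)) =
    (lprod (map (colval (a, b, c)) js) :: 'k::field mat3)"
  using assms(3,4)
proof (induction js)
  case Nil show ?case by (simp add: alt_Nil)
next
  case (Cons j js)
  have "tabalt (a, b, c)
      (collist (a, b, c) j @ concat (map (collist (a, b, c)) js)) =
    (tabalt (a, b, c) (collist (a, b, c) j) **
     tabalt (a, b, c) (concat (map (collist (a, b, c)) js)) :: 'k mat3)"
  proof (rule alt_append)
    fix x y assume "x \<in> set (collist (a, b, c) j)" "y \<in> set (concat (map (collist (a, b, c)) js))"
    then have "tab_col (a, b, c) x = j" "tab_col (a, b, c) y \<in> set js"
      using collist(2)[OF assms(1,2), of j] collist_concat(2)[OF assms(1,2), of js] Cons.prems by auto
    then show "tab_col (a, b, c) x \<noteq> tab_col (a, b, c) y" using Cons.prems by auto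
  qed
  then show ?case using Cons alt_collist[OF assms(1,2), of j, where 'k = 'k] by simp
qed

abbreviation "hpow i q \<equiv> lprod (replicate q (hat i))"

lemma colval_lprod:
  assumes "c \<le> b"
  shows "(lprod (map (colval (a, b, c)) [0..<c]) :: 'k::field mat3) = smat ((-2) ^ c) (mat 1)"
    "c \<le> i \<Longrightarrow> j \<le> b \<Longrightarrow> (lprod (map (colval (a, b, c)) [i..<j]) :: 'k mat3) = hpow 2 (j - i)"
    "b \<le> i \<Longrightarrow> (lprod (map (colval (a, b, c)) [i..<j]) :: 'k mat3) = hpow 0 (j - i)"
proof -
  have "(lprod (map (colval (a, b, c)) [0..<m]) :: 'k mat3) = smat ((-2) ^ m) (mat 1)" if "m \<le> c" for m
    using that
    by (induction m) (simp_all add: lprod_append colval_def smat_mult_left smat_mult_right matrix_mul_lid matrix_mul_rid mult.commute)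
  then show "(lprod (map (colval (a, b, c)) [0..<c]) :: 'k mat3) = smat ((-2) ^ c) (mat 1)" by simp
  have "map (colval (a, b, c)) [i..<j] = replicate (j - i) (hat 2 :: 'k mat3)" if "c \<le> i" "j \<le> b"
    by (rule nth_equalityI) (use that in \<open>auto simp: colval_def\<close>)
  then show "c \<le> i \<Longrightarrow> j \<le> b \<Longrightarrow> (lprod (map (colval (a, b, c)) [i..<j]) :: 'k mat3) = hpow 2 (j - i)"
    by simp
  have "map (colval (a, b, c)) [i..<j] = replicate (j - i) (hat 0 :: 'k mat3)" if "b \<le> i"
    by (rule nth_equalityI) (use that assms in \<open>auto simp: colval_def\<close>)
  then show "b \<le> i \<Longrightarrow> (lprod (map (colval (a, b, c)) [i..<j]) :: 'k mat3) = hpow 0 (j - i)"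
    by simp
qed

text \<open>Columns of length three have scalar values, so they are put in front and divided out;
  the remaining columns may be multiplied in any order.\<close>

lemma ordered_columns_in_hwvals:
  assumes nu: "b \<le> a" "c \<le> b" and js: "distinct js" "set js = {c..<a}"
  shows "(lprod (map (colval (a, b, c)) js) :: 'k::field_char_0 mat3) \<in> hwvals3 a b c"
proof -
  let ?js = "[0..<c] @ js"
  have d: "distinct ?js" "set ?js = {..<a}" using js nu by auto
  have sub: "set ?js \<subseteq> {..<a}" using d(2) by simp
  have "tabalt (a, b, c) (concat (map (collist (a, b, c)) ?js))
      \<in> (hwvals3 a b c :: ('k mat3) set)"
  proof (rule alt_in_hwvals)
    show "distinct (concat (map (collist (a, b, c)) ?js))" by (rule collist_concat(1)[OF nu d(1) sub])
    show "set (concat (map (collist (a, b, c)) ?js)) = {..<a + b + c}"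
      unfolding collist_concat(2)[OF nu d(1) sub] d(2) using tab_col_less[OF nu] by auto
  qed
  also have "tabalt (a, b, c) (concat (map (collist (a, b, c)) ?js)) =
      smat ((-2) ^ c) (lprod (map (colval (a, b, c)) js) :: 'k mat3)"
    unfolding alt_concat[OF nu d(1) sub] unfolding map_append lprod_append colval_lprod(1)[OF nu(2)]
    by (simp add: smat_mult_left matrix_mul_lid)
  finally show ?thesis by (rule hwvals_smatD) simp
qed

lemma rearranged_columns_in_hwvals:
  assumes nu: "b \<le> a" "c \<le> b" and L: "mset L = mset (concat (map (collist (a, b, c)) [0..<a]))"
  shows "(tabalt (a, b, c) L :: 'k::field mat3) \<in> hwvals3 a b c"
proof (rule alt_in_hwvals)
  have "set [0..<a] \<subseteq> {..<a}" by auto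
  note cc = collist_concat[OF nu distinct_upt this]
  show "distinct L" using cc(1) mset_eq_imp_distinct_iff[OF L] by blast
  show "set L = {..<a + b + c}" using cc(2) mset_eq_setD[OF L] tab_col_less[OF nu] by auto
qed

section \<open>Symmetry constraints on highest weight values\<close>

lemma klein_conj_lprod:
  fixes D :: "'k::field mat3"
  assumes D: "D ** D = mat 1" and h: "\<And>i. i < n \<Longrightarrow> D ** hat (u i) ** D = smat (\<delta> (u i)) (hat (u i))"
  shows "D ** lprod (map (\<lambda>i. hat (u i)) [0..<n]) ** D =
    smat (\<Prod>i<n. \<delta> (u i)) (lprod (map (\<lambda>i. hat (u i)) [0..<n]))"
  using h
proof (induction n)
  case 0 then show ?case using D by (simp add: matrix_mul_rid)
next
  case (Suc n)
  let ?P = "lprod (map (\<lambda>i. hat (u i)) [0..<n]) :: 'k mat3"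
  have "D ** (?P ** hat (u n)) ** D = (D ** ?P ** D) ** (D ** hat (u n) ** D)"
  proof -
    have "(D ** ?P ** D) ** (D ** hat (u n) ** D) = D ** ?P ** (D ** D) ** hat (u n) ** D"
      by (simp only: matrix_mul_assoc)
    then show ?thesis unfolding D by (simp only: matrix_mul_rid matrix_mul_assoc)
  qed
  then show ?case using Suc
    by (simp add: lprod_append matrix_mul_rid smat_mult_left smat_mult_right mult.commute)
qed

abbreviation "mat9 x1 x2 x3 y1 y2 y3 z1 z2 z3 \<equiv>
  vector [vector [x1, x2, x3], vector [y1, y2, y3], vector [z1, z2, z3]] :: 'k::field mat3"

text \<open>As the third sign is the product of the other two, D is the identity or a half turn
  about a coordinate axis. Conjugation by a rotation takes the cross product matrix of a vector to
  that of the rotated vector, so each \<open>hat l\<close> is scaled by its own sign.\<close>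

lemma klein_conj_wev:
  fixes \<delta> :: "nat \<Rightarrow> 'k::field"
  assumes d: "\<delta> 0 * \<delta> 0 = 1" "\<delta> 1 * \<delta> 1 = 1" "\<delta> 2 = \<delta> 0 * \<delta> 1" and w: "\<And>k. k < n \<Longrightarrow> w k < 3"
  defines "D \<equiv> mat9 (\<delta> 0) 0 0 0 (\<delta> 1) 0 0 0 (\<delta> 2)"
  shows "D ** wev n c w ** D = smat (\<Prod>k<n. \<delta> (w k)) (wev n c w)"
proof -
  have "\<delta> 2 * \<delta> 2 = (\<delta> 0 * \<delta> 0) * (\<delta> 1 * \<delta> 1)" unfolding d(3) by (simp only: mult_ac)
  then have DD: "D ** D = mat 1" using d(1,2) by (simp add: D_def mat3_simps mat_def)
  have h: "D ** hat l ** D = smat (\<delta> l) (hat l)" if "l < 3" for l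
  proof -
    have "\<delta> 1 * \<delta> 2 = \<delta> 0 * (\<delta> 1 * \<delta> 1)" "\<delta> 0 * \<delta> 2 = \<delta> 1 * (\<delta> 0 * \<delta> 0)"
      unfolding d(3) by (simp_all only: mult_ac)
    then have "\<delta> 1 * \<delta> 2 = \<delta> 0" "\<delta> 0 * \<delta> 2 = \<delta> 1" using d by simp_all
    moreover have "l = 0 \<or> l = 1 \<or> l = 2" using that by linarith
    ultimately show ?thesis using d(3) by (auto simp: D_def mat3_simps mult.commute)
  qed
  have "D ** monom_eval n \<sigma> (\<lambda>k. hat (w k)) ** D = smat (\<Prod>k<n. \<delta> (w k)) (monom_eval n \<sigma> (\<lambda>k. hat (w k)))"
    if s: "\<sigma> \<in> Sn n" for \<sigma>
  proof -
    have "D ** monom_eval n \<sigma> (\<lambda>k. hat (w k)) ** D =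
        smat (\<Prod>i<n. \<delta> (w (\<sigma> i))) (monom_eval n \<sigma> (\<lambda>k. hat (w k)))"
      unfolding monom_eval_lprod by (rule klein_conj_lprod[OF DD h]) (use w s in \<open>simp add: Sn_less\<close>)
    also have "(\<Prod>i<n. \<delta> (w (\<sigma> i))) = (\<Prod>k<n. \<delta> (w k))"
      using prod.permute[of \<sigma> "{..<n}" "\<lambda>k. \<delta> (w k)"] s by (simp add: Sn_def o_def)
    finally show ?thesis .
  qed
  then show ?thesis unfolding wev_def eval_multilin_eq mult_sum_mat smat_sum
    by (intro sum.cong refl) (simp add: smat_mult_left smat_mult_right mult.commute)
qed

lemma prod_tab_row: "(\<Prod>k<a + b + c. \<delta> (tab_row (a, b, c) k)) = \<delta> 0 ^ a * \<delta> 1 ^ b * (\<delta> 2 ^ c :: 'k::field)"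
proof -
  have 1: "(\<Prod>k<a + b + c. F k) = (\<Prod>k<a + b. F k) * (\<Prod>k=a + b..<a + b + c. F k)"
    and 2: "(\<Prod>k<a + b. F k) = (\<Prod>k<a. F k) * (\<Prod>k=a..<a + b. F k)" for F :: "nat \<Rightarrow> 'k"
    using prod.atLeastLessThan_concat[of 0 "a + b" "a + b + c" F] prod.atLeastLessThan_concat[of 0 a "a + b" F]
    by (simp_all add: lessThan_atLeast0)
  have "(\<Prod>k<a + b + c. \<delta> (tab_row (a, b, c) k)) = (\<Prod>k<a. \<delta> (tab_row (a, b, c) k)) *
      (\<Prod>k=a..<a + b. \<delta> (tab_row (a, b, c) k)) * (\<Prod>k=a + b..<a + b + c. \<delta> (tab_row (a, b, c) k))"
    unfolding 1 2 ..
  also have "(\<Prod>k<a. \<delta> (tab_row (a, b, c) k)) = \<delta> 0 ^ a" by (simp add: tab_row_def)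
  also have "(\<Prod>k=a..<a + b. \<delta> (tab_row (a, b, c) k)) = \<delta> 1 ^ b" by (simp add: tab_row_def)
  also have "(\<Prod>k=a + b..<a + b + c. \<delta> (tab_row (a, b, c) k)) = \<delta> 2 ^ c" by (simp add: tab_row_def)
  finally show ?thesis .
qed

text \<open>Conjugation by a diagonal sign matrix multiplies an entry of X by the signs of its row
  and its column, and all of X by the product of the signs of the letters. The half turns about the
  first and the third axis bring in the parities of b + c and a + b.\<close>

lemma hwvals_parity:
  fixes X :: "'k::field_char_0 mat3"
  assumes X: "X \<in> hwvals3 a b c"
  shows "even (b + c) \<Longrightarrow> X $ 1 $ 2 = 0 \<and> X $ 1 $ 3 = 0 \<and> X $ 2 $ 1 = 0 \<and> X $ 3 $ 1 = 0"
    "odd (b + c) \<Longrightarrow> X $ 1 $ 1 = 0 \<and> X $ 2 $ 2 = 0 \<and> X $ 3 $ 3 = 0 \<and> X $ 2 $ 3 = 0 \<and> X $ 3 $ 2 = 0"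
    "even (a + b) \<Longrightarrow> X $ 1 $ 3 = 0 \<and> X $ 2 $ 3 = 0 \<and> X $ 3 $ 1 = 0 \<and> X $ 3 $ 2 = 0"
    "odd (a + b) \<Longrightarrow> X $ 1 $ 1 = 0 \<and> X $ 2 $ 2 = 0 \<and> X $ 3 $ 3 = 0 \<and> X $ 1 $ 2 = 0 \<and> X $ 2 $ 1 = 0"
proof -
  obtain f where f: "X = wev (a + b + c) f (tab_row (a, b, c))" using X by (auto simp: hwvals_def)
  have 1: "mat9 1 0 0 0 (-1) 0 0 0 (-1) ** X ** mat9 1 0 0 0 (-1) 0 0 0 (-1) = smat ((-1) ^ (b + c)) X"
    using klein_conj_wev[of "\<lambda>k. if k = 0 then 1 else - 1 :: 'k" "a + b + c" "tab_row (a, b, c)" f]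
    by (simp add: tab_row_less3 f prod_tab_row[of "\<lambda>k. if k = 0 then 1 else - 1 :: 'k"] power_add)
  have 2: "mat9 (-1) 0 0 0 (-1) 0 0 0 1 ** X ** mat9 (-1) 0 0 0 (-1) 0 0 0 1 = smat ((-1) ^ (a + b)) X"
    using klein_conj_wev[of "\<lambda>k. if k = 2 then 1 else - 1 :: 'k" "a + b + c" "tab_row (a, b, c)" f]
    by (simp add: tab_row_less3 f prod_tab_row[of "\<lambda>k. if k = 2 then 1 else - 1 :: 'k"] power_add)
  have neg: "x = - x \<longleftrightarrow> x = 0" "- x = x \<longleftrightarrow> x = 0" for x :: 'k by auto
  note e1 = 1[THEN arg_cong[of _ _ "\<lambda>M. M $ i $ j" for i j]] and e2 = 2[THEN arg_cong[of _ _ "\<lambda>M. M $ i $ j" for i j]]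
  show "even (b + c) \<Longrightarrow> X $ 1 $ 2 = 0 \<and> X $ 1 $ 3 = 0 \<and> X $ 2 $ 1 = 0 \<and> X $ 3 $ 1 = 0"
    using e1[of 1 2] e1[of 1 3] e1[of 2 1] e1[of 3 1] by (simp add: matrix_matrix_mult_def sum_3 neg)
  show "odd (b + c) \<Longrightarrow> X $ 1 $ 1 = 0 \<and> X $ 2 $ 2 = 0 \<and> X $ 3 $ 3 = 0 \<and> X $ 2 $ 3 = 0 \<and> X $ 3 $ 2 = 0"
    using e1[of 1 1] e1[of 2 2] e1[of 3 3] e1[of 2 3] e1[of 3 2] by (simp add: matrix_matrix_mult_def sum_3 neg)
  show "even (a + b) \<Longrightarrow> X $ 1 $ 3 = 0 \<and> X $ 2 $ 3 = 0 \<and> X $ 3 $ 1 = 0 \<and> X $ 3 $ 2 = 0"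
    using e2[of 1 3] e2[of 2 3] e2[of 3 1] e2[of 3 2] by (simp add: matrix_matrix_mult_def sum_3 neg)
  show "odd (a + b) \<Longrightarrow> X $ 1 $ 1 = 0 \<and> X $ 2 $ 2 = 0 \<and> X $ 3 $ 3 = 0 \<and> X $ 1 $ 2 = 0 \<and> X $ 2 $ 1 = 0"
    using e2[of 1 1] e2[of 2 2] e2[of 3 3] e2[of 1 2] e2[of 2 1] by (simp add: matrix_matrix_mult_def sum_3 neg)
qed

lemma wev_colsum_eq_0:
  fixes f :: "'k::field_char_0 grpalg"
  assumes k: "k < n" "k' < n" "k \<noteq> k'" "col k = col k'" "w k = w k'"
  shows "wev n (csym n col f) w = 0"
proof -
  let ?t = "tp k k'" and ?c = "csym n col f"
  have t: "?t \<in> stab n col" using k by (intro stab_transpose) auto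
  have "wev n (act ?t ?c) w = wev n ?c w"
    unfolding wev_act[OF stab_Sn[OF t]] by (rule wev_cong) (use k in \<open>auto simp: Transposition.transpose_def\<close>)
  moreover have "wev n (act ?t ?c) w = smat (-1) (wev n ?c w)"
    using act_conv_colsum[OF t, of f] k by (simp add: sign_swap_id wev_scale[symmetric])
  ultimately show ?thesis by (simp add: vec_eq_iff)
qed

text \<open>If a = b, each column that meets one of the first two rows meets both. Commuting with
  \<open>hat 2\<close> turns a letter of one of these rows into the letter of the other, so a column
  has a repeated letter and alternation kills the term. For b = c the same happens to the last two
  rows under \<open>hat 0\<close>.\<close>

lemma hwvals_commute:
  fixes X :: "'k::field_char_0 mat3"
  assumes nu: "b \<le> a" "c \<le> b" and X: "X \<in> hwvals3 a b c"
  shows "a = b \<Longrightarrow> hat 2 ** X = X ** hat 2" "b = c \<Longrightarrow> hat 0 ** X = X ** hat 0"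
proof -
  let ?n = "a + b + c" and ?r = "tab_row (a, b, c)" and ?col = "tab_col (a, b, c)"
  obtain \<psi> where f: "X = wev ?n (conv ?n (colsum ?n ?col) \<psi>) ?r" using X by (auto simp: hwvals_def)
  let ?c = "conv ?n (colsum ?n ?col) \<psi>"
  have comm: "hat 2 ** hat 0 - hat 0 ** hat 2 = smat 1 (hat 1 :: 'k mat3)"
    "hat 2 ** hat 1 - hat 1 ** hat 2 = smat (-1) (hat 0 :: 'k mat3)"
    "hat 0 ** hat 1 - hat 1 ** hat 0 = smat 1 (hat 2 :: 'k mat3)"
    "hat 0 ** hat 2 - hat 2 ** hat 0 = smat (-1) (hat 1 :: 'k mat3)"
    by (simp_all add: mat3_simps)
  \<comment> \<open>The cell k' lies in the column of k and already carries the letter j that the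
    commutator produces at k.\<close>
  let ?partner = "\<lambda>k k' j. k' < ?n \<and> k \<noteq> k' \<and> ?col k = ?col k' \<and> ?r k' = j"
  have commute: "hat m ** X = X ** hat m"
    if h: "\<And>k. k < ?n \<Longrightarrow> ?r k \<noteq> m \<Longrightarrow> \<exists>k' e j. ?partner k k' j \<and>
      hat m ** hat (?r k) - hat (?r k) ** hat m = smat e (hat j :: 'k mat3)" for m
  proof -
    have "hat m ** X - X ** hat m = 0" unfolding f wev_derivation
    proof (rule sum.neutral, rule ballI)
      fix k assume "k \<in> {..<?n}"
      then have k: "k < ?n" by simp
      show "eval_multilin ?n ?c ((\<lambda>k. hat (?r k))(k := hat m ** hat (?r k) - hat (?r k) ** hat m)) = 0"
      proof (cases "?r k = m")
        case True
        then show ?thesis by (simp add: eval_slot_zero[OF k])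
      next
        case False
        then obtain k' e j where j: "?partner k k' j"
          "hat m ** hat (?r k) - hat (?r k) ** hat m = smat e (hat j :: 'k mat3)" using h[OF k] by blast
        then have "wev ?n ?c (?r(k := j)) = 0" by (intro wev_colsum_eq_0[OF k, of k']) auto
        then show ?thesis unfolding j(2) by (simp only: eval_slot_scale[OF k] hat_upd wev_def smat_0_right)
      qed
    qed
    then show ?thesis by simp
  qed
  show "hat 2 ** X = X ** hat 2" if ab: "a = b"
  proof (rule commute)
    fix k assume k: "k < ?n" "?r k \<noteq> 2"
    show "\<exists>k' e j. ?partner k k' j \<and> hat 2 ** hat (?r k) - hat (?r k) ** hat 2 = smat e (hat j :: 'k mat3)"
    proof (cases "k < a")
      case True
      then have "?r k = 0" "?partner k (a + k) 1" using ab by (auto simp: tab_row_def tab_col_def)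
      then show ?thesis using comm(1) by metis
    next
      case False
      then have "?r k = 1" "?partner k (k - a) 0" using k ab by (auto simp: tab_row_def tab_col_def split: if_splits)
      then show ?thesis using comm(2) by metis
    qed
  qed
  show "hat 0 ** X = X ** hat 0" if bc: "b = c"
  proof (rule commute)
    fix k assume k: "k < ?n" "?r k \<noteq> 0"
    show "\<exists>k' e j. ?partner k k' j \<and> hat 0 ** hat (?r k) - hat (?r k) ** hat 0 = smat e (hat j :: 'k mat3)"
    proof (cases "k < a + b")
      case True
      then have "?r k = 1" "?partner k (k + b) 2" using k bc nu by (auto simp: tab_row_def tab_col_def split: if_splits)
      then show ?thesis using comm(3) by metis
    next
      case False
      then have "?r k = 2" "?partner k (k - b) 1" using k bc nu by (auto simp: tab_row_def tab_col_def)
      then show ?thesis using comm(4) by metis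
    qed
  qed
qed

section \<open>Explicit highest weight values\<close>

lemma hwvals_one_row:
  assumes "X \<in> hwvals a (a, 0, 0)"
  shows "\<exists>t. X = smat t (hpow 0 a)"
proof -
  obtain f where f: "X = wev a f (tab_row (a, 0, 0))" using assms by (auto simp: hwvals_def)
  also have "\<dots> = wev a f (\<lambda>_. 0)" by (rule wev_cong) (simp add: tab_row_def)
  also have "\<dots> = (\<Sum>\<sigma>\<in>Sn a. smat (f \<sigma>) (hpow 0 a))"
    unfolding wev_def eval_multilin_eq monom_eval_lprod by (simp add: map_replicate_const)
  also have "\<dots> = smat (\<Sum>\<sigma>\<in>Sn a. f \<sigma>) (hpow 0 a)"
    by (rule mat3_eqI) (simp add: sum_distrib_right)
  finally show ?thesis by blast
qed

text \<open>The hypotheses give h ** h ** h = - h, so up to sign the positive powers alternate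
  between h and P. For \<open>hat 0\<close> and \<open>hat 2\<close>, P is the projection onto the
  plane of rotation.\<close>

lemma hat_power_aux:
  fixes h P :: "'k::field mat3"
  assumes "h ** h = smat (-1) P" "h ** P = h"
  shows "lprod (replicate (Suc (2 * m)) h) = smat ((-1) ^ m) h \<and> lprod (replicate (Suc (Suc (2 * m))) h) = smat ((-1) ^ Suc m) P"
proof (induction m)
  case 0 show ?case using assms by (simp add: matrix_mul_rid)
next
  case (Suc m)
  let ?H = "lprod (replicate (Suc (Suc (2 * m))) h)"
  have H: "?H = smat ((-1) ^ Suc m) P" using Suc by blast
  have "lprod (replicate (Suc (2 * Suc m)) h) = h ** ?H" by simp
  also have "\<dots> = smat ((-1) ^ Suc m) h" unfolding H by (simp only: smat_mult_right assms)
  finally have 1: "lprod (replicate (Suc (2 * Suc m)) h) = smat ((-1) ^ Suc m) h" .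
  have "lprod (replicate (Suc (Suc (2 * Suc m))) h) = h ** lprod (replicate (Suc (2 * Suc m)) h)" by simp
  also have "\<dots> = smat ((-1) ^ Suc (Suc m)) P" unfolding 1 by (simp add: smat_mult_right assms)
  finally show ?case using 1 by blast
qed

lemma hat_power:
  fixes h P :: "'k::field mat3"
  assumes "h ** h = smat (-1) P" "h ** P = h"
  shows "even q \<Longrightarrow> 0 < q \<Longrightarrow> \<exists>s. s \<noteq> 0 \<and> lprod (replicate q h) = smat s P"
    "odd q \<Longrightarrow> \<exists>s. s \<noteq> 0 \<and> lprod (replicate q h) = smat s h"
proof -
  show "\<exists>s. s \<noteq> 0 \<and> lprod (replicate q h) = smat s P" if q: "even q" "0 < q"
  proof -
    from evenE[OF q(1)] obtain k where "q = 2 * k" .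
    then obtain m where "q = Suc (Suc (2 * m))" using q(2) by (cases k) auto
    then show ?thesis using hat_power_aux[OF assms, of m] by (intro exI[of _ "(-1) ^ Suc m"]) auto
  qed
  show "\<exists>s. s \<noteq> 0 \<and> lprod (replicate q h) = smat s h" if "odd q"
  proof -
    from oddE[OF that] obtain m where "q = 2 * m + 1" .
    then have "q = Suc (2 * m)" by simp
    then show ?thesis using hat_power_aux[OF assms, of m] by (intro exI[of _ "(-1) ^ m"]) auto
  qed
qed

lemma hat0_power: "hat 0 ** hat 0 = smat (-1) (mat9 0 0 0 0 1 0 0 0 1)"
    "hat 0 ** mat9 0 0 0 0 1 0 0 0 1 = (hat 0 :: 'k::field mat3)"
  and hat2_power: "hat 2 ** hat 2 = smat (-1) (mat9 1 0 0 0 1 0 0 0 0)"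
    "hat 2 ** mat9 1 0 0 0 1 0 0 0 0 = (hat 2 :: 'k::field mat3)"
  by (simp_all add: mat3_simps)

lemmas hat0_even = hat_power(1)[OF hat0_power] and hat0_odd = hat_power(2)[OF hat0_power]
  and hat2_even = hat_power(1)[OF hat2_power] and hat2_odd = hat_power(2)[OF hat2_power]

text \<open>Columns of length two contribute factors \<open>hat 2\<close> and columns of length one
  factors \<open>hat 0\<close>. The first two products order these groups in both ways; in the last
  two, one column of a group is taken across the other group.\<close>

lemma consecutive_columns_in_hwvals:
  assumes nu: "b \<le> a" "c \<le> b"
  shows "hpow 0 (a - b) ** hpow 2 (b - c) \<in> (hwvals3 a b c :: ('k::field_char_0 mat3) set)"
    "hpow 2 (b - c) ** hpow 0 (a - b) \<in> (hwvals3 a b c :: ('k::field_char_0 mat3) set)"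
    "c < b \<Longrightarrow> hat 2 ** (hpow 0 (a - b) ** hpow 2 (b - Suc c)) \<in> (hwvals3 a b c :: ('k::field_char_0 mat3) set)"
    "b < a \<Longrightarrow> hat 0 ** (hpow 2 (b - c) ** hpow 0 (a - Suc b)) \<in> (hwvals3 a b c :: ('k::field_char_0 mat3) set)"
proof -
  let ?S = "hwvals3 a b c :: ('k mat3) set"
  note oc = ordered_columns_in_hwvals[OF nu, where 'k = 'k]
  note cl = colval_lprod(2,3)[OF nu(2), where 'k = 'k, of _ _ a]
  show "hpow 0 (a - b) ** hpow 2 (b - c) \<in> ?S"
    using oc[of "[b..<a] @ [c..<b]"] nu by (force simp: lprod_append cl)
  show "hpow 2 (b - c) ** hpow 0 (a - b) \<in> ?S"
    using oc[of "[c..<b] @ [b..<a]"] nu by (force simp: lprod_append cl)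
  show "hat 2 ** (hpow 0 (a - b) ** hpow 2 (b - Suc c)) \<in> ?S" if "c < b"
  proof -
    have "colval (a, b, c) c = (hat 2 :: 'k mat3)" using that by (simp add: colval_def)
    moreover have "set ([c] @ [b..<a] @ [Suc c..<b]) = {c..<a}" using that nu by auto
    ultimately show ?thesis using oc[of "[c] @ [b..<a] @ [Suc c..<b]"] that
      by (simp add: lprod_append cl)
  qed
  show "hat 0 ** (hpow 2 (b - c) ** hpow 0 (a - Suc b)) \<in> ?S" if "b < a"
  proof -
    have "colval (a, b, c) b = (hat 0 :: 'k mat3)" using that nu by (simp add: colval_def)
    moreover have "set ([b] @ [c..<b] @ [Suc b..<a]) = {c..<a}" using that nu by auto
    ultimately show ?thesis using oc[of "[b] @ [c..<b] @ [Suc b..<a]"] that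
      by (simp add: lprod_append cl)
  qed
qed

text \<open>When \<open>\<nu>\<close> has two equal rows and all parities agree, products of whole columns only give
  multiples of one matrix; one column has to be interleaved with the others.\<close>

lemma split_pair_column_in_hwvals:
  assumes "c < b"
  defines "Z \<equiv> hpow 2 (b - Suc c) :: 'k::field_char_0 mat3"
  shows "hat 0 ** Z ** hat 1 - hat 1 ** Z ** hat 0 \<in> hwvals3 b b c"
proof -
  let ?nu = "(b, b, c)"
  let ?col = "tab_col ?nu" and ?h = "\<lambda>k. hat (tab_row ?nu k) :: 'k mat3"
  let ?C = "\<lambda>js. concat (map (collist ?nu) js)"
  have nu: "b \<le> b" "c \<le> b" using assms by auto
  have s1: "set [0..<c] \<subseteq> {..<b}" "set [Suc c..<b] \<subseteq> {..<b}" using assms by auto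
  note cc = collist_concat(2)[OF nu distinct_upt s1(1)] collist_concat(2)[OF nu distinct_upt s1(2)]
  have col: "?col c = c" "?col (b + c) = c" using assms by (auto simp: tab_col_def)
  have row: "tab_row ?nu c = 0" "tab_row ?nu (b + c) = 1" using assms by (auto simp: tab_row_def)
  let ?L2 = "c # ?C [Suc c..<b] @ [b + c]"
  have "alt ?col ?h (?C [0..<c] @ ?L2) \<in> (hwvals3 b b c :: ('k mat3) set)"
  proof (rule rearranged_columns_in_hwvals[OF nu])
    have "[0..<b] = [0..<c] @ c # [Suc c..<b]"
      using assms upt_add_eq_append[of 0 c "b - c"] upt_conv_Cons[of c b] by simp
    moreover have "collist ?nu c = [c, b + c]" using assms by (simp add: collist_def)
    ultimately show "mset (?C [0..<c] @ ?L2) = mset (?C [0..<b])" by simp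
  qed
  also have "alt ?col ?h (?C [0..<c] @ ?L2) = alt ?col ?h (?C [0..<c]) ** alt ?col ?h ?L2"
  proof (rule alt_append)
    fix x y assume "x \<in> set (?C [0..<c])" "y \<in> set ?L2"
    then have "x \<in> {k. k < b + b + c \<and> ?col k \<in> set [0..<c]}"
      "y = c \<or> y = b + c \<or> y \<in> {k. k < b + b + c \<and> ?col k \<in> set [Suc c..<b]}"
      unfolding cc[symmetric] by auto
    then show "?col x \<noteq> ?col y" using col by auto
  qed
  also have "alt ?col ?h ?L2 = hat 0 ** Z ** hat 1 - hat 1 ** Z ** hat 0"
  proof (subst alt_pair_wrap)
    show "c \<noteq> b + c" "?col c = ?col (b + c)" using assms col by auto
    show "?col z \<noteq> ?col c" if "z \<in> set (?C [Suc c..<b])" for z using that col unfolding cc(2) by auto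
    have "alt ?col ?h (?C [Suc c..<b]) = Z"
      unfolding alt_concat[OF nu distinct_upt s1(2)] Z_def by (rule colval_lprod(2)[OF nu(2)]) auto
    then show "?h c ** alt ?col ?h (?C [Suc c..<b]) ** ?h (b + c) - ?h (b + c) ** alt ?col ?h (?C [Suc c..<b]) ** ?h c =
        hat 0 ** Z ** hat 1 - hat 1 ** Z ** hat 0" using row by simp
  qed
  also have "alt ?col ?h (?C [0..<c]) = smat ((-2) ^ c) (mat 1)"
    unfolding alt_concat[OF nu distinct_upt s1(1)] by (rule colval_lprod(1)[OF nu(2)])
  finally have "smat ((-2) ^ c) (hat 0 ** Z ** hat 1 - hat 1 ** Z ** hat 0) \<in> hwvals3 b b c"
    by (simp only: smat_mult_left matrix_mul_lid)
  then show ?thesis by (rule hwvals_smatD) simp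
qed

text \<open>The case b = c: two letters of a column of length three stand before the columns of
  length one and the third letter after them. The commutators are again the \<open>hat i\<close>, so
  the matrix is the sum of the products \<open>hat i ** Z ** hat i\<close>. The condition 0 < b
  provides such a column.\<close>

lemma split_triple_column_in_hwvals:
  assumes "b \<le> a" "0 < b"
  defines "Z \<equiv> hpow 0 (a - b) :: 'k::field_char_0 mat3"
  shows "(hat 0 ** hat 1 - hat 1 ** hat 0) ** Z ** hat 2 + (hat 1 ** hat 2 - hat 2 ** hat 1) ** Z ** hat 0 +
    (hat 2 ** hat 0 - hat 0 ** hat 2) ** Z ** hat 1 \<in> hwvals3 a b b" (is "?F Z \<in> _")
proof -
  let ?nu = "(a, b, b)"
  let ?col = "tab_col ?nu" and ?h = "\<lambda>k. hat (tab_row ?nu k) :: 'k mat3"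
  let ?C = "\<lambda>js. concat (map (collist ?nu) js)"
  have nu: "b \<le> a" "b \<le> b" using assms by auto
  have s1: "set [1..<a] \<subseteq> {..<a}" by auto
  note cc = collist_concat[OF nu distinct_upt s1]
  have col: "?col 0 = 0" "?col a = 0" "?col (a + b) = 0" using assms by (auto simp: tab_col_def)
  have row: "tab_row ?nu 0 = 0" "tab_row ?nu a = 1" "tab_row ?nu (a + b) = 2" using assms by (auto simp: tab_row_def)
  let ?L = "0 # a # ?C [1..<a] @ [a + b]"
  have "alt ?col ?h ?L \<in> (hwvals3 a b b :: ('k mat3) set)"
  proof (rule rearranged_columns_in_hwvals[OF nu])
    have "[0..<a] = 0 # [1..<a]" using assms upt_conv_Cons[of 0 a] by simp
    moreover have "collist ?nu 0 = [0, a, a + b]" using assms by (simp add: collist_def)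
    ultimately show "mset ?L = mset (?C [0..<a])" by simp
  qed
  also have "alt ?col ?h ?L = ?F (alt ?col ?h (?C [1..<a]))"
  proof (subst alt_triple_wrap)
    show "0 \<noteq> a" "0 \<noteq> a + b" "a \<noteq> a + b" using assms by auto
    show "?col 0 = ?col a" "?col 0 = ?col (a + b)" using col by auto
    show "?col t \<noteq> ?col 0" if "t \<in> set (?C [1..<a])" for t using that col unfolding cc(2) by auto
  qed (simp add: row)
  also have "alt ?col ?h (?C [1..<a]) = smat ((-2) ^ (b - 1)) Z"
  proof -
    have "[1..<a] = [1..<b] @ [b..<a]" using assms upt_add_eq_append[of 1 b "a - b"] by simp
    moreover have "lprod (map (colval ?nu) [1..<m]) = (smat ((-2) ^ (m - 1)) (mat 1) :: 'k mat3)"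
      if "1 \<le> m" "m \<le> b" for m
      using that
    proof (induction m rule: dec_induct)
      case (step m)
      then have "colval ?nu m = (smat (-2) (mat 1) :: 'k mat3)" by (simp add: colval_def)
      moreover have "(-2) ^ (Suc m - 1) = (-2) ^ (m - 1) * (-2 :: 'k)" using step by (cases m) auto
      ultimately show ?case using step
        by (simp add: lprod_append matrix_mul_rid matrix_mul_lid smat_mult_left smat_mult_right mult.commute)
    qed simp
    ultimately show ?thesis unfolding alt_concat[OF nu distinct_upt s1] Z_def
      using colval_lprod(3)[OF nu(2) order_refl, of a a, where 'k = 'k] assms
      by (simp add: lprod_append smat_mult_left matrix_mul_lid)
  qed
  also have "?F (smat ((-2) ^ (b - 1)) Z) = smat ((-2) ^ (b - 1)) (?F Z)"
    by (simp only: smat_mult_left smat_mult_right smat_add)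
  finally show ?thesis by (rule hwvals_smatD) simp
qed

section \<open>Bases of the spaces of highest weight values\<close>

definition mat_basis :: "('k::field mat3) set \<Rightarrow> nat \<Rightarrow> (nat \<Rightarrow> 'k mat3) \<Rightarrow> bool" where
  "mat_basis S d M \<longleftrightarrow> (\<forall>t<d. M t \<in> S) \<and>
    (\<forall>k. (\<Sum>t<d. smat (k t) (M t)) = 0 \<longrightarrow> (\<forall>t<d. k t = 0)) \<and>
    (\<forall>X\<in>S. \<exists>k. X = (\<Sum>t<d. smat (k t) (M t)))"

lemma mat_basisI:
  assumes "set Ms \<subseteq> S" "\<And>k t. (\<Sum>t<length Ms. smat (k t) (Ms ! t)) = 0 \<Longrightarrow> t < length Ms \<Longrightarrow> k t = 0"
    "\<And>X. X \<in> S \<Longrightarrow> X = (\<Sum>t<length Ms. smat (co X ! t) (Ms ! t))" "d = length Ms"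
  shows "\<exists>M. mat_basis S d M"
  unfolding mat_basis_def assms(4)
proof (intro exI[of _ "(!) Ms"] conjI allI impI ballI)
  show "\<exists>k. X = (\<Sum>t<length Ms. smat (k t) (Ms ! t))" if "X \<in> S" for X
    by (rule exI, rule assms(3)[OF that])
qed (use assms(1,2) in auto)

text \<open>All values are diagonal; a = b identifies the first two entries and b = c the last two,
  which leaves 3, 2, 2 or 1 parameters. In the case b = c < a the assumption \<open>ex\<close>
  supplies a column of length three.\<close>

lemma hwvals_basis_even:
  assumes nu: "b \<le> a" "c \<le> b" and par: "even (a + b)" "even (b + c)" and ex: "0 < b \<or> a = 0"
  shows "\<exists>M. mat_basis (hwvals3 a b c :: ('k::field_char_0 mat3) set) (m_nu (a, b, c)) M"
proof -
  let ?S = "hwvals3 a b c :: ('k mat3) set"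
  note cols = consecutive_columns_in_hwvals[OF nu, where 'k = 'k]
  have par': "even a = even b" "even b = even c" using par by simp_all
  have diag: "X $ 1 $ 2 = 0" "X $ 1 $ 3 = 0" "X $ 2 $ 1 = 0" "X $ 2 $ 3 = 0" "X $ 3 $ 1 = 0" "X $ 3 $ 2 = 0"
    if "X \<in> ?S" for X using hwvals_parity(1,3)[OF that] par by auto
  have ab: "X $ 1 $ 1 = X $ 2 $ 2" if "X \<in> ?S" "a = b" for X
    using hwvals_commute(1)[OF nu that, THEN arg_cong[of _ _ "\<lambda>M. M $ 2 $ 1"]] by (simp add: mat3_simps)
  have bc: "X $ 2 $ 2 = X $ 3 $ 3" if "X \<in> ?S" "b = c" for X
    using hwvals_commute(2)[OF nu that, THEN arg_cong[of _ _ "\<lambda>M. M $ 3 $ 2"]] by (simp add: mat3_simps)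
  consider "c < b" "b < a" | "c < b" "a = b" | "b = c" "b < a" | "b = c" "a = b" using nu by linarith
  then show ?thesis
  proof cases
    case 1
    have e: "even (a - b)" "0 < a - b" "even (b - c)" "0 < b - c" "odd (a - Suc b)" "odd (b - Suc c)" using 1 par by auto
    obtain s t where s: "s \<noteq> 0" "hpow 0 (a - b) = smat s (mat9 0 0 0 0 1 0 0 0 1 :: 'k mat3)"
      and t: "t \<noteq> 0" "hpow 2 (b - c) = smat t (mat9 1 0 0 0 1 0 0 0 0 :: 'k mat3)"
      using hat0_even[OF e(1,2)] hat2_even[OF e(3,4)] by blast
    obtain s' t' where s': "s' \<noteq> 0" "hpow 0 (a - Suc b) = smat s' (hat 0 :: 'k mat3)"
      and t': "t' \<noteq> 0" "hpow 2 (b - Suc c) = smat t' (hat 2 :: 'k mat3)"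
      using hat0_odd[OF e(5)] hat2_odd[OF e(6)] by blast
    \<comment> \<open>The projections for \<open>hat 0\<close> and \<open>hat 2\<close> multiply to
      the middle diagonal unit. The projection for \<open>hat 0\<close> between two factors
      \<open>hat 2\<close> gives minus the first unit, that for \<open>hat 2\<close> between two
      factors \<open>hat 0\<close> minus the last.\<close>
    have E2: "mat9 0 0 0 0 1 0 0 0 0 \<in> ?S"
      by (rule hwvalsI[OF cols(1), of "s * t"])
        (unfold s(2) t(2), simp add: mat3_simps, simp add: s(1) t(1))
    have E1: "mat9 1 0 0 0 0 0 0 0 0 \<in> ?S"
      by (rule hwvalsI[OF cols(3)[OF 1(1)], of "- s * t'"])
        (unfold s(2) t'(2), simp add: mat3_simps, simp add: s(1) t'(1))
    have E3: "mat9 0 0 0 0 0 0 0 0 1 \<in> ?S"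
      by (rule hwvalsI[OF cols(4)[OF 1(2)], of "- t * s'"])
        (unfold t(2) s'(2), simp add: mat3_simps, simp add: t(1) s'(1))
    have m: "m_nu (a, b, c) = 3" using 1 par' by (simp add: m_nu_def)
    show ?thesis unfolding m
      by (rule mat_basisI[of "[mat9 1 0 0 0 0 0 0 0 0, mat9 0 0 0 0 1 0 0 0 0, mat9 0 0 0 0 0 0 0 0 1]" _ "\<lambda>X. [X $ 1 $ 1, X $ 2 $ 2, X $ 3 $ 3]"])
        (use E1 E2 E3 diag in \<open>auto simp: mat3_simps less_Suc_eq\<close>)
  next
    case 2
    have e: "even (b - c)" "0 < b - c" "odd (b - Suc c)" using 2 par by auto
    obtain t where t: "t \<noteq> 0" "hpow 2 (b - c) = smat t (mat9 1 0 0 0 1 0 0 0 0 :: 'k mat3)"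
      using hat2_even[OF e(1,2)] by blast
    obtain t' where t': "t' \<noteq> 0" "hpow 2 (b - Suc c) = smat t' (hat 2 :: 'k mat3)"
      using hat2_odd[OF e(3)] by blast
    have "smat t (mat9 1 0 0 0 1 0 0 0 0) \<in> ?S" using cols(1) 2 t by (simp add: matrix_mul_lid)
    then have P2: "mat9 1 0 0 0 1 0 0 0 0 \<in> ?S" by (rule hwvals_smatD) (use t in simp)
    \<comment> \<open>Both terms of the alternation give the last diagonal unit with the same sign,
      whence the factor 2.\<close>
    have "smat (2 * t') (mat9 0 0 0 0 0 0 0 0 1) = hat 0 ** smat t' (hat 2) ** hat 1 - hat 1 ** smat t' (hat 2) ** hat 0"
      by (simp add: mat3_simps)
    then have "smat (2 * t') (mat9 0 0 0 0 0 0 0 0 1) \<in> ?S"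
      using split_pair_column_in_hwvals[OF 2(1), where 'k = 'k] t' 2 by simp
    then have E3: "mat9 0 0 0 0 0 0 0 0 1 \<in> ?S" by (rule hwvals_smatD) (use t' in simp)
    have m: "m_nu (a, b, c) = 2" using 2 par' by (simp add: m_nu_def)
    show ?thesis unfolding m
      by (rule mat_basisI[of "[mat9 1 0 0 0 1 0 0 0 0, mat9 0 0 0 0 0 0 0 0 1]" _ "\<lambda>X. [X $ 1 $ 1, X $ 3 $ 3]"])
        (use P2 E3 diag ab 2 in \<open>auto simp: mat3_simps less_Suc_eq\<close>)
  next
    case 3
    have e: "even (a - b)" "0 < a - b" "0 < b" using 3 par ex by auto
    obtain s where s: "s \<noteq> 0" "hpow 0 (a - b) = smat s (mat9 0 0 0 0 1 0 0 0 1 :: 'k mat3)"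
      using hat0_even[OF e(1,2)] by blast
    let ?Z = "smat s (mat9 0 0 0 0 1 0 0 0 1) :: 'k mat3"
    have "smat s (mat9 0 0 0 0 1 0 0 0 1) \<in> ?S" using cols(1) 3 s by (simp add: matrix_mul_rid)
    then have P0: "mat9 0 0 0 0 1 0 0 0 1 \<in> ?S" by (rule hwvals_smatD) (use s in simp)
    \<comment> \<open>The summands with \<open>hat 1\<close> and \<open>hat 2\<close> each give the
      first diagonal unit, the one with \<open>hat 0\<close> the other two. The resulting diag(2, 1,
      1) is independent of diag(0, 1, 1).\<close>
    have "smat (- s) (mat9 2 0 0 0 1 0 0 0 1) =
        (hat 0 ** hat 1 - hat 1 ** hat 0) ** ?Z ** hat 2 + (hat 1 ** hat 2 - hat 2 ** hat 1) ** ?Z ** hat 0 +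
        (hat 2 ** hat 0 - hat 0 ** hat 2) ** ?Z ** hat 1"
      by (simp add: mat3_simps)
    then have "smat (- s) (mat9 2 0 0 0 1 0 0 0 1) \<in> ?S"
      using split_triple_column_in_hwvals[OF nu(1) e(3), where 'k = 'k] s 3 by simp
    then have Q: "mat9 2 0 0 0 1 0 0 0 1 \<in> ?S" by (rule hwvals_smatD) (use s in simp)
    have m: "m_nu (a, b, c) = 2" using 3 par' by (simp add: m_nu_def)
    show ?thesis unfolding m
      by (rule mat_basisI[of "[mat9 0 0 0 0 1 0 0 0 1, mat9 2 0 0 0 1 0 0 0 1]" _ "\<lambda>X. [X $ 2 $ 2 - X $ 1 $ 1 / 2, X $ 1 $ 1 / 2]"])
        (use P0 Q diag bc 3 in \<open>auto simp: mat3_simps less_Suc_eq\<close>)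
  next
    case 4
    have I: "mat 1 \<in> ?S" using cols(1) 4 by (simp add: matrix_mul_rid)
    have m: "m_nu (a, b, c) = 1" using 4 par' by (simp add: m_nu_def)
    show ?thesis unfolding m
      by (rule mat_basisI[of "[mat 1]" _ "\<lambda>X. [X $ 1 $ 1]"])
        (use I diag ab bc 4 in \<open>auto simp: mat3_simps mat_def\<close>)
  qed
qed

text \<open>The entries (1,2) and (2,1) survive the parity constraints, and for a > b the two orders
  of the columns realize one each. For a = b commutation with \<open>hat 2\<close> leaves only the
  multiples of \<open>hat 2\<close>.\<close>

lemma hwvals_basis_ii:
  assumes nu: "b \<le> a" "c \<le> b" and par: "even (a + b)" "odd (b + c)"
  shows "\<exists>M. mat_basis (hwvals3 a b c :: ('k::field_char_0 mat3) set) (m_nu (a, b, c)) M"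
proof -
  let ?S = "hwvals3 a b c :: ('k mat3) set"
  note cols = consecutive_columns_in_hwvals[OF nu, where 'k = 'k]
  have par': "even a = even b" "even b \<noteq> even c" using par by auto
  have off: "X $ 1 $ 1 = 0" "X $ 2 $ 2 = 0" "X $ 3 $ 3 = 0" "X $ 2 $ 3 = 0" "X $ 3 $ 2 = 0" "X $ 1 $ 3 = 0" "X $ 3 $ 1 = 0"
    if "X \<in> ?S" for X using hwvals_parity(2,3)[OF that] par by auto
  have e: "odd (b - c)" using par nu by auto
  obtain t where t: "t \<noteq> 0" "hpow 2 (b - c) = smat t (hat 2 :: 'k mat3)"
    using hat2_odd[OF e] by blast
  show ?thesis
  proof (cases "a = b")
    case True
    have "smat t (hat 2) \<in> ?S" using cols(1) True t by (simp add: matrix_mul_lid)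
    then have H: "hat 2 \<in> ?S" by (rule hwvals_smatD) (use t in simp)
    have m: "m_nu (a, b, c) = 1" using True par' by (simp add: m_nu_def)
    have anti: "X $ 1 $ 2 = - X $ 2 $ 1" if "X \<in> ?S" for X
      using hwvals_commute(1)[OF nu that True, THEN arg_cong[of _ _ "\<lambda>M. M $ 1 $ 1"]] by (simp add: mat3_simps)
    show ?thesis unfolding m
      by (rule mat_basisI[of "[hat 2]" _ "\<lambda>X. [X $ 2 $ 1]"])
        (use H off anti in \<open>auto simp: mat3_simps less_Suc_eq\<close>)
  next
    case False
    have e': "even (a - b)" "0 < a - b" using par nu False by auto
    obtain s where s: "s \<noteq> 0" "hpow 0 (a - b) = smat s (mat9 0 0 0 0 1 0 0 0 1 :: 'k mat3)"
      using hat0_even[OF e'] by blast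
    have E21: "mat9 0 0 0 1 0 0 0 0 0 \<in> ?S"
      by (rule hwvalsI[OF cols(1), of "s * t"])
        (unfold s(2) t(2), simp add: mat3_simps, simp add: s(1) t(1))
    have E12: "mat9 0 1 0 0 0 0 0 0 0 \<in> ?S"
      by (rule hwvalsI[OF cols(2), of "- s * t"])
        (unfold s(2) t(2), simp add: mat3_simps, simp add: s(1) t(1))
    have m: "m_nu (a, b, c) = 2" using False par' nu by (simp add: m_nu_def)
    show ?thesis unfolding m
      by (rule mat_basisI[of "[mat9 0 1 0 0 0 0 0 0 0, mat9 0 0 0 1 0 0 0 0 0]" _ "\<lambda>X. [X $ 1 $ 2, X $ 2 $ 1]"])
        (use E12 E21 off in \<open>auto simp: mat3_simps less_Suc_eq\<close>)
  qed
qed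

text \<open>The entries (1,3) and (3,1) survive. Both row differences are odd, so no two consecutive
  rows are equal and the two orders of the columns give the two matrix units.\<close>

lemma hwvals_basis_iii:
  assumes nu: "b \<le> a" "c \<le> b" and par: "odd (a + b)" "odd (b + c)"
  shows "\<exists>M. mat_basis (hwvals3 a b c :: ('k::field_char_0 mat3) set) (m_nu (a, b, c)) M"
proof -
  let ?S = "hwvals3 a b c :: ('k mat3) set"
  note cols = consecutive_columns_in_hwvals[OF nu, where 'k = 'k]
  have off: "X $ 1 $ 1 = 0" "X $ 2 $ 2 = 0" "X $ 3 $ 3 = 0" "X $ 2 $ 3 = 0" "X $ 3 $ 2 = 0" "X $ 1 $ 2 = 0" "X $ 2 $ 1 = 0"
    if "X \<in> ?S" for X using hwvals_parity(2,4)[OF that] par by auto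
  have e: "odd (b - c)" "odd (a - b)" using par nu by auto
  obtain s t where t: "t \<noteq> 0" "hpow 2 (b - c) = smat t (hat 2 :: 'k mat3)"
    and s: "s \<noteq> 0" "hpow 0 (a - b) = smat s (hat 0 :: 'k mat3)"
    using hat2_odd[OF e(1)] hat0_odd[OF e(2)] by blast
  have E31: "mat9 0 0 0 0 0 0 1 0 0 \<in> ?S"
    by (rule hwvalsI[OF cols(1), of "s * t"])
      (unfold s(2) t(2), simp add: mat3_simps, simp add: s(1) t(1))
  have E13: "mat9 0 0 1 0 0 0 0 0 0 \<in> ?S"
    by (rule hwvalsI[OF cols(2), of "s * t"])
      (unfold s(2) t(2), simp add: mat3_simps, simp add: s(1) t(1))
  have m: "m_nu (a, b, c) = 2" using par by (auto simp: m_nu_def)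
  show ?thesis unfolding m
    by (rule mat_basisI[of "[mat9 0 0 1 0 0 0 0 0 0, mat9 0 0 0 0 0 0 1 0 0]" _ "\<lambda>X. [X $ 1 $ 3, X $ 3 $ 1]"])
      (use E13 E31 off in \<open>auto simp: mat3_simps less_Suc_eq\<close>)
qed

text \<open>The entries (2,3) and (3,2) survive, and for b > c each comes from one order of the
  columns. For b = c commutation with \<open>hat 0\<close> leaves only the multiples of
  \<open>hat 0\<close>.\<close>

lemma hwvals_basis_iv:
  assumes nu: "b \<le> a" "c \<le> b" and par: "odd (a + b)" "even (b + c)"
  shows "\<exists>M. mat_basis (hwvals3 a b c :: ('k::field_char_0 mat3) set) (m_nu (a, b, c)) M"
proof -
  let ?S = "hwvals3 a b c :: ('k mat3) set"
  note cols = consecutive_columns_in_hwvals[OF nu, where 'k = 'k]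
  have off: "X $ 1 $ 1 = 0" "X $ 2 $ 2 = 0" "X $ 3 $ 3 = 0" "X $ 1 $ 2 = 0" "X $ 1 $ 3 = 0" "X $ 2 $ 1 = 0" "X $ 3 $ 1 = 0"
    if "X \<in> ?S" for X using hwvals_parity(1,4)[OF that] par by auto
  have par': "even a \<noteq> even b" "even b = even c" using par by auto
  have e: "odd (a - b)" using par nu by auto
  obtain s where s: "s \<noteq> 0" "hpow 0 (a - b) = smat s (hat 0 :: 'k mat3)"
    using hat0_odd[OF e] by blast
  show ?thesis
  proof (cases "b = c")
    case True
    have "smat s (hat 0) \<in> ?S" using cols(1) True s by (simp add: matrix_mul_rid)
    then have H: "hat 0 \<in> ?S" by (rule hwvals_smatD) (use s in simp)
    have m: "m_nu (a, b, c) = 1" using True par' by (auto simp: m_nu_def)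
    have anti: "X $ 2 $ 3 = - X $ 3 $ 2" if "X \<in> ?S" for X
      using hwvals_commute(2)[OF nu that True, THEN arg_cong[of _ _ "\<lambda>M. M $ 2 $ 2"]] by (simp add: mat3_simps)
    show ?thesis unfolding m
      by (rule mat_basisI[of "[hat 0]" _ "\<lambda>X. [X $ 3 $ 2]"])
        (use H off anti in \<open>auto simp: mat3_simps less_Suc_eq\<close>)
  next
    case False
    have e': "even (b - c)" "0 < b - c" using par nu False by auto
    obtain t where t: "t \<noteq> 0" "hpow 2 (b - c) = smat t (mat9 1 0 0 0 1 0 0 0 0 :: 'k mat3)"
      using hat2_even[OF e'] by blast
    have E32: "mat9 0 0 0 0 0 0 0 1 0 \<in> ?S"
      by (rule hwvalsI[OF cols(1), of "s * t"])
        (unfold s(2) t(2), simp add: mat3_simps, simp add: s(1) t(1))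
    have E23: "mat9 0 0 0 0 0 1 0 0 0 \<in> ?S"
      by (rule hwvalsI[OF cols(2), of "- s * t"])
        (unfold s(2) t(2), simp add: mat3_simps, simp add: s(1) t(1))
    have m: "m_nu (a, b, c) = 2" using False par' nu by (auto simp: m_nu_def)
    show ?thesis unfolding m
      by (rule mat_basisI[of "[mat9 0 0 0 0 0 1 0 0 0, mat9 0 0 0 0 0 0 0 1 0]" _ "\<lambda>X. [X $ 2 $ 3, X $ 3 $ 2]"])
        (use E23 E32 off in \<open>auto simp: mat3_simps less_Suc_eq\<close>)
  qed
qed

lemma hwvals_basis:
  assumes "\<nu> \<in> partitions3 n"
  shows "\<exists>M. mat_basis (hwvals n \<nu> :: ('k::field_char_0 mat3) set) (mult_so3 \<nu>) M"
proof -
  obtain a b c where abc: "\<nu> = (a, b, c)" by (cases \<nu>)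
  have nu: "b \<le> a" "c \<le> b" and n: "n = a + b + c" using assms by (auto simp: abc partitions3_iff)
  show ?thesis
  proof (cases "b = 0 \<and> c = 0 \<and> even a \<and> 2 \<le> a")
    case True
    let ?S = "hwvals a (a, 0, 0) :: ('k mat3) set"
    have "hpow 0 a \<in> ?S"
      using consecutive_columns_in_hwvals(1)[of 0 a 0, where 'k = 'k] by (simp add: matrix_mul_rid)
    moreover obtain s where s: "s \<noteq> 0" "hpow 0 a = smat s (mat9 0 0 0 0 1 0 0 0 1 :: 'k mat3)"
      using hat0_even[of a] True by auto
    ultimately have A: "mat9 0 0 0 0 1 0 0 0 1 \<in> ?S" by (metis hwvals_smatD)
    have "X = smat (X $ 2 $ 2) (mat9 0 0 0 0 1 0 0 0 1)" if X: "X \<in> ?S" for X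
    proof -
      obtain t where "X = smat t (hpow 0 a)" using hwvals_one_row[OF X] ..
      then show ?thesis unfolding s(2) by (simp add: vec_eq_iff forall_3 vector_3)
    qed
    then have "\<exists>M. mat_basis ?S 1 M"
      by (intro mat_basisI[of "[mat9 0 0 0 0 1 0 0 0 1]" _ "\<lambda>X. [X $ 2 $ 2]"]) (use A in \<open>auto simp: smat_eq_0_iff vec_eq_iff forall_3\<close>)
    moreover have "mult_so3 \<nu> = 1" using True by (simp add: abc mult_so3_def)
    ultimately show ?thesis using True by (simp add: abc n)
  next
    case False
    then have m: "mult_so3 \<nu> = m_nu \<nu>" by (auto simp: abc mult_so3_def)
    consider "even (a + b)" "even (b + c)" | "even (a + b)" "odd (b + c)" | "odd (a + b)" "odd (b + c)"
      | "odd (a + b)" "even (b + c)" by blast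
    then have "\<exists>M. mat_basis (hwvals3 a b c :: ('k mat3) set) (m_nu (a, b, c)) M"
    proof cases
      case 1
      \<comment> \<open>Outside the exceptional family a shape with equal parities and b = 0 is the
        empty one.\<close>
      have "0 < b \<or> a = 0"
      proof (rule ccontr)
        assume "\<not> (0 < b \<or> a = 0)"
        then have "b = 0" "c = 0" "a \<noteq> 0" "even a" using nu 1 by auto
        moreover from this have "2 \<le> a" by presburger
        ultimately show False using False by blast
      qed
      then show ?thesis
        by (rule hwvals_basis_even[OF nu 1])
    next
      case 2 then show ?thesis by (rule hwvals_basis_ii[OF nu])
    next
      case 3 then show ?thesis by (rule hwvals_basis_iii[OF nu])
    next
      case 4 then show ?thesis by (rule hwvals_basis_iv[OF nu])
    qed
    then show ?thesis unfolding m[unfolded abc] abc n .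
  qed
qed

subsection \<open>Decomposition of the cocharacter\<close>

lemma sum_fibre: "(\<Sum>j\<in>{\<mu>} \<times> A. F j) = (\<Sum>t\<in>A. F (\<mu>, t))"
  by (rule sum.reindex_bij_witness[of _ "\<lambda>t. (\<mu>, t)" snd]) auto

text \<open>This identifies e A modulo the weak identities in it with \<open>hwvals n \<nu>\<close>:
  the row sum contributes a nonzero factor, and value zero at the highest weight word forces value
  zero at all words.\<close>

lemma young_sym_weak_id_iff:
  fixes \<psi> :: "'k::field_char_0 grpalg"
  assumes nu: "\<nu> \<in> partitions3 n" and \<psi>: "\<psi> \<in> Pn n"
  shows "conv n (young_sym \<nu>) \<psi> \<in> weak_ids_Pn n \<longleftrightarrow> wev n (csym n (tab_col \<nu>) \<psi>) (tab_row \<nu>) = 0"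
proof -
  obtain a b c where abc: "\<nu> = (a, b, c)" by (cases \<nu>)
  let ?f = "conv n (young_sym \<nu>) \<psi>" and ?z = "csym n (tab_col \<nu>) \<psi>"
  have f: "?f = rsym n (tab_row \<nu>) ?z" unfolding young_sym_eq[OF nu] conv_assoc ..
  have fP: "?f \<in> Pn n" using \<psi> by (rule conv_Pn)
  have "card (stab n (tab_row \<nu>)) \<noteq> 0" using stab_id[of n "tab_row \<nu>"] by (auto simp: card_eq_0_iff simp del: stab_id)
  then have r0: "wev n ?f (tab_row \<nu>) = 0 \<longleftrightarrow> wev n ?z (tab_row \<nu>) = 0"
    unfolding f wev_rowsum by (simp add: smat_eq_0_iff)
  have "wev n ?f w = 0" if "wev n ?f (tab_row \<nu>) = 0" "\<And>k. k < n \<Longrightarrow> w k < 3" for w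
  proof (rule highest_weight_value_determines[OF _ _ _ that])
    show "act p ?f = ?f" if "p \<in> stab n (tab_row \<nu>)" for p
      unfolding f by (rule act_conv_rowsum[OF that])
    show "rsym n ((tab_row \<nu>)(y := i)) ?f = 0" if "y < n" "i < tab_row \<nu> y" for y i
      using highest_weight[of a b c n y i \<psi>, folded abc] nu that young_sym_eq[OF nu, where 'a = 'k] by simp
  qed (simp add: tab_row_less3)
  then show ?thesis unfolding weak_ids_words using fP r0 tab_row_less3 by blast
qed

lemma specht_eq: "\<nu> \<in> partitions3 n \<Longrightarrow> specht \<nu> = {conv n f (young_sym \<nu>) |f. f \<in> Pn n}"
  by (simp add: specht_def size3_partitions3)

lemma left_ideal_specht: "\<nu> \<in> partitions3 n \<Longrightarrow> left_ideal n (specht \<nu>)"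
  by (simp add: specht_eq left_ideal_principal young_sym_Pn)

lemma findim_left_ideal: "left_ideal n L \<Longrightarrow> findim L"
  using findim_mono[OF findim_Pn] by (auto simp: left_ideal_def)

lemma irr_char_eq:
  assumes nu: "\<nu> \<in> partitions3 n" and \<tau>: "\<tau> \<in> Sn n"
  shows "irr_char \<nu> \<tau> = sub_trace (specht \<nu>) (act \<tau>)"
proof -
  note L = left_ideal_specht[OF nu]
  then have s: "FS.subspace (specht \<nu>)" "act \<tau> ` specht \<nu> \<subseteq> specht \<nu>" using \<tau> by (auto simp: left_ideal_def)
  have "qtrace (specht \<nu>) {0} (act \<tau>) = sub_trace (specht \<nu>) (act \<tau>) - sub_trace {0} (act \<tau>)"
    by (rule qtrace_eq[OF findim_left_ideal[OF L] s]) (use FS.subspace_0[OF s(1)] flinear_act in auto)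
  then show ?thesis by (simp add: irr_char_def sub_trace_0[OF flinear_act])
qed

text \<open>Regularity gives y = y a y; with y = z e this reads y = z (e a y), and the last factor
  vanishes by hypothesis.\<close>

lemma young_sym_separates:
  fixes y :: "'k::field_char_0 grpalg"
  assumes nu: "\<nu> \<in> partitions3 n" and y: "y \<in> specht \<nu>"
    and 0: "\<And>p. p \<in> Pn n \<Longrightarrow> conv n (young_sym \<nu>) (conv n p y) = 0"
  shows "y = 0"
proof -
  obtain z where z: "y = conv n z (young_sym \<nu>)" using y by (auto simp: specht_eq[OF nu])
  have "y \<in> Pn n" unfolding z by (rule conv_Pn[OF young_sym_Pn[OF nu]])
  then obtain a where a: "a \<in> Pn n" "conv n y (conv n a y) = y" using von_neumann_regular by blast
  have "y = conv n z (conv n (young_sym \<nu>) (conv n a y))" using a(2) by (subst (asm) (1) z) (simp only: conv_assoc)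
  then show ?thesis using 0[OF a(1)] by simp
qed

theorem theorem3p7:
  assumes "\<tau> \<in> Sn n"
  shows "(cochar n \<tau> :: 'k::field_char_0) =
           (\<Sum>\<nu>\<in>partitions3 n. of_nat (mult_so3 \<nu>) * irr_char \<nu> \<tau>)"
proof -
  let ?P = "partitions3 n" and ?W = "weak_ids_Pn n :: 'k grpalg set"
  let ?e = "young_sym :: nat \<times> nat \<times> nat \<Rightarrow> (nat \<Rightarrow> nat) \<Rightarrow> 'k"
  let ?val = "\<lambda>\<nu> \<psi>. wev n (csym n (tab_col \<nu>) \<psi>) (tab_row \<nu>) :: 'k mat3"
  note W = left_ideal_weak_ids[of n, where 'k = 'k]
  have subW: "FS.subspace ?W" using W by (simp add: left_ideal_def)
  have subP: "FS.subspace (Pn n :: 'k grpalg set)" by (rule subspace_Pn)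
  have val: "?val \<nu> (\<Sum>t\<in>A. fscale (k t) (u t)) = (\<Sum>t\<in>A. smat (k t) (?val \<nu> (u t)))"
    for \<nu> k u and A :: "nat set" by (simp add: conv_sum conv_scale wev_sum wev_scale)
  \<comment> \<open>A basis of the values is lifted to polynomials \<open>v\<close>, which give
    representatives e v of a basis of e A modulo weak identities.\<close>
  have "\<forall>\<nu>\<in>?P. \<exists>v. (\<forall>t<mult_so3 \<nu>. v t \<in> Pn n) \<and>
      mat_basis (hwvals n \<nu>) (mult_so3 \<nu>) (\<lambda>t. ?val \<nu> (v t))"
  proof
    fix \<nu> assume nu: "\<nu> \<in> ?P"
    obtain M where M: "mat_basis (hwvals n \<nu> :: ('k mat3) set) (mult_so3 \<nu>) M" using hwvals_basis[OF nu] by blast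
    then have "\<forall>t. \<exists>\<psi>. t < mult_so3 \<nu> \<longrightarrow> \<psi> \<in> Pn n \<and> M t = ?val \<nu> \<psi>"
      unfolding mat_basis_def hwvals_def by blast
    then obtain v where v: "\<forall>t. t < mult_so3 \<nu> \<longrightarrow> v t \<in> Pn n \<and> M t = ?val \<nu> (v t)" by (rule choice[THEN exE])
    then have "mat_basis (hwvals n \<nu>) (mult_so3 \<nu>) (\<lambda>t. ?val \<nu> (v t))"
      using M unfolding mat_basis_def by simp
    then show "\<exists>v. (\<forall>t<mult_so3 \<nu>. v t \<in> Pn n) \<and>
        mat_basis (hwvals n \<nu>) (mult_so3 \<nu>) (\<lambda>t. ?val \<nu> (v t))" using v by blast
  qed
  from bchoice[OF this] obtain v where v: "\<forall>\<nu>\<in>?P. (\<forall>t<mult_so3 \<nu>. v \<nu> t \<in> Pn n) \<and>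
      mat_basis (hwvals n \<nu>) (mult_so3 \<nu>) (\<lambda>t. ?val \<nu> (v \<nu> t))" ..
  have vP: "v \<nu> t \<in> Pn n" if "\<nu> \<in> ?P" "t < mult_so3 \<nu>" for \<nu> t using v that by blast
  define J where "J = (SIGMA \<nu>:?P. {..<mult_so3 \<nu>})"
  \<comment> \<open>Right multiplication by one of the chosen polynomials carries the Specht module
    to a copy of it inside \<open>Pn n\<close>.\<close>
  define S where "S = (\<lambda>j. (\<lambda>x. conv n x (v (fst j) (snd j))) ` specht (fst j))"
  have J: "finite J" by (simp add: J_def)
  \<comment> \<open>Left multiplication by e p removes the other shapes and turns each coefficient
    for \<mu> into a scalar multiple of e. The sum becomes e u with u a combination of the chosen
    polynomials; independence of their values makes the scalars zero, and
    \<open>young_sym_separates\<close> gives zero coefficients.\<close>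
  have coeffs0: "\<forall>j\<in>J. y j = 0"
    if y: "\<And>j. j \<in> J \<Longrightarrow> y j \<in> specht (fst j)" and sum: "(\<Sum>j\<in>J. conv n (y j) (v (fst j) (snd j))) \<in> ?W" for y
  proof
    fix j0 assume j0: "j0 \<in> J"
    obtain \<mu> t0 where jmu: "j0 = (\<mu>, t0)" by (cases j0)
    have mu: "\<mu> \<in> ?P" "t0 < mult_so3 \<mu>" using j0 by (auto simp: J_def jmu)
    show "y j0 = 0"
    proof (rule young_sym_separates[of \<mu> n])
      show "\<mu> \<in> ?P" by (rule mu)
      show "y j0 \<in> specht \<mu>" using y[OF j0] by (simp add: jmu)
      fix p :: "'k grpalg" assume p: "p \<in> Pn n"
      have 0: "conv n (?e \<mu>) (conv n p (y j)) = 0" if j: "j \<in> J" "fst j \<noteq> \<mu>" for j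
      proof -
        have nu: "fst j \<in> ?P" using j by (auto simp: J_def)
        obtain z where "y j = conv n z (?e (fst j))" using y[OF j(1)] by (auto simp: specht_eq[OF nu])
        then show ?thesis
          using young_sym_orthogonal[OF mu(1) nu, of "conv n p z"] j(2) by (simp add: conv_assoc)
      qed
      have "\<exists>k. conv n (?e \<mu>) (conv n p (y (\<mu>, t))) = fscale k (?e \<mu>)" if "t < mult_so3 \<mu>" for t
      proof -
        have "y (\<mu>, t) \<in> specht \<mu>" using y[of "(\<mu>, t)"] mu(1) that by (simp add: J_def)
        then obtain z where "y (\<mu>, t) = conv n z (?e \<mu>)" by (auto simp: specht_eq[OF mu(1)])
        then show ?thesis using young_sym_sandwich[OF mu(1), of "conv n p z"] by (simp add: conv_assoc)
      qed
      then have "\<forall>t\<in>{..<mult_so3 \<mu>}. \<exists>k. conv n (?e \<mu>) (conv n p (y (\<mu>, t))) = fscale k (?e \<mu>)" by simp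
      from bchoice[OF this] obtain k
        where k: "\<forall>t\<in>{..<mult_so3 \<mu>}. conv n (?e \<mu>) (conv n p (y (\<mu>, t))) = fscale (k t) (?e \<mu>)" ..
      let ?u = "\<Sum>t<mult_so3 \<mu>. fscale (k t) (v \<mu> t)"
      let ?term = "\<lambda>j. conv n (conv n (?e \<mu>) (conv n p (y j))) (v (fst j) (snd j))"
      have uP: "?u \<in> Pn n" by (intro FS.subspace_sum[OF subP] FS.subspace_scale[OF subP] vP mu(1)) simp
      have "conv n (?e \<mu>) (conv n p (\<Sum>j\<in>J. conv n (y j) (v (fst j) (snd j)))) \<in> ?W"
        by (intro left_ideal_conv[OF W] sum)
      also have "conv n (?e \<mu>) (conv n p (\<Sum>j\<in>J. conv n (y j) (v (fst j) (snd j)))) =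
          (\<Sum>j\<in>J. ?term j)"
        by (simp only: conv_sum conv_assoc)
      also have "\<dots> = (\<Sum>j\<in>{\<mu>} \<times> {..<mult_so3 \<mu>}. ?term j)"
      proof (rule sum.mono_neutral_right[OF J])
        show "{\<mu>} \<times> {..<mult_so3 \<mu>} \<subseteq> J" using mu(1) by (auto simp: J_def)
        show "\<forall>j\<in>J - {\<mu>} \<times> {..<mult_so3 \<mu>}. ?term j = 0"
        proof
          fix j assume j: "j \<in> J - {\<mu>} \<times> {..<mult_so3 \<mu>}"
          then have "fst j \<noteq> \<mu>" by (auto simp: J_def)
          then show "?term j = 0" using 0 j by simp
        qed
      qed
      also have "\<dots> = (\<Sum>t<mult_so3 \<mu>. conv n (conv n (?e \<mu>) (conv n p (y (\<mu>, t)))) (v \<mu> t))"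
        by (simp add: sum_fibre)
      also have "\<dots> = conv n (?e \<mu>) ?u"
        unfolding conv_sum by (intro sum.cong refl) (use k in \<open>simp add: conv_scale conv_scale_left\<close>)
      finally have "?val \<mu> ?u = 0" using young_sym_weak_id_iff[OF mu(1) uP] by simp
      then have "\<forall>t<mult_so3 \<mu>. k t = 0" using v mu(1) unfolding val mat_basis_def by blast
      then show "conv n (?e \<mu>) (conv n p (y j0)) = 0" using k mu(2) by (simp add: jmu)
    qed
  qed
  have S_ideal: "left_ideal n (S j)" if "j \<in> J" for j
  proof -
    have nu: "fst j \<in> ?P" "v (fst j) (snd j) \<in> Pn n" using that vP by (auto simp: J_def)
    note L = left_ideal_specht[OF nu(1), where 'a = 'k, unfolded left_ideal_def]
    let ?h = "\<lambda>x. conv n x (v (fst j) (snd j))"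
    show ?thesis unfolding left_ideal_def S_def
    proof (intro conjI ballI)
      show "FS.subspace (?h ` specht (fst j))"
        using L by (intro FSP.linear_subspace_image[OF flinear_conv_left]) blast
      show "?h ` specht (fst j) \<subseteq> Pn n" using nu conv_Pn by blast
      show "act \<sigma> x \<in> ?h ` specht (fst j)"
        if "\<sigma> \<in> Sn n" "x \<in> ?h ` specht (fst j)" for \<sigma> x
        using that L by (auto simp: act_conv)
    qed
  qed
  have ind: "\<forall>j\<in>J. x j = 0" if x: "\<And>j. j \<in> J \<Longrightarrow> x j \<in> S j" "(\<Sum>j\<in>J. x j) \<in> ?W" for x
  proof -
    have "\<forall>j\<in>J. \<exists>y. y \<in> specht (fst j) \<and> x j = conv n y (v (fst j) (snd j))"
    proof
      fix j assume "j \<in> J"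
      from x(1)[OF this] show "\<exists>y. y \<in> specht (fst j) \<and> x j = conv n y (v (fst j) (snd j))"
        unfolding S_def by blast
    qed
    from bchoice[OF this] obtain y
      where y: "\<forall>j\<in>J. y j \<in> specht (fst j) \<and> x j = conv n (y j) (v (fst j) (snd j))" ..
    have eq: "(\<Sum>j\<in>J. conv n (y j) (v (fst j) (snd j))) = (\<Sum>j\<in>J. x j)" by (rule sum.cong) (use y in simp_all)
    have "\<forall>j\<in>J. y j = 0"
      by (rule coeffs0) (use y in blast, unfold eq, rule x(2))
    then show ?thesis using y by simp
  qed
  define N where "N = {w + (\<Sum>j\<in>J. x j) |w x. w \<in> ?W \<and> (\<forall>j\<in>J. x j \<in> S j)}"
  have dsum: "sub_trace N (act \<sigma>) = sub_trace ?W (act \<sigma>) + (\<Sum>j\<in>J. sub_trace (S j) (act \<sigma>)) \<and>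
      findim N \<and> FS.subspace N \<and> act \<sigma> ` N \<subseteq> N" if \<sigma>: "\<sigma> \<in> Sn n" for \<sigma>
    unfolding N_def
  proof (rule sub_trace_direct_sum[unfolded Let_def, OF J findim_left_ideal[OF W] subW _ flinear_act _ ind])
    show "act \<sigma> ` ?W \<subseteq> ?W" using W \<sigma> by (auto simp: left_ideal_def)
    show "findim (S j) \<and> FS.subspace (S j) \<and> act \<sigma> ` S j \<subseteq> S j" if "j \<in> J" for j
      using findim_left_ideal[OF S_ideal[OF that]] S_ideal[OF that] \<sigma> by (auto simp: left_ideal_def)
  qed
  have WN: "w \<in> N" if "w \<in> ?W" for w
  proof -
    have "w = w + (\<Sum>j\<in>J. 0)" by simp
    moreover have "\<forall>j\<in>J. 0 \<in> S j" using S_ideal by (auto simp: left_ideal_def FS.subspace_0)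
    ultimately show ?thesis unfolding N_def using that by (intro CollectI exI[of _ w] exI[of _ "\<lambda>_. 0"] conjI)
  qed
  have N: "left_ideal n N"
    unfolding left_ideal_def
  proof (intro conjI ballI)
    show "FS.subspace N" using dsum[OF Sn_id] by blast
    show "N \<subseteq> Pn n"
    proof
      fix z assume "z \<in> N"
      then obtain w x where "z = w + (\<Sum>j\<in>J. x j)" "w \<in> ?W" "\<forall>j\<in>J. x j \<in> S j" unfolding N_def by blast
      moreover have "?W \<subseteq> Pn n" "\<And>j. j \<in> J \<Longrightarrow> S j \<subseteq> Pn n" using W S_ideal by (auto simp: left_ideal_def)
      ultimately show "z \<in> Pn n" using FS.subspace_add[OF subP] FS.subspace_sum[OF subP, of J x] by blast
    qed
    show "act \<sigma> x \<in> N" if "\<sigma> \<in> Sn n" "x \<in> N" for \<sigma> x using dsum[OF that(1)] that(2) by blast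
  qed
  \<comment> \<open>Each e z agrees modulo weak identities with a combination of the e v, because
    the chosen values span; so N contains all e z. Whatever is annihilated by all three-colour row
    sums is a weak identity and lies in N as well.\<close>
  have "N = Pn n"
  proof (rule young_ideal_complete[OF N])
    show "y \<in> N" if "y \<in> Pn n" "\<And>r. (\<And>k. k < n \<Longrightarrow> r k < 3) \<Longrightarrow> rsym n r y = 0" for y
      by (rule WN[OF rowsums_faithful[OF that]])
    fix \<nu> and z :: "'k grpalg" assume nu: "\<nu> \<in> ?P" and z: "z \<in> Pn n"
    have "?val \<nu> z \<in> hwvals n \<nu>" using z by (auto simp: hwvals_def)
    then obtain k where k: "?val \<nu> z = (\<Sum>t<mult_so3 \<nu>. smat (k t) (?val \<nu> (v \<nu> t)))"
      using v nu unfolding mat_basis_def by blast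
    let ?u = "\<Sum>t<mult_so3 \<nu>. fscale (k t) (v \<nu> t)"
    have uP: "?u \<in> Pn n" by (intro FS.subspace_sum[OF subP] FS.subspace_scale[OF subP] vP nu) simp
    have "?val \<nu> (z + fscale (-1) ?u) = ?val \<nu> z + smat (-1) (?val \<nu> ?u)"
      by (simp only: conv_add conv_scale wev_add wev_scale)
    also have "\<dots> = 0" unfolding val k by (simp add: vec_eq_iff)
    finally have "?val \<nu> (z + fscale (-1) ?u) = 0" .
    moreover have "z + fscale (-1) ?u \<in> Pn n"
      by (intro FS.subspace_add[OF subP] FS.subspace_scale[OF subP] z uP)
    ultimately have w: "conv n (?e \<nu>) (z + fscale (-1) ?u) \<in> ?W" using young_sym_weak_id_iff[OF nu] by blast
    define x where "x = (\<lambda>j. if fst j = \<nu> then conv n (fscale (k (snd j)) (?e \<nu>)) (v \<nu> (snd j)) else 0)"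
    have eS: "fscale q (?e \<nu>) \<in> specht \<nu>" for q
      unfolding specht_eq[OF nu] using conv_scale_left[of n q "delta id" "?e \<nu>"] FS.subspace_scale[OF subP delta_Pn[OF Sn_id], of q]
      by (auto simp: conv_unit_left intro!: exI[of _ "fscale q (delta id)"])
    have xS: "x j \<in> S j" if "j \<in> J" for j
    proof (cases "fst j = \<nu>")
      case True then show ?thesis using eS by (auto simp: x_def S_def)
    next
      case False then show ?thesis using S_ideal[OF that] by (simp add: x_def left_ideal_def FS.subspace_0)
    qed
    have "(\<Sum>j\<in>J. x j) = (\<Sum>j\<in>{\<nu>} \<times> {..<mult_so3 \<nu>}. x j)"
    proof (rule sum.mono_neutral_right[OF J])
      show "{\<nu>} \<times> {..<mult_so3 \<nu>} \<subseteq> J" using nu by (auto simp: J_def)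
      show "\<forall>j\<in>J - {\<nu>} \<times> {..<mult_so3 \<nu>}. x j = 0" by (auto simp: J_def x_def)
    qed
    also have "\<dots> = (\<Sum>t<mult_so3 \<nu>. x (\<nu>, t))" by (simp add: sum_fibre)
    also have "\<dots> = conv n (?e \<nu>) ?u"
      unfolding conv_sum by (intro sum.cong refl) (simp add: x_def conv_scale conv_scale_left)
    finally have "conv n (?e \<nu>) z = conv n (?e \<nu>) (z + fscale (-1) ?u) + (\<Sum>j\<in>J. x j)"
      by (simp add: conv_diff)
    then show "conv n (?e \<nu>) z \<in> N" unfolding N_def using w xS by blast
  qed
  moreover have "sub_trace (S j) (act \<tau>) = irr_char (fst j) \<tau>" if j: "j \<in> J" for j
  proof -
    have nu: "fst j \<in> ?P" using j by (auto simp: J_def)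
    note L = left_ideal_specht[OF nu, where 'a = 'k]
    have sub: "FS.subspace (specht (fst j) :: 'k grpalg set)" using L by (simp add: left_ideal_def)
    let ?h = "\<lambda>x. conv n x (v (fst j) (snd j))"
    have inj: "inj_on ?h (specht (fst j))"
    proof (rule inj_onI)
      fix x y assume xy: "x \<in> specht (fst j)" "y \<in> specht (fst j)"
        "conv n x (v (fst j) (snd j)) = conv n y (v (fst j) (snd j))"
      \<comment> \<open>A family concentrated at j: its sum is 0, which is a weak identity, so
        \<open>coeffs0\<close> forces x = y.\<close>
      define q where "q = (\<lambda>i. if i = j then x - y else 0)"
      have "\<forall>i\<in>J. q i = 0"
      proof (rule coeffs0)
        show "q i \<in> specht (fst i)" if "i \<in> J" for i
        proof -
          have "fst i \<in> ?P" using that by (auto simp: J_def)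
          from left_ideal_specht[OF this, where 'a = 'k]
          have "FS.subspace (specht (fst i) :: 'k grpalg set)" by (simp only: left_ideal_def)
          then show ?thesis using FS.subspace_diff[OF sub xy(1,2)] by (simp add: q_def FS.subspace_0)
        qed
        have "(\<Sum>i\<in>J. conv n (q i) (v (fst i) (snd i))) = 0"
          by (rule sum.neutral) (use xy(3) in \<open>simp add: q_def conv_diff_left\<close>)
        then show "(\<Sum>i\<in>J. conv n (q i) (v (fst i) (snd i))) \<in> ?W" using FS.subspace_0[OF subW] by simp
      qed
      then have "q j = 0" using j by blast
      then show "x = y" by (simp add: q_def)
    qed
    have "sub_trace (S j) (act \<tau>) = sub_trace (specht (fst j)) (act \<tau>)"
      unfolding S_def
      by (rule sub_trace_iso[OF findim_left_ideal[OF L] sub _ flinear_act flinear_act flinear_conv_left inj])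
        (use L assms in \<open>auto simp: left_ideal_def act_conv\<close>)
    then show ?thesis by (simp add: irr_char_eq[OF nu assms])
  qed
  ultimately have "sub_trace (Pn n) (act \<tau>) = sub_trace ?W (act \<tau>) + (\<Sum>j\<in>J. irr_char (fst j) \<tau>)"
    using dsum[OF assms] by simp
  moreover have "cochar n \<tau> = sub_trace (Pn n) (act \<tau>) - sub_trace ?W (act \<tau>)"
    unfolding cochar_def
    by (rule qtrace_eq[OF findim_Pn subspace_Pn _ subW _ _ flinear_act])
      (use W assms act_Pn in \<open>auto simp: left_ideal_def\<close>)
  moreover have "(\<Sum>j\<in>J. irr_char (fst j) \<tau>) = (\<Sum>\<nu>\<in>?P. of_nat (mult_so3 \<nu>) * irr_char \<nu> \<tau> :: 'k)"
    using sum.Sigma[of ?P "\<lambda>\<nu>. {..<mult_so3 \<nu>}" "\<lambda>\<nu> _. irr_char \<nu> \<tau> :: 'k"]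
    by (simp add: J_def case_prod_beta)
  ultimately show ?thesis by simp
qed

end
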